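(* Let $X$ be a Cantor space and let $CR(X)$ be the set of chain recurrent maps in $C_s(X)$. \begin{itemize} \item[(a)] $CR(X)$ is a conjugacy transitive subset of $C_s(X)$ with a transitive element of residual type. \item[(b)] For a chain recurrent $g \in C_s(X)$, let $g_n \in C_s(X)$ be isomorphic to $n$ disjoint copies of the $n!$-fold suspension of $g$. If $K_0$ is the union of the conjugacy classes of $g_1, g_2, \dots$, then $K_0$ is a dense subset of $CR(X)$. \item[(c)] If $K_1$ is the set of $f \in H(X)$ with a dense set of periodic points, then $K_1$ is a dense subset of $CR(X)$. \item[(d)] For any $Q \subset \mathbb{N}$, the set $C_s(X;Per \supset Q)\cap CR(X)$ is a conjugacy transitive subset of $C_s(X)$. The set $CR(X;1)$ of chain recurrent maps in $C_s(X)$ admitting a fixed point has a conjugacy transitive element of residual type. \end{itemize}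
   Context: A Cantor space is a nonempty, compact, zero-dimensional, perfect metric space. $\mathbb{N}$ is the set of positive integers. $C_s(X)$ is the space of continuous surjections $X\to X$ with the sup metric; $H(X)$ is the group of homeomorphisms of $X$, acting by $f\mapsto h\circ f\circ h^{-1}$; orbits are called conjugacy classes. $Per(f)=\{n\in\mathbb{N}: f^n(x)=x \text{ for some } x\in X\}$ and $C_s(X;Per\supset Q)=\{f\in C_s(X):Q\subset Per(f)\}$. $f\in C_s(X)$ is chain recurrent if for every $\epsilon>0$ and every $x\in X$ there is a finite sequence $x=x_0,x_1,\dots,x_n=x$, $n\ge1$, with $d(f(x_i),x_{i+1})<\epsilon$ for $0\le i<n$. A closed, conjugacy invariant subset $K\subset C_s(X)$ is conjugacy transitive if it is the closure of the conjugacy class of some $f\in K$; such an $f$ is called a (conjugacy) transitive element of $K$; it is of residual type if its conjugacy class is a $G_\delta$ subset of $K$. For a map $g$ on $X$ and $N\in\mathbb{N}$, the $N$-fold suspension is the map $g_N$ on $X\times\{1,\dots,N\}$ with $g_N(x,i)=(x,i+1)$ for $i<N$ and $g_N(x,N)=(g(x),1)$. All the Cantor spaces that arise ($X\times\{1,\dots,N\}$ and finite disjoint unions) are identified with $X$ via homeomorphisms (all Cantor spaces are homeomorphic), so that $g_n$ is well defined up to conjugacy. *)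

theory Defs
  imports "HOL-Analysis.Analysis"
begin

text \<open>A Cantor space is modelled by a metric type whose universe satisfies \<open>cantor_space\<close>.
  On a compact space every continuous function is bounded, so \<open>'a \<Rightarrow>\<^sub>C 'a\<close>
  is the space of all continuous self-maps with the sup metric.\<close>

definition cantor_space :: "'a::metric_space set \<Rightarrow> bool"
  where "cantor_space S \<longleftrightarrow>
    S \<noteq> {} \<and> compact S \<and> top_of_set S dim_le 0 \<and> (\<forall>x\<in>S. x islimpt S)"

definition Cs :: "('a::metric_space \<Rightarrow>\<^sub>C 'a) set"
  where "Cs = {f. surj (apply_bcontfun f)}"

definition self_homeo :: "('a::metric_space \<Rightarrow> 'a) \<Rightarrow> bool"
  where "self_homeo h \<longleftrightarrow> (\<exists>k. homeomorphism UNIV UNIV h k)"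

definition H :: "('a::metric_space \<Rightarrow>\<^sub>C 'a) set"
  where "H = {f. self_homeo (apply_bcontfun f)}"

definition conj_class :: "('a::metric_space \<Rightarrow>\<^sub>C 'a) \<Rightarrow> ('a \<Rightarrow>\<^sub>C 'a) set"
  where "conj_class f =
    {g. \<exists>h. self_homeo h \<and> apply_bcontfun g = h \<circ> apply_bcontfun f \<circ> inv h}"

definition conj_invariant :: "('a::metric_space \<Rightarrow>\<^sub>C 'a) set \<Rightarrow> bool"
  where "conj_invariant K \<longleftrightarrow> (\<forall>f\<in>K. conj_class f \<subseteq> K)"

definition transitive_element ::
    "('a::metric_space \<Rightarrow>\<^sub>C 'a) set \<Rightarrow> ('a \<Rightarrow>\<^sub>C 'a) \<Rightarrow> bool"
  where "transitive_element K f \<longleftrightarrow>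
    closedin (top_of_set Cs) K \<and> conj_invariant K \<and>
    f \<in> K \<and> K = top_of_set Cs closure_of conj_class f"

definition conj_transitive :: "('a::metric_space \<Rightarrow>\<^sub>C 'a) set \<Rightarrow> bool"
  where "conj_transitive K \<longleftrightarrow> (\<exists>f. transitive_element K f)"

definition residual_type ::
    "('a::metric_space \<Rightarrow>\<^sub>C 'a) set \<Rightarrow> ('a \<Rightarrow>\<^sub>C 'a) \<Rightarrow> bool"
  where "residual_type K f \<longleftrightarrow> gdelta_in (top_of_set K) (conj_class f)"

definition dense_subset :: "'b::topological_space set \<Rightarrow> 'b set \<Rightarrow> bool"
  where "dense_subset D K \<longleftrightarrow> D \<subseteq> K \<and> K \<subseteq> closure D"

definition Per :: "('a \<Rightarrow> 'a) \<Rightarrow> nat set"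
  where "Per f = {n. 1 \<le> n \<and> (\<exists>x. (f ^^ n) x = x)}"

definition periodic_points :: "('a \<Rightarrow> 'a) \<Rightarrow> 'a set"
  where "periodic_points f = {x. \<exists>n\<ge>1. (f ^^ n) x = x}"

definition Cs_Per :: "nat set \<Rightarrow> ('a::metric_space \<Rightarrow>\<^sub>C 'a) set"
  where "Cs_Per Q = {f \<in> Cs. Q \<subseteq> Per (apply_bcontfun f)}"

definition chain_recurrent :: "('a::metric_space \<Rightarrow> 'a) \<Rightarrow> bool"
  where "chain_recurrent f \<longleftrightarrow>
    (\<forall>\<epsilon>>0. \<forall>x. \<exists>n\<ge>1. \<exists>s :: nat \<Rightarrow> 'a.
      s 0 = x \<and> s n = x \<and> (\<forall>i<n. dist (f (s i)) (s (Suc i)) < \<epsilon>))"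

definition CR :: "('a::metric_space \<Rightarrow>\<^sub>C 'a) set"
  where "CR = {f \<in> Cs. chain_recurrent (apply_bcontfun f)}"

definition CR1 :: "('a::metric_space \<Rightarrow>\<^sub>C 'a) set"
  where "CR1 = {f \<in> CR. \<exists>x. apply_bcontfun f x = x}"

text \<open>The suspension and the disjoint copies are total functions that are meant on the carriers
  \<open>UNIV \<times> {1..N}\<close> and \<open>Y \<times> {1..n}\<close>; there the product metric
  induces the disjoint-union topology, because \<open>nat\<close> is discrete.\<close>

definition suspension :: "nat \<Rightarrow> ('a \<Rightarrow> 'a) \<Rightarrow> 'a \<times> nat \<Rightarrow> 'a \<times> nat"
  where "suspension N g = (\<lambda>(x, i). if i < N then (x, i + 1) else (g x, 1))"

definition copies :: "('b \<Rightarrow> 'b) \<Rightarrow> 'b \<times> nat \<Rightarrow> 'b \<times> nat"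
  where "copies F = (\<lambda>(y, j). (F y, j))"

definition isomorphic_maps :: "'b::topological_space set \<Rightarrow> ('b \<Rightarrow> 'b) \<Rightarrow>
    'c::topological_space set \<Rightarrow> ('c \<Rightarrow> 'c) \<Rightarrow> bool"
  where "isomorphic_maps Y F Z G \<longleftrightarrow>
    (\<exists>\<phi> \<psi>. homeomorphism Y Z \<phi> \<psi> \<and> (\<forall>y\<in>Y. \<phi> (F y) = G (\<phi> y)))"

text \<open>\<open>suspension_copies g n f\<close>: the map \<open>f\<close> is a version of \<open>g\<^sub>n\<close>,
  which is determined only up to conjugacy.\<close>

definition suspension_copies ::
    "('a::metric_space \<Rightarrow>\<^sub>C 'a) \<Rightarrow> nat \<Rightarrow> ('a \<Rightarrow>\<^sub>C 'a) \<Rightarrow> bool"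
  where "suspension_copies g n f \<longleftrightarrow> f \<in> Cs \<and>
    isomorphic_maps ((UNIV \<times> {1..fact n}) \<times> {1..n})
      (copies (suspension (fact n) (apply_bcontfun g))) UNIV (apply_bcontfun f)"

end

theory Submission
  imports Defs "HOL-Combinatorics.Cycles"
begin

text \<open>
  A label is a continuous function with values in \<open>nat\<close>, in other words a numbered clopen partition.
  On a Cantor space everything about a map up to conjugacy and up to small errors can be said with labels: a label
  \<open>l\<close> turns a map \<open>g\<close> into a finite directed graph on the values of \<open>l\<close>, and \<open>g\<close> is a limit of conjugates
  of \<open>f\<close> as soon as each of these graphs is covered by a label of \<open>f\<close> under which \<open>f\<close> moves along edges
  (\<open>simulates_imp_closure_conj_class\<close>). The reason is the homogeneity of the Cantor space: two clopen
  partitions with equally many pieces are matched by a homeomorphism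
  (\<open>label_preserving_homeomorphism\<close>).

  Chain recurrence of \<open>g\<close> gives a closed walk through every vertex of its graphs (\<open>closed_walks\<close>).
  A map that has many invariant clopen towers, rotated with periods divisible by all small numbers, can
  follow such walks, one tower for each vertex (\<open>cyclic_towers_simulate\<close>). The maps \<open>g\<^sub>n\<close> are made of such towers,
  whence (b). When \<open>g\<close> is the identity they are periodic homeomorphisms, whence (c).

  The generic chain recurrent map is the product of the universal adding machine with the identity of a
  Cantor space. It is characterized by a sequence of conditions, called levels here, each of which is open in the map
  (\<open>adding_level\<close>, \<open>open_adding_off\<close>). Any two maps that satisfy all levels are conjugate (\<open>adding_family_unique\<close>): such
  a map has a factor map to the profinite integers, its fibre over \<open>0\<close> is a Cantor space, and a homeomorphism between
  two such fibres extends along orbits. So the conjugacy class is a \<open>G\<^sub>\<delta>\<close>, and it is dense because of its towers; this is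
  (a). In the presence of a fixed point the generic map has one fixed point and is of the above kind off
  arbitrarily small invariant clopen neighbourhoods of it. Uniqueness follows by gluing conjugacies on shells around
  the fixed point (\<open>pointed_generic_unique\<close>); this is the second half of (d).

  For the first half of (d), only countably many finite graphs have to be covered. The product of
  suitable maps, one for each graph, lives on a countable power of the Cantor space, is chain recurrent, keeps the required
  periods, and covers each graph through one coordinate (\<open>conj_transitive_Cs_Per_CR\<close>).
\<close>

section \<open>Labels on compact metric spaces\<close>

lemma continuous_on_nat_iff:
  fixes l :: "'a::metric_space \<Rightarrow> nat"
  shows "continuous_on S l \<longleftrightarrow> (\<forall>x\<in>S. \<exists>d>0. \<forall>y\<in>S. dist x y < d \<longrightarrow> l y = l x)"
proof -
  have "(\<forall>\<^sub>F y in at x within S. l y = l x) \<longleftrightarrow> (\<exists>d>0. \<forall>y\<in>S. dist x y < d \<longrightarrow> l y = l x)" for x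
    unfolding eventually_at by (metis dist_commute)
  then show ?thesis
    unfolding continuous_on_def tendsto_discrete by simp
qed

text \<open>The Lebesgue number of the partition into fibres. Through it statements about labels are
  turned into statements about distances.\<close>

lemma label_uniform:
  fixes l :: "'a::metric_space \<Rightarrow> nat"
  assumes "compact S" "continuous_on S l"
  obtains d where "d > 0" "\<And>x y. x \<in> S \<Longrightarrow> y \<in> S \<Longrightarrow> dist x y < d \<Longrightarrow> l x = l y"
proof -
  have "continuous_on S (\<lambda>x. real (l x))"
    using assms(2) by (rule continuous_on_of_nat)
  then have "uniformly_continuous_on S (\<lambda>x. real (l x))"
    using assms(1) by (rule compact_uniformly_continuous)
  then obtain d where "d > 0" "\<forall>x\<in>S. \<forall>x'\<in>S. dist x' x < d \<longrightarrow> dist (real (l x')) (real (l x)) < 1"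
    unfolding uniformly_continuous_on_def using zero_less_one by metis
  then show ?thesis
    by (intro that[of d]) (fastforce simp: dist_real_def dist_commute)+
qed

lemma continuous_on_label_fun:
  fixes l :: "'a::metric_space \<Rightarrow> nat" and g :: "nat \<Rightarrow> nat"
  assumes "continuous_on S l"
  shows "continuous_on S (\<lambda>x. g (l x))"
  using assms unfolding continuous_on_nat_iff by metis

lemma continuous_on_label_fun2:
  fixes l m :: "'a::metric_space \<Rightarrow> nat" and g :: "nat \<Rightarrow> nat \<Rightarrow> nat"
  assumes "continuous_on S l" "continuous_on S m"
  shows "continuous_on S (\<lambda>x. g (l x) (m x))"
  unfolding continuous_on_nat_iff
proof
  fix x assume "x \<in> S"
  then obtain d d' where "d > 0" "d' > 0" "\<forall>y\<in>S. dist x y < d \<longrightarrow> l y = l x"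
    "\<forall>y\<in>S. dist x y < d' \<longrightarrow> m y = m x"
    using assms unfolding continuous_on_nat_iff by metis
  then show "\<exists>d>0. \<forall>y\<in>S. dist x y < d \<longrightarrow> g (l y) (m y) = g (l x) (m x)"
    by (intro exI[of _ "min d d'"]) auto
qed

lemma continuous_on_label_comp:
  fixes l :: "'a::metric_space \<Rightarrow> nat"
  assumes "continuous_on T l" "continuous_on S f" "f ` S \<subseteq> T"
  shows "continuous_on S (\<lambda>x. l (f x))"
  using continuous_on_compose2[OF assms] .

lemma finite_label_range:
  fixes l :: "'a::metric_space \<Rightarrow> nat"
  assumes "compact S" "continuous_on S l"
  shows "finite (l ` S)"
proof -
  have "bounded ((\<lambda>x. real (l x)) ` S)"
    using assms continuous_on_of_nat by (blast intro: compact_continuous_image compact_imp_bounded)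
  then obtain B where B: "\<And>x. x \<in> S \<Longrightarrow> real (l x) \<le> B"
    unfolding bounded_iff by auto
  have "l ` S \<subseteq> {..nat \<lfloor>B\<rfloor>}"
    using B by (auto intro: le_nat_floor)
  then show ?thesis
    by (rule finite_subset) simp
qed

lemma compact_fibre:
  fixes l :: "'a::metric_space \<Rightarrow> nat"
  assumes "compact S" "continuous_on S l"
  shows "compact {x \<in> S. l x = v}"
proof -
  have "closed {x \<in> S. l x = v}"
    using continuous_closed_preimage_constant[OF assms(2) compact_imp_closed[OF assms(1)]] .
  then show ?thesis
    using compact_Int_closed[OF assms(1)] by (metis (no_types, lifting) inf.absorb2 mem_Collect_eq subsetI)
qed

lemma nested_compact_nonempty:
  fixes K :: "nat \<Rightarrow> 'a::metric_space set"
  assumes K: "\<And>n. compact (K n)" "\<And>n. K n \<noteq> {}" "\<And>n. K (Suc n) \<subseteq> K n"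
  shows "\<exists>x. \<forall>n. x \<in> K n"
proof -
  have anti: "K n \<subseteq> K m" if "m \<le> n" for m n
    using lift_Suc_antimono_le[of K, OF K(3) that] .
  have "K 0 \<inter> \<Inter> (range K) \<noteq> {}"
  proof (rule compact_imp_fip)
    fix F assume F: "finite F" "F \<subseteq> range K"
    then obtain I where I: "finite I" "F = K ` I"
      by (meson finite_subset_image)
    have "K (Max (insert 0 I)) \<subseteq> K i" if "i \<in> insert 0 I" for i
      using I that by (intro anti Max_ge) auto
    then have "K (Max (insert 0 I)) \<subseteq> K 0 \<inter> \<Inter> F"
      using I by auto
    then show "K 0 \<inter> \<Inter> F \<noteq> {}"
      using K(2) by blast
  qed (use K(1) compact_imp_closed in blast)+
  then show ?thesis by (metis INT_E IntE all_not_in_conv UNIV_I)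
qed

text \<open>Zero-dimensionality of a compact metric space, in the form used throughout: there
  are labels whose fibres are as small as desired.\<close>

definition fine_labels :: "'a::metric_space set \<Rightarrow> bool"
  where "fine_labels S \<longleftrightarrow> (\<forall>e>0. \<exists>l :: 'a \<Rightarrow> nat. continuous_on S l \<and>
    (\<forall>x\<in>S. \<forall>y\<in>S. l x = l y \<longrightarrow> dist x y < e))"

lemma fine_labels_subset: "fine_labels S \<Longrightarrow> T \<subseteq> S \<Longrightarrow> fine_labels T"
  unfolding fine_labels_def by (meson continuous_on_subset subsetD)

text \<open>A finite cover by small clopen sets is made into a partition by sending each point
  to the first set of the list that contains it.\<close>

lemma zero_dim_imp_fine_labels:
  fixes S :: "'a::metric_space set"
  assumes "compact S" "top_of_set S dim_le 0"
  shows "fine_labels S"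
  unfolding fine_labels_def
proof (intro allI impI)
  fix e :: real assume "e > 0"
  have "\<exists>U. x \<in> U \<and> U \<subseteq> ball x (e/2) \<and> openin (top_of_set S) U \<and> closedin (top_of_set S) U"
    if "x \<in> S" for x
  proof -
    have "openin (top_of_set S) (S \<inter> ball x (e/2))" "x \<in> S \<inter> ball x (e/2)"
      using that \<open>e > 0\<close> by auto
    moreover have "\<forall>x\<in>topspace (top_of_set S). \<forall>W. openin (top_of_set S) W \<and> x \<in> W \<longrightarrow>
        (\<exists>U V. openin (top_of_set S) U \<and> (closedin (top_of_set S) V \<and> openin (top_of_set S) V) \<and> x \<in> U \<and> U \<subseteq> V \<and> V \<subseteq> W)"
      using assms(2) unfolding dimension_le_0_neighbourhood_base_of_clopen neighbourhood_base_of_def neighbourhood_base_at_def .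
    ultimately obtain U V where "openin (top_of_set S) U" "closedin (top_of_set S) V \<and> openin (top_of_set S) V"
       "x \<in> U" "U \<subseteq> V" "V \<subseteq> S \<inter> ball x (e/2)"
      using that by (elim ballE[of _ _ x] allE[of _ "S \<inter> ball x (e/2)"]) auto
    then show ?thesis by blast
  qed
  then obtain U where U: "\<And>x. x \<in> S \<Longrightarrow> x \<in> U x \<and> U x \<subseteq> ball x (e/2) \<and> openin (top_of_set S) (U x) \<and> closedin (top_of_set S) (U x)"
    by metis
  have "(\<forall>c\<in>U ` S. openin (top_of_set S) c) \<and> S \<subseteq> \<Union> (U ` S)"
    using U by blast
  then have "\<exists>D\<subseteq>U ` S. finite D \<and> S \<subseteq> \<Union> D"
    using \<open>compact S\<close>[unfolded compact_eq_openin_cover] by (elim allE[of _ "U ` S"] impE)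
  then obtain D where D: "D \<subseteq> U ` S" "finite D" "S \<subseteq> \<Union> D" by blast
  obtain c where c: "set c = D"
    using finite_list[OF D(2)] by blast
  define l where "l x = (LEAST i. i < length c \<and> x \<in> c ! i)" for x
  have l: "l x < length c \<and> x \<in> c ! l x" if "x \<in> S" for x
  proof -
    have "\<exists>i. i < length c \<and> x \<in> c ! i"
      using that D c by (metis UnionE in_set_conv_nth subsetD)
    then show ?thesis unfolding l_def by (rule LeastI_ex)
  qed
  have clo: "openin (top_of_set S) (c ! i) \<and> closedin (top_of_set S) (c ! i)" if "i < length c" for i
  proof -
    have "c ! i \<in> U ` S" using that c D nth_mem by blast
    then show ?thesis using U by auto
  qed
  have "continuous_on S l"
    unfolding continuous_on_nat_iff
  proof
    fix x assume x: "x \<in> S"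
    define W where "W = c ! l x \<inter> (\<Inter>i<l x. S - c ! i) \<inter> S"
    have "openin (top_of_set S) (S \<inter> (\<Inter>i\<in>{..<l x}. S - c ! i))"
    proof (cases "l x = 0")
      case False
      then show ?thesis
        using clo l[OF x] by (intro openin_Int openin_INT2 openin_diff) auto
    qed simp
    then have "openin (top_of_set S) W"
      unfolding W_def using clo l[OF x] by (metis (no_types, lifting) Int_commute inf_assoc openin_Int)
    moreover have "x \<in> W"
    proof -
      have "x \<notin> c ! i" if "i < l x" for i
        using not_less_Least[of i "\<lambda>i. i < length c \<and> x \<in> c ! i"] that l[OF x] unfolding l_def by linarith
      then show ?thesis using l[OF x] x by (auto simp: W_def)
    qed
    ultimately obtain d where d: "d > 0" "ball x d \<inter> S \<subseteq> W"
      by (metis openin_contains_ball)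
    have "l y = l x" if "y \<in> W" for y
      using that l[OF x] unfolding W_def l_def[of y]
      by (intro Least_equality) (auto simp: not_less[symmetric] split: if_splits)
    then show "\<exists>d>0. \<forall>y\<in>S. dist x y < d \<longrightarrow> l y = l x"
      using d by (metis IntI mem_ball subsetD)
  qed
  moreover have "dist x y < e" if "x \<in> S" "y \<in> S" "l x = l y" for x y
  proof -
    obtain z where "z \<in> S" "c ! l x = U z"
      using l[OF \<open>x \<in> S\<close>] c D by (metis (no_types, lifting) imageE nth_mem subsetD)
    then have "x \<in> ball z (e/2)" "y \<in> ball z (e/2)"
      using l that U by (metis subsetD)+
    then show ?thesis
      using dist_triangle_half_r[of z x e y] by simp
  qed
  ultimately show "\<exists>l :: 'a \<Rightarrow> nat. continuous_on S l \<and> (\<forall>x\<in>S. \<forall>y\<in>S. l x = l y \<longrightarrow> dist x y < e)"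
    by blast
qed

lemma fine_labels_imp_zero_dim:
  fixes S :: "'a::metric_space set"
  assumes "fine_labels S"
  shows "top_of_set S dim_le 0"
  unfolding dimension_le_0_neighbourhood_base_of_clopen neighbourhood_base_of_def neighbourhood_base_at_def
proof (intro ballI allI impI, elim conjE)
  fix W x assume W: "openin (top_of_set S) W" "x \<in> W"
  then obtain e where e: "e > 0" "ball x e \<inter> S \<subseteq> W" and x: "x \<in> S"
    by (metis openin_contains_ball subsetD)
  obtain l :: "'a \<Rightarrow> nat" where l: "continuous_on S l" "\<forall>x\<in>S. \<forall>y\<in>S. l x = l y \<longrightarrow> dist x y < e"
    using assms e unfolding fine_labels_def by blast
  define U where "U = S \<inter> l -` {l x}"
  have "openin (top_of_set S) U"
    unfolding U_def using l(1) by (rule continuous_openin_preimage_gen) (simp add: open_discrete)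
  moreover have "closedin (top_of_set S) U"
    unfolding U_def using l(1) by (rule continuous_closedin_preimage) simp
  moreover have "x \<in> U" "U \<subseteq> W"
    using x l(2) e by (auto simp: U_def)
  ultimately show "\<exists>U V. openin (top_of_set S) U \<and> (closedin (top_of_set S) V \<and> openin (top_of_set S) V) \<and>
      x \<in> U \<and> U \<subseteq> V \<and> V \<subseteq> W"
    by blast
qed

lemma cantor_space_iff:
  "cantor_space S \<longleftrightarrow> S \<noteq> {} \<and> compact S \<and> fine_labels S \<and> (\<forall>x\<in>S. \<forall>e>0. \<exists>y\<in>S. y \<noteq> x \<and> dist x y < e)"
  unfolding cantor_space_def islimpt_approachable
  using zero_dim_imp_fine_labels fine_labels_imp_zero_dim by (metis dist_commute)

lemma cantor_space_clopen_subset: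
  fixes S T :: "'a::metric_space set"
  assumes "cantor_space S" "T \<subseteq> S" "T \<noteq> {}" "closed T" "openin (top_of_set S) T"
  shows "cantor_space T"
  unfolding cantor_space_iff
proof (intro conjI ballI allI impI)
  show "compact T"
    using assms by (metis cantor_space_iff compact_Int_closed inf.absorb2)
  show "fine_labels T"
    using assms fine_labels_subset cantor_space_iff by blast
  fix x and e :: real assume "x \<in> T" "e > 0"
  then obtain d where d: "d > 0" "ball x d \<inter> S \<subseteq> T"
    using assms by (metis openin_contains_ball)
  obtain y where "y \<in> S" "y \<noteq> x" "dist x y < min d e"
    using assms \<open>x \<in> T\<close> \<open>e > 0\<close> d unfolding cantor_space_iff
    by (metis min_less_iff_conj subsetD)
  then show "\<exists>y\<in>T. y \<noteq> x \<and> dist x y < e"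
    using d by (intro bexI[of _ y]) auto
qed (use assms in auto)

text \<open>Homeomorphisms are built from their graphs: both projections of a compact graph are
  continuous bijections from a compact space, so they are homeomorphisms.\<close>

lemma compact_graph_homeomorphism:
  fixes S :: "'a::metric_space set" and T :: "'b::metric_space set"
  assumes \<Gamma>: "compact \<Gamma>" "fst ` \<Gamma> = S" "snd ` \<Gamma> = T"
    and uni: "\<And>x y y'. (x, y) \<in> \<Gamma> \<Longrightarrow> (x, y') \<in> \<Gamma> \<Longrightarrow> y = y'"
    and inj: "\<And>x x' y. (x, y) \<in> \<Gamma> \<Longrightarrow> (x', y) \<in> \<Gamma> \<Longrightarrow> x = x'"
  obtains h k where "homeomorphism S T h k" "\<And>x. x \<in> S \<Longrightarrow> (x, h x) \<in> \<Gamma>"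
proof -
  have "inj_on fst \<Gamma>" "inj_on snd \<Gamma>"
    using uni inj by (auto simp: inj_on_def)
  then obtain p q where p: "homeomorphism \<Gamma> S fst p" and q: "homeomorphism \<Gamma> T snd q"
    using homeomorphism_compact[OF \<Gamma>(1) continuous_on_fst[OF continuous_on_id] \<Gamma>(2)]
      homeomorphism_compact[OF \<Gamma>(1) continuous_on_snd[OF continuous_on_id] \<Gamma>(3)] by blast
  have "homeomorphism S T (snd \<circ> p) (fst \<circ> q)"
    using homeomorphism_compose[OF homeomorphism_symD[OF p] q] .
  moreover have "(x, (snd \<circ> p) x) \<in> \<Gamma>" if "x \<in> S" for x
    using p that unfolding homeomorphism_def by (metis comp_apply image_eqI prod.collapse)
  ultimately show ?thesis using that by blast
qed

section \<open>Cantor spaces are homeomorphic, compatibly with labels\<close>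

text \<open>One piece at a time is split off with a label that separates two points; what remains is
  again a Cantor space.\<close>

lemma perfect_label_surj:
  fixes T :: "'a::metric_space set"
  assumes "cantor_space T" "finite F" "F \<noteq> {}"
  shows "\<exists>l :: 'a \<Rightarrow> nat. continuous_on T l \<and> l ` T = F"
  using assms(2,3,1)
proof (induction F arbitrary: T rule: finite_ne_induct)
  case (singleton v)
  then show ?case
    by (intro exI[of _ "\<lambda>_. v"]) (auto simp: cantor_space_iff)
next
  case (insert v F)
  obtain x y where xy: "x \<in> T" "y \<in> T" "y \<noteq> x"
    using insert.prems unfolding cantor_space_iff by (metis ex_in_conv zero_less_one)
  obtain m :: "'a \<Rightarrow> nat" where "continuous_on T m" "\<forall>p\<in>T. \<forall>q\<in>T. m p = m q \<longrightarrow> dist p q < dist x y"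
    using insert.prems xy unfolding cantor_space_iff fine_labels_def by (metis zero_less_dist_iff)
  then have m: "continuous_on T m" "m x \<noteq> m y"
    using xy by (auto dest: bspec)
  define A where "A = {z \<in> T. m z \<noteq> m x}"
  have opn: "openin (top_of_set T) A"
  proof -
    have "A = T \<inter> m -` (- {m x})" by (auto simp: A_def)
    then show ?thesis
      using continuous_openin_preimage_gen[OF m(1)] by (simp add: open_discrete)
  qed
  have "closed A"
  proof -
    have "compact {z \<in> T. (if m z = m x then 1 else (0::nat)) = 0}"
      using insert.prems m(1) unfolding cantor_space_iff
      by (intro compact_fibre continuous_on_label_fun[of T m "\<lambda>v. if v = m x then 1 else 0"]) auto
    moreover have "A = {z \<in> T. (if m z = m x then 1 else (0::nat)) = 0}" by (auto simp: A_def)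
    ultimately show ?thesis using compact_imp_closed by metis
  qed
  then have "cantor_space A"
    using opn xy m by (intro cantor_space_clopen_subset[OF insert.prems]) (auto simp: A_def)
  then obtain l :: "'a \<Rightarrow> nat" where l: "continuous_on A l" "l ` A = F"
    using insert.IH by blast
  define l' where "l' z = (if m z = m x then v else l z)" for z
  have "continuous_on T l'"
    unfolding continuous_on_nat_iff
  proof
    fix z assume z: "z \<in> T"
    obtain d where d: "d > 0" "\<forall>y\<in>T. dist z y < d \<longrightarrow> m y = m z"
      using m(1) z unfolding continuous_on_nat_iff by blast
    show "\<exists>d>0. \<forall>y\<in>T. dist z y < d \<longrightarrow> l' y = l' z"
    proof (cases "m z = m x")
      case True
      then show ?thesis using d by (auto simp: l'_def)
    next
      case False
      then have "z \<in> A" using z by (simp add: A_def)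
      then obtain d' where d': "d' > 0" "\<forall>y\<in>A. dist z y < d' \<longrightarrow> l y = l z"
        using l(1) unfolding continuous_on_nat_iff by blast
      then show ?thesis
        using d False by (intro exI[of _ "min d d'"]) (auto simp: l'_def A_def)
    qed
  qed
  moreover have "l' ` T = insert v F"
  proof -
    have "l' ` T = l' ` A \<union> l' ` (T - A)" by (auto simp: A_def)
    moreover have "l' ` A = l ` A" by (rule image_cong) (auto simp: l'_def A_def)
    moreover have "l' ` (T - A) = {v}" using xy by (force simp: l'_def A_def)
    ultimately show ?thesis using l by auto
  qed
  ultimately show ?case by blast
qed

text \<open>One half of a back-and-forth step. The label on \<open>S\<close> is refined until
  its fibres are small. On \<open>T\<close> no smallness is asked for, so each fibre there only
  has to be split into as many pieces as the corresponding fibre of \<open>S\<close>.\<close>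

lemma refine_matching_labels:
  fixes S :: "'a::metric_space set" and T :: "'b::metric_space set"
  assumes S: "cantor_space S" and T: "cantor_space T"
    and l: "continuous_on S l" and m: "continuous_on T m" and eq: "l ` S = m ` T" and "e > 0"
  shows "\<exists>l' m'. continuous_on S l' \<and> continuous_on T m' \<and> l' ` S = (m' ` T :: nat set) \<and>
    (\<forall>x\<in>S. \<forall>y\<in>S. l' x = l' y \<longrightarrow> dist x y < e) \<and>
    (\<exists>r :: nat \<Rightarrow> nat. (\<forall>x\<in>S. r (l' x) = l x) \<and> (\<forall>y\<in>T. r (m' y) = m y))"
proof -
  obtain k :: "'a \<Rightarrow> nat" where k: "continuous_on S k" "\<forall>x\<in>S. \<forall>y\<in>S. k x = k y \<longrightarrow> dist x y < e"
    using S \<open>e > 0\<close> unfolding cantor_space_iff fine_labels_def by blast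
  have "\<exists>n :: 'b \<Rightarrow> nat. continuous_on {y \<in> T. m y = v} n \<and> n ` {y \<in> T. m y = v} = k ` {x \<in> S. l x = v}"
    if v: "v \<in> l ` S" for v
  proof (rule perfect_label_surj)
    show "finite (k ` {x \<in> S. l x = v})" 
      using finite_label_range[OF _ k(1)] S unfolding cantor_space_iff
      by (auto intro: finite_subset[rotated])
    show "k ` {x \<in> S. l x = v} \<noteq> {}" using v by auto
    have "{y \<in> T. m y = v} = T \<inter> m -` {v}" by auto
    then have "openin (top_of_set T) {y \<in> T. m y = v}"
      using continuous_openin_preimage_gen[OF m] by (simp add: open_discrete)
    moreover have "closed {y \<in> T. m y = v}"
      using compact_fibre[OF _ m] T compact_imp_closed unfolding cantor_space_iff by blast
    ultimately show "cantor_space {y \<in> T. m y = v}"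
      using v eq by (intro cantor_space_clopen_subset[OF T]) auto
  qed
  then have "\<exists>n. \<forall>v\<in>l ` S. continuous_on {y \<in> T. m y = v} (n v) \<and> n v ` {y \<in> T. m y = v} = k ` {x \<in> S. l x = v}"
    by (intro bchoice) auto
  then obtain n :: "nat \<Rightarrow> 'b \<Rightarrow> nat" where n: "\<And>v. v \<in> l ` S \<Longrightarrow> continuous_on {y \<in> T. m y = v} (n v)"
      "\<And>v. v \<in> l ` S \<Longrightarrow> n v ` {y \<in> T. m y = v} = k ` {x \<in> S. l x = v}"
    by blast
  define l' where "l' x = prod_encode (l x, k x)" for x
  define m' where "m' y = prod_encode (m y, n (m y) y)" for y
  have "continuous_on S l'"
    unfolding l'_def using l k(1) by (rule continuous_on_label_fun2)
  moreover have "continuous_on T m'"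
    unfolding continuous_on_nat_iff
  proof
    fix z assume z: "z \<in> T"
    obtain d where d: "d > 0" "\<forall>y\<in>T. dist z y < d \<longrightarrow> m y = m z"
      using m z unfolding continuous_on_nat_iff by blast
    have "m z \<in> l ` S" using z eq by auto
    then obtain d' where d': "d' > 0" "\<forall>y\<in>{y\<in>T. m y = m z}. dist z y < d' \<longrightarrow> n (m z) y = n (m z) z"
      using n(1)[of "m z"] z unfolding continuous_on_nat_iff by blast
    then show "\<exists>d>0. \<forall>y\<in>T. dist z y < d \<longrightarrow> m' y = m' z"
      using d by (intro exI[of _ "min d d'"]) (auto simp: m'_def)
  qed
  moreover have "l' ` S = m' ` T"
  proof (intro equalityI image_subsetI)
    fix x assume "x \<in> S"
    then have "k x \<in> n (l x) ` {y \<in> T. m y = l x}" using n(2)[of "l x"] by auto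
    then obtain y where "y \<in> T" "m y = l x" "k x = n (l x) y" by auto
    then show "l' x \<in> m' ` T" by (auto simp: l'_def m'_def intro!: image_eqI[of _ _ y])
  next
    fix y assume "y \<in> T"
    then have "n (m y) y \<in> k ` {x \<in> S. l x = m y}" using n(2)[of "m y"] eq by auto
    then obtain x where "x \<in> S" "l x = m y" "n (m y) y = k x" by auto
    then show "m' y \<in> l' ` S" by (auto simp: l'_def m'_def intro!: image_eqI[of _ _ x])
  qed
  moreover have "\<forall>x\<in>S. \<forall>y\<in>S. l' x = l' y \<longrightarrow> dist x y < e"
    using k(2) by (auto simp: l'_def)
  moreover have "(\<forall>x\<in>S. fst (prod_decode (l' x)) = l x) \<and> (\<forall>y\<in>T. fst (prod_decode (m' y)) = m y)"
    by (auto simp: l'_def m'_def)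
  ultimately show ?thesis by (intro exI[of _ l'] exI[of _ m'] conjI exI[of _ "\<lambda>i. fst (prod_decode i)"]) auto
qed

lemma label_sequence_separates:
  fixes L :: "nat \<Rightarrow> 'a::metric_space \<Rightarrow> nat"
  assumes mesh: "\<And>n. \<forall>x\<in>S. \<forall>y\<in>S. L (Suc n) x = L (Suc n) y \<longrightarrow> dist x y < 1 / Suc n"
    and "\<And>n. L n x = L n y" "x \<in> S" "y \<in> S"
  shows "x = y"
proof (rule ccontr)
  assume "x \<noteq> y"
  then obtain n where "1 / real (Suc n) < dist x y"
    by (metis inverse_eq_divide reals_Archimedean zero_less_dist_iff)
  then show False using mesh[of n] assms(2-4) by force
qed

text \<open>This provides the partner of a point in the back-and-forth construction, by compactness.\<close>

lemma label_sequence_realized: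
  fixes L :: "nat \<Rightarrow> 'a::metric_space \<Rightarrow> nat"
  assumes "compact S" "\<And>n. continuous_on S (L n)" "\<And>n. v n \<in> L n ` S"
    and r: "\<And>n x. x \<in> S \<Longrightarrow> r n (L (Suc n) x) = L n x" "\<And>n. r n (v (Suc n)) = v n"
  shows "\<exists>x\<in>S. \<forall>n. L n x = v n"
proof -
  have "\<exists>x. \<forall>n. x \<in> {x \<in> S. L n x = v n}"
  proof (rule nested_compact_nonempty)
    show "compact {x \<in> S. L n x = v n}" for n using compact_fibre[OF assms(1,2)] .
    show "{x \<in> S. L n x = v n} \<noteq> {}" for n using assms(3)[of n] by auto
    show "{x \<in> S. L (Suc n) x = v (Suc n)} \<subseteq> {x \<in> S. L n x = v n}" for n
      using r by (auto, metis)
  qed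
  then show ?thesis by blast
qed

text \<open>Brouwer's characterization of the Cantor space, with a prescribed matching of clopen
  partitions. Back and forth gives two sequences of ever finer labels with the same ranges and
  the same refinement maps; points with the same sequence of labels correspond to each other.\<close>

theorem label_preserving_homeomorphism:
  fixes S :: "'a::metric_space set" and T :: "'b::metric_space set"
  assumes S: "cantor_space S" and T: "cantor_space T"
    and l: "continuous_on S l" and m: "continuous_on T m" and eq: "l ` S = (m ` T :: nat set)"
  obtains h k where "homeomorphism S T h k" "\<And>x. x \<in> S \<Longrightarrow> m (h x) = l x"
proof -
  define ok :: "('a \<Rightarrow> nat) \<times> ('b \<Rightarrow> nat) \<Rightarrow> bool"
    where "ok p \<longleftrightarrow> continuous_on S (fst p) \<and> continuous_on T (snd p) \<and> fst p ` S = snd p ` T" for p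
  define mesh :: "real \<Rightarrow> ('a \<Rightarrow> nat) \<times> ('b \<Rightarrow> nat) \<Rightarrow> bool" where
    "mesh e p \<longleftrightarrow> (\<forall>x\<in>S. \<forall>y\<in>S. fst p x = fst p y \<longrightarrow> dist x y < e) \<and> (\<forall>x\<in>T. \<forall>y\<in>T. snd p x = snd p y \<longrightarrow> dist x y < e)"
    for e p
  define refi :: "('a \<Rightarrow> nat) \<times> ('b \<Rightarrow> nat) \<Rightarrow> ('a \<Rightarrow> nat) \<times> ('b \<Rightarrow> nat) \<Rightarrow> bool" where
    "refi q p \<longleftrightarrow> (\<exists>r. (\<forall>x\<in>S. r (fst q x) = fst p x) \<and> (\<forall>y\<in>T. r (snd q y) = snd p y))" for p q
  have step: "\<exists>q. ok q \<and> mesh e q \<and> refi q p" if p: "ok p" and "e > 0" for p e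
  proof -
    have 0: "continuous_on S (fst p)" "continuous_on T (snd p)" "fst p ` S = snd p ` T"
      using p by (auto simp: ok_def)
    obtain l1 m1 and r1 :: "nat \<Rightarrow> nat" where 1: "continuous_on S l1" "continuous_on T m1" "l1 ` S = (m1 ` T :: nat set)"
        "\<forall>x\<in>S. \<forall>y\<in>S. l1 x = l1 y \<longrightarrow> dist x y < e" "\<forall>x\<in>S. r1 (l1 x) = fst p x" "\<forall>y\<in>T. r1 (m1 y) = snd p y"
      using refine_matching_labels[OF S T 0 \<open>e > 0\<close>] by (elim exE conjE) (rule that)
    obtain l2 m2 and r2 :: "nat \<Rightarrow> nat" where 2: "continuous_on S l2" "continuous_on T m2" "l2 ` S = (m2 ` T :: nat set)"
        "\<forall>x\<in>T. \<forall>y\<in>T. m2 x = m2 y \<longrightarrow> dist x y < e" "\<forall>x\<in>S. r2 (l2 x) = l1 x" "\<forall>y\<in>T. r2 (m2 y) = m1 y"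
      using refine_matching_labels[OF T S 1(2,1) 1(3)[symmetric] \<open>e > 0\<close>]
      by (elim exE conjE) (rule that[OF _ _ sym])
    have "ok (l2, m2)" using 2 by (simp add: ok_def)
    moreover have "mesh e (l2, m2)"
      using 1(4) 2(4,5) unfolding mesh_def by (metis fst_conv snd_conv)
    moreover have "refi (l2, m2) p"
      unfolding refi_def using 1(5,6) 2(5,6) by (intro exI[of _ "r1 \<circ> r2"]) auto
    ultimately show ?thesis by blast
  qed
  have "\<exists>p. p 0 = (l, m) \<and> (\<forall>n. ok (p n) \<and> (mesh (1 / Suc n) (p (Suc n)) \<and> refi (p (Suc n)) (p n)))"
  proof -
    define p where "p = rec_nat (l, m) (\<lambda>n q. SOME q'. ok q' \<and> mesh (1 / Suc n) q' \<and> refi q' q)"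
    have S': "ok (p (Suc n)) \<and> mesh (1 / Suc n) (p (Suc n)) \<and> refi (p (Suc n)) (p n)" if "ok (p n)" for n
      unfolding p_def using someI_ex[OF step[OF that, of "1 / Suc n"]] by (simp add: p_def)
    have "ok (p n)" for n
    proof (induction n)
      case 0 then show ?case using l m eq by (simp add: p_def ok_def)
    next
      case (Suc n) then show ?case using S' by blast
    qed
    then show ?thesis using S' by (intro exI[of _ p]) (auto simp: p_def)
  qed
  then obtain p where p0: "p 0 = (l, m)" and ok: "\<And>n. ok (p n)"
    and fine: "\<And>n. mesh (1 / Suc n) (p (Suc n))" and refi: "\<And>n. refi (p (Suc n)) (p n)"
    by metis
  define L where "L n = fst (p n)" for n
  define M where "M n = snd (p n)" for n
  have LM: "continuous_on S (L n)" "continuous_on T (M n)" "L n ` S = M n ` T" for n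
    using ok[of n] by (auto simp: ok_def L_def M_def)
  obtain r where r: "\<And>n x. x \<in> S \<Longrightarrow> r n (L (Suc n) x) = L n x" "\<And>n y. y \<in> T \<Longrightarrow> r n (M (Suc n) y) = M n y"
    using refi unfolding refi_def L_def M_def by metis
  have sep: "x = y" if "\<And>n. L n x = L n y" "x \<in> S" "y \<in> S" for x y
    using fine that unfolding mesh_def L_def by (intro label_sequence_separates[of S "\<lambda>n. fst (p n)"]) auto
  have sepT: "x = y" if "\<And>n. M n x = M n y" "x \<in> T" "y \<in> T" for x y
    using fine that unfolding mesh_def M_def by (intro label_sequence_separates[of T "\<lambda>n. snd (p n)"]) auto
  have cS: "compact S" and cT: "compact T" using S T by (auto simp: cantor_space_iff)
  define \<Gamma> where "\<Gamma> = {q \<in> S \<times> T. \<forall>n. L n (fst q) = M n (snd q)}"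
  have "compact \<Gamma>"
  proof -
    have "continuous_on (S \<times> T) (\<lambda>q. L n (fst q))" "continuous_on (S \<times> T) (\<lambda>q. M n (snd q))" for n
      by (rule continuous_on_label_comp[OF LM(1)] continuous_on_label_comp[OF LM(2)];
          auto intro: continuous_intros)+
    then have "continuous_on (S \<times> T) (\<lambda>q. if L n (fst q) = M n (snd q) then 1 else (0::nat))" for n
      by (rule continuous_on_label_fun2)
    then have "compact {q \<in> S \<times> T. (if L n (fst q) = M n (snd q) then 1 else (0::nat)) = 1}" for n
      using compact_Times[OF cS cT] by (rule compact_fibre[rotated])
    moreover have eq: "{q \<in> S \<times> T. (if L n (fst q) = M n (snd q) then 1 else (0::nat)) = 1} = {q \<in> S \<times> T. L n (fst q) = M n (snd q)}" for n
      by auto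
    ultimately have "compact {q \<in> S \<times> T. L n (fst q) = M n (snd q)}" for n by (simp only: eq)
    then have "compact (S \<times> T \<inter> (\<Inter>n. {q \<in> S \<times> T. L n (fst q) = M n (snd q)}))"
      using compact_Times[OF cS cT] by (intro compact_Int_closed closed_INT) (auto dest: compact_imp_closed)
    moreover have "\<Gamma> = S \<times> T \<inter> (\<Inter>n. {q \<in> S \<times> T. L n (fst q) = M n (snd q)})"
      by (auto simp: \<Gamma>_def)
    ultimately show ?thesis by simp
  qed
  moreover have "\<exists>y. (x, y) \<in> \<Gamma>" if x: "x \<in> S" for x
  proof -
    have "L n x \<in> M n ` T" for n using x by (simp flip: LM(3))
    then have "\<exists>y\<in>T. \<forall>n. M n y = L n x"
      using r x by (intro label_sequence_realized[OF cT LM(2), where v = "\<lambda>n. L n x" and r = r]) auto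
    then show ?thesis using x by (auto simp: \<Gamma>_def)
  qed
  then have "fst ` \<Gamma> = S" by (force simp: \<Gamma>_def)
  moreover have "\<exists>x. (x, y) \<in> \<Gamma>" if y: "y \<in> T" for y
  proof -
    have "M n y \<in> L n ` S" for n using y by (simp add: LM(3))
    then have "\<exists>x\<in>S. \<forall>n. L n x = M n y"
      using r y by (intro label_sequence_realized[OF cS LM(1), where v = "\<lambda>n. M n y" and r = r]) auto
    then show ?thesis using y by (force simp: \<Gamma>_def)
  qed
  then have "snd ` \<Gamma> = T" by (force simp: \<Gamma>_def)
  ultimately obtain h k where hk: "homeomorphism S T h k" "\<And>x. x \<in> S \<Longrightarrow> (x, h x) \<in> \<Gamma>"
  proof (rule compact_graph_homeomorphism)
    fix x y y' assume "(x, y) \<in> \<Gamma>" "(x, y') \<in> \<Gamma>"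
    then show "y = y'" by (intro sepT) (auto simp: \<Gamma>_def)
  next
    fix x x' y assume "(x, y) \<in> \<Gamma>" "(x', y) \<in> \<Gamma>"
    then show "x = x'" by (intro sep) (auto simp: \<Gamma>_def)
  qed blast
  moreover have "m (h x) = l x" if "x \<in> S" for x
    using hk(2)[OF that] p0 by (auto simp: \<Gamma>_def L_def M_def dest: spec[of _ 0])
  ultimately show ?thesis using that by blast
qed

corollary cantor_spaces_homeomorphic:
  fixes S :: "'a::metric_space set" and T :: "'b::metric_space set"
  assumes "cantor_space S" "cantor_space T"
  obtains h k where "homeomorphism S T h k"
proof (rule label_preserving_homeomorphism[OF assms, of "\<lambda>_. 0" "\<lambda>_. 0"])
  show "(\<lambda>_. 0) ` S = (\<lambda>_. 0::nat) ` T"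
    using assms by (auto simp: cantor_space_iff)
qed (use that in auto)

lemma self_homeo_of_labels:
  fixes l m :: "'a::metric_space \<Rightarrow> nat"
  assumes X: "cantor_space (UNIV :: 'a set)"
    and "continuous_on UNIV l" "continuous_on UNIV m" "range l = range m"
  obtains h where "self_homeo h" "\<And>x. m (h x) = l x"
  using label_preserving_homeomorphism[OF X X assms(2-4)] unfolding self_homeo_def by (metis UNIV_I)

section \<open>Density of a conjugacy class from simulated labels\<close>

lemma cantor_compact: "cantor_space S \<Longrightarrow> compact S"
  by (simp add: cantor_space_def)

lemma bcontfun_of_continuous:
  fixes f :: "'a::metric_space \<Rightarrow> 'a"
  assumes "compact (UNIV :: 'a set)" "continuous_on UNIV f"
  obtains F :: "'a \<Rightarrow>\<^sub>C 'a" where "apply_bcontfun F = f"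
proof -
  have "f \<in> bcontfun"
    using assms compact_continuous_image[OF assms(2,1)]
    by (auto simp: bcontfun_def intro: compact_imp_bounded)
  then show ?thesis using that Bcontfun_inverse by blast
qed

lemma self_homeo_surjD: "self_homeo h \<Longrightarrow> surj h"
  unfolding self_homeo_def by (auto dest: homeomorphism_image1)

lemma conj_class_iff:
  "g \<in> conj_class f \<longleftrightarrow> (\<exists>h k. homeomorphism UNIV UNIV h k \<and> (\<forall>x. g (h x) = h (f x)))"
proof
  assume "g \<in> conj_class f"
  then obtain h k where hk: "homeomorphism UNIV UNIV h k" "apply_bcontfun g = h \<circ> apply_bcontfun f \<circ> inv h"
    unfolding conj_class_def self_homeo_def by auto
  have "inv h (h x) = x" for x
    by (metis hk(1) UNIV_I homeomorphism_def inv_f_f injI)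
  then have "g (h x) = h (f x)" for x
    by (simp add: hk(2))
  then show "\<exists>h k. homeomorphism UNIV UNIV h k \<and> (\<forall>x. g (h x) = h (f x))"
    using hk(1) by blast
next
  assume "\<exists>h k. homeomorphism UNIV UNIV h k \<and> (\<forall>x. g (h x) = h (f x))"
  then obtain h k where hk: "homeomorphism UNIV UNIV h k" "\<And>x. g (h x) = h (f x)"
    by blast
  have "h (inv h y) = y" for y
    by (metis hk(1) homeomorphism_image1 surj_f_inv_f)
  then have "apply_bcontfun g = h \<circ> apply_bcontfun f \<circ> inv h"
    by (auto simp: fun_eq_iff simp flip: hk(2))
  then show "g \<in> conj_class f"
    using hk(1) unfolding conj_class_def self_homeo_def by blast
qed

text \<open>Read \<open>l\<close> as a finite clopen partition and join \<open>v\<close> to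
  \<open>w\<close> when \<open>g\<close> maps some point of fibre \<open>v\<close> into fibre
  \<open>w\<close>. Then \<open>simulates l f g\<close> says that \<open>f\<close> has a label
  onto the vertices of this finite graph under which every step of \<open>f\<close> is an edge.\<close>

definition simulates :: "('b \<Rightarrow> nat) \<Rightarrow> ('a::metric_space \<Rightarrow> 'a) \<Rightarrow> ('b::metric_space \<Rightarrow> 'b) \<Rightarrow> bool"
  where "simulates l f g \<longleftrightarrow>
    (\<exists>\<pi>. continuous_on UNIV \<pi> \<and> range \<pi> = range l \<and> (\<forall>x. \<exists>y. l y = \<pi> x \<and> l (g y) = \<pi> (f x)))"

text \<open>A homeomorphism that carries the fibres of \<open>\<pi>\<close> to those of
  \<open>l\<close> conjugates \<open>f\<close> to a map that follows the edges of the graph of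
  \<open>g\<close>. If the fibres are so small that \<open>g\<close> barely moves points of one
  fibre apart, all edges out of a vertex end near each other, so the conjugate is close to
  \<open>g\<close>. Only the vertices have to be covered, not the edges.\<close>

lemma simulates_imp_closure_conj_class:
  fixes g :: "'a::metric_space \<Rightarrow>\<^sub>C 'a"
  assumes X: "cantor_space (UNIV :: 'a set)"
    and sim: "\<And>l. continuous_on UNIV l \<Longrightarrow> \<exists>f\<in>F. simulates l (apply_bcontfun f) g"
  shows "g \<in> closure (\<Union>f\<in>F. conj_class f)"
  unfolding closure_approachable
proof (intro allI impI)
  fix e :: real assume "e > 0"
  have cpt: "compact (UNIV :: 'a set)" using X by (rule cantor_compact)
  have cont: "continuous_on UNIV f" for f :: "'a \<Rightarrow>\<^sub>C 'a"
    using apply_bcontfun by (auto simp: bcontfun_def)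
  have "uniformly_continuous_on UNIV g"
    using cont cpt by (rule compact_uniformly_continuous)
  then obtain d where d: "d > 0" "\<And>x y. dist x y < d \<Longrightarrow> dist (g x) (g y) < e / 3"
    unfolding uniformly_continuous_on_def using \<open>e > 0\<close> by (metis UNIV_I divide_pos_pos zero_less_numeral)
  obtain l :: "'a \<Rightarrow> nat" where l: "continuous_on UNIV l" "\<And>x y. l x = l y \<Longrightarrow> dist x y < min d (e/3)"
    using X d \<open>e > 0\<close> unfolding cantor_space_iff fine_labels_def
    by (metis UNIV_I divide_pos_pos min_less_iff_conj zero_less_numeral)
  obtain f where "f \<in> F" and f: "simulates l (apply_bcontfun f) g" using sim[OF l(1)] by blast
  obtain \<pi> where \<pi>: "continuous_on UNIV \<pi>" "range \<pi> = range l" "\<And>x. \<exists>y. l y = \<pi> x \<and> l (g y) = \<pi> (f x)"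
    using f unfolding simulates_def by blast
  obtain h where h: "self_homeo h" "\<And>x. l (h x) = \<pi> x"
    using self_homeo_of_labels[OF X \<pi>(1) l(1) \<pi>(2)] by metis
  then obtain k where hk: "homeomorphism UNIV UNIV h k" unfolding self_homeo_def by blast
  have "continuous_on UNIV (h \<circ> f \<circ> k)"
    using hk cont by (intro continuous_on_compose) (auto simp: homeomorphism_def intro: continuous_on_subset)
  then obtain G :: "'a \<Rightarrow>\<^sub>C 'a" where G: "apply_bcontfun G = h \<circ> f \<circ> k"
    using bcontfun_of_continuous[OF cpt] by blast
  have Gh: "G (h x) = h (f x)" for x
    using hk by (simp add: G homeomorphism_def)
  then have "G \<in> conj_class f"
    unfolding conj_class_iff using hk by blast
  moreover have "dist (G z) (g z) \<le> 2 * e / 3" for z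
  proof -
    obtain x where z: "z = h x" using hk by (metis UNIV_I homeomorphism_def imageE)
    obtain y where y: "l y = \<pi> x" "l (g y) = \<pi> (f x)" using \<pi>(3) by blast
    have "dist (G z) (g y) < e / 3" using l(2)[of "G z" "g y"] y h z Gh by simp
    moreover have "dist (g y) (g z) < e / 3"
      using d(2)[of y z] l(2)[of y z] y h z by simp
    ultimately show ?thesis using dist_triangle[of "G z" "g z" "g y"] by simp
  qed
  then have "dist G g \<le> 2 * e / 3" by (rule dist_bound)
  then have "dist G g < e" using \<open>e > 0\<close> by simp
  ultimately show "\<exists>G\<in>\<Union>f\<in>F. conj_class f. dist G g < e" using \<open>f \<in> F\<close> by blast
qed

lemma transitive_elementI:
  fixes f :: "'a::metric_space \<Rightarrow>\<^sub>C 'a"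
  assumes X: "cantor_space (UNIV :: 'a set)" and K: "closedin (top_of_set Cs) K" "conj_invariant K"
    and "f \<in> K" "\<And>g l. g \<in> K \<Longrightarrow> continuous_on UNIV l \<Longrightarrow> simulates l f g"
  shows "transitive_element K f"
proof -
  have "K \<subseteq> Cs" using closedin_subset[OF K(1)] by simp
  have "conj_class f \<subseteq> K" using K(2) \<open>f \<in> K\<close> by (simp add: conj_invariant_def)
  then have "top_of_set Cs closure_of conj_class f \<subseteq> K"
    using K(1) by (rule closure_of_minimal)
  moreover have "K \<subseteq> top_of_set Cs closure_of conj_class f"
    using simulates_imp_closure_conj_class[OF X, of "{f}"] assms(5) \<open>K \<subseteq> Cs\<close> \<open>conj_class f \<subseteq> K\<close>
    by (auto simp: closure_of_subtopology Int_absorb1)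
  ultimately show ?thesis
    using assms by (auto simp: transitive_element_def)
qed

lemma chain_recurrent_factor:
  fixes f :: "'a::metric_space \<Rightarrow> 'a" and g :: "'b::metric_space \<Rightarrow> 'b"
  assumes "chain_recurrent f" "uniformly_continuous_on UNIV h" "surj h" "\<And>x. g (h x) = h (f x)"
  shows "chain_recurrent g"
  unfolding chain_recurrent_def
proof (intro allI impI)
  fix e :: real and y assume "e > 0"
  then obtain d where d: "d > 0" "\<And>x y. dist x y < d \<Longrightarrow> dist (h x) (h y) < e"
    using assms(2) unfolding uniformly_continuous_on_def by (metis UNIV_I)
  obtain x where y: "y = h x" using assms(3) by blast
  obtain n s where s: "n \<ge> 1" "s 0 = x" "s n = x" "\<forall>i<n. dist (f (s i)) (s (Suc i)) < d"
    using assms(1) d(1) unfolding chain_recurrent_def by metis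
  then show "\<exists>n\<ge>1. \<exists>s. s 0 = y \<and> s n = y \<and> (\<forall>i<n. dist (g (s i)) (s (Suc i)) < e)"
    using d(2) y by (intro exI[of _ n] conjI exI[of _ "\<lambda>i. h (s i)"]) (auto simp: assms(4))
qed

lemma chain_recurrent_labelD:
  fixes l :: "'a::metric_space \<Rightarrow> nat"
  assumes "chain_recurrent f" "compact (UNIV :: 'a set)" "continuous_on UNIV l"
  shows "\<exists>n\<ge>1. \<exists>s. s 0 = x \<and> s n = x \<and> (\<forall>i<n. l (f (s i)) = l (s (Suc i)))"
proof -
  obtain d where "d > 0" "\<And>x y. dist x y < d \<Longrightarrow> l x = l y"
    using label_uniform[OF assms(2,3)] by (metis UNIV_I)
  moreover obtain n s where "n \<ge> 1" "s 0 = x" "s n = x" "\<forall>i<n. dist (f (s i)) (s (Suc i)) < d"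
    using assms(1) \<open>d > 0\<close> unfolding chain_recurrent_def by blast
  ultimately show ?thesis by blast
qed

text \<open>Together with \<open>chain_recurrent_labelD\<close> this describes chain recurrence
  without the metric: chains may jump inside the fibres of a label.\<close>

lemma chain_recurrent_labelI:
  fixes f :: "'a::metric_space \<Rightarrow> 'a"
  assumes X: "cantor_space (UNIV :: 'a set)"
    and "\<And>(l::'a \<Rightarrow> nat) x. continuous_on UNIV l \<Longrightarrow>
      \<exists>n\<ge>1. \<exists>s. s 0 = x \<and> s n = x \<and> (\<forall>i<n. l (f (s i)) = l (s (Suc i)))"
  shows "chain_recurrent f"
  unfolding chain_recurrent_def
proof (intro allI impI)
  fix e :: real and x :: 'a assume "e > 0"
  then obtain l :: "'a \<Rightarrow> nat" where "continuous_on UNIV l" "\<And>x y. l x = l y \<Longrightarrow> dist x y < e"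
    using X unfolding cantor_space_iff fine_labels_def by (metis UNIV_I)
  then show "\<exists>n\<ge>1. \<exists>s. s 0 = x \<and> s n = x \<and> (\<forall>i<n. dist (f (s i)) (s (Suc i)) < e)"
    using assms(2)[of l x] by metis
qed

lemma closedin_Cs_I:
  assumes "K \<subseteq> Cs" "\<And>g. g \<in> Cs \<Longrightarrow> (\<And>e. e > 0 \<Longrightarrow> \<exists>f\<in>K. dist f g < e) \<Longrightarrow> g \<in> K"
  shows "closedin (top_of_set Cs) K"
proof -
  have "K = Cs \<inter> closure K"
    using assms closure_subset[of K] by (auto simp: closure_approachable)
  then show ?thesis using closedin_closed_Int[OF closed_closure] by metis
qed

lemma closedin_CR: "closedin (top_of_set Cs) (CR :: ('a::metric_space \<Rightarrow>\<^sub>C 'a) set)"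
proof (rule closedin_Cs_I)
  fix g :: "'a \<Rightarrow>\<^sub>C 'a" assume g: "g \<in> Cs" "\<And>e. e > 0 \<Longrightarrow> \<exists>f\<in>CR. dist f g < e"
  have "chain_recurrent g"
    unfolding chain_recurrent_def
  proof (intro allI impI)
    fix e :: real and x assume "e > 0"
    then obtain f where f: "f \<in> CR" "dist f g < e/2" using g(2)[of "e/2"] by auto
    obtain n s where s: "n \<ge> 1" "s 0 = x" "s n = x" "\<forall>i<n. dist (f (s i)) (s (Suc i)) < e/2"
    proof -
      have "chain_recurrent f" "e/2 > 0" using f(1) \<open>e > 0\<close> by (auto simp: CR_def)
      then show ?thesis using that unfolding chain_recurrent_def by blast
    qed
    have "dist (g (s i)) (s (Suc i)) < e" if "i < n" for i
    proof -
      have "dist (f (s i)) (g (s i)) < e/2" using f(2) dist_bounded[of f "s i" g] by simp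
      then show ?thesis
        using s(4) that dist_triangle_half_r[of "f (s i)" "g (s i)" e "s (Suc i)"] by (auto simp: dist_commute)
    qed
    then show "\<exists>n\<ge>1. \<exists>s. s 0 = x \<and> s n = x \<and> (\<forall>i<n. dist (g (s i)) (s (Suc i)) < e)"
      using s by blast
  qed
  then show "g \<in> CR" using g(1) by (simp add: CR_def)
qed (auto simp: CR_def)

lemma conj_class_Cs:
  assumes "f \<in> Cs" "g \<in> conj_class f"
  shows "g \<in> Cs"
proof -
  obtain h k where hk: "homeomorphism UNIV UNIV h k" "\<And>x. g (h x) = h (f x)"
    using assms(2) unfolding conj_class_iff by blast
  have "\<exists>x. y = g x" for y
  proof -
    obtain z where "y = h z" using hk(1) by (metis UNIV_I homeomorphism_def imageE)
    moreover obtain x where "z = f x" using assms(1) unfolding Cs_def by (auto dest: surjD)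
    ultimately show ?thesis using hk(2) by metis
  qed
  then show ?thesis unfolding Cs_def by blast
qed

lemma conj_invariant_CR:
  assumes "compact (UNIV :: 'a::metric_space set)"
  shows "conj_invariant (CR :: ('a \<Rightarrow>\<^sub>C 'a) set)"
  unfolding conj_invariant_def
proof (intro ballI subsetI)
  fix f g :: "'a \<Rightarrow>\<^sub>C 'a" assume "f \<in> CR" "g \<in> conj_class f"
  then obtain h k where hk: "homeomorphism UNIV UNIV h k" "\<And>x. g (h x) = h (f x)"
    unfolding conj_class_iff by blast
  have "uniformly_continuous_on UNIV h"
    using homeomorphism_cont1[OF hk(1)] assms by (rule compact_uniformly_continuous)
  moreover have "surj h" using hk(1) homeomorphism_image1 by blast
  ultimately have "chain_recurrent g"
    using \<open>f \<in> CR\<close> hk(2) chain_recurrent_factor[of f h g] by (auto simp: CR_def)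
  then show "g \<in> CR"
    using \<open>f \<in> CR\<close> \<open>g \<in> conj_class f\<close> conj_class_Cs by (auto simp: CR_def)
qed

lemma iterates_semiconj: "(\<And>x. g (h x) = h (f x)) \<Longrightarrow> (g ^^ n) (h x) = h ((f ^^ n) x)"
  by (induction n) auto

lemma Per_semiconj:
  assumes "\<And>x. g (h x) = h (f x)"
  shows "Per f \<subseteq> Per g"
proof
  fix n assume "n \<in> Per f"
  then obtain x where "n \<ge> 1" "(f ^^ n) x = x" by (auto simp: Per_def)
  then have "(g ^^ n) (h x) = h x" using iterates_semiconj[of g h f, OF assms] by simp
  then show "n \<in> Per g" using \<open>n \<ge> 1\<close> by (auto simp: Per_def)
qed

text \<open>Taking the \<open>n\<close>-th iterate is continuous at \<open>g\<close>; this makes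
  the existence of a point of period \<open>n\<close> a closed condition.\<close>

lemma iterates_close:
  fixes g :: "'a::metric_space \<Rightarrow>\<^sub>C 'a"
  assumes "compact (UNIV :: 'a set)" "e > 0"
  shows "\<exists>d>0. \<forall>f :: 'a \<Rightarrow>\<^sub>C 'a. dist f g < d \<longrightarrow> (\<forall>x. dist ((apply_bcontfun f ^^ n) x) ((apply_bcontfun g ^^ n) x) < e)"
  using assms(2)
proof (induction n arbitrary: e)
  case 0
  then show ?case by (auto intro!: exI[of _ 1])
next
  case (Suc n)
  have "uniformly_continuous_on UNIV g"
    using assms(1) by (intro compact_uniformly_continuous) auto
  then obtain d where d: "d > 0" "\<And>x y. dist x y < d \<Longrightarrow> dist (g x) (g y) < e / 2"
    unfolding uniformly_continuous_on_def using \<open>e > 0\<close> by (metis UNIV_I half_gt_zero)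
  obtain d' where d': "d' > 0" "\<And>(f :: 'a \<Rightarrow>\<^sub>C 'a) x. dist f g < d' \<Longrightarrow> dist ((apply_bcontfun f ^^ n) x) ((apply_bcontfun g ^^ n) x) < d"
    using Suc.IH[OF d(1)] by blast
  have "dist ((apply_bcontfun f ^^ Suc n) x) ((apply_bcontfun g ^^ Suc n) x) < e" if f: "dist f g < min d' (e/2)" for f :: "'a \<Rightarrow>\<^sub>C 'a" and x
  proof -
    have "dist (f ((apply_bcontfun f ^^ n) x)) (g ((apply_bcontfun f ^^ n) x)) < e / 2"
      using f dist_bounded[of f "(apply_bcontfun f ^^ n) x" g] by simp
    moreover have "dist (g ((apply_bcontfun f ^^ n) x)) (g ((apply_bcontfun g ^^ n) x)) < e / 2"
      using d' d f by simp
    ultimately show ?thesis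
      using dist_triangle[of "f ((apply_bcontfun f ^^ n) x)" "g ((apply_bcontfun g ^^ n) x)" "g ((apply_bcontfun f ^^ n) x)"] by simp
  qed
  then show ?case using d'(1) \<open>e > 0\<close> by (intro exI[of _ "min d' (e/2)"]) auto
qed

lemma closedin_Cs_Per:
  assumes cpt: "compact (UNIV :: 'a::metric_space set)" and "UNIV \<noteq> ({} :: 'a set)"
  shows "closedin (top_of_set Cs) (Cs_Per Q :: ('a \<Rightarrow>\<^sub>C 'a) set)"
proof (rule closedin_Cs_I)
  fix g :: "'a \<Rightarrow>\<^sub>C 'a" assume g: "g \<in> Cs" "\<And>e. e > 0 \<Longrightarrow> \<exists>f\<in>Cs_Per Q. dist f g < e"
  have "n \<in> Per g" if n: "n \<in> Q" for n
  proof -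
    have "continuous_on UNIV (apply_bcontfun g ^^ n)"
      by (induction n) (auto intro: continuous_on_compose2[of UNIV])
    then have "continuous_on UNIV (\<lambda>x. dist ((apply_bcontfun g ^^ n) x) x)"
      by (intro continuous_intros) auto
    then obtain x where x: "\<And>y. dist ((apply_bcontfun g ^^ n) x) x \<le> dist ((apply_bcontfun g ^^ n) y) y"
      using continuous_attains_inf[OF cpt] assms(2) by auto
    have "(apply_bcontfun g ^^ n) x = x"
    proof (rule ccontr)
      assume "(apply_bcontfun g ^^ n) x \<noteq> x"
      then obtain d where d: "d > 0" "\<And>(f :: 'a \<Rightarrow>\<^sub>C 'a) y. dist f g < d \<Longrightarrow> dist ((apply_bcontfun f ^^ n) y) ((apply_bcontfun g ^^ n) y) < dist ((apply_bcontfun g ^^ n) x) x"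
        using iterates_close[OF cpt, of "dist ((apply_bcontfun g ^^ n) x) x" g n] by auto
      obtain f where f: "f \<in> Cs_Per Q" "dist f g < d" using g(2) d(1) by blast
      then obtain y where "(apply_bcontfun f ^^ n) y = y" using n by (auto simp: Cs_Per_def Per_def)
      then have "dist y ((apply_bcontfun g ^^ n) y) < dist ((apply_bcontfun g ^^ n) x) x" using d(2)[OF f(2), of y] by simp
      then show False using x[of y] by (simp add: dist_commute)
    qed
    moreover have "n \<ge> 1" using g(2)[of 1] n by (auto simp: Cs_Per_def Per_def)
    ultimately show ?thesis by (auto simp: Per_def)
  qed
  then show "g \<in> Cs_Per Q" using g(1) by (auto simp: Cs_Per_def)
qed (auto simp: Cs_Per_def)

lemma conj_invariant_Cs_Per: "conj_invariant (Cs_Per Q :: ('a::metric_space \<Rightarrow>\<^sub>C 'a) set)"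
  unfolding conj_invariant_def
proof (intro ballI subsetI)
  fix f g :: "'a \<Rightarrow>\<^sub>C 'a" assume fg: "f \<in> Cs_Per Q" "g \<in> conj_class f"
  then obtain h where "\<And>x. g (h x) = h (f x)"
    unfolding conj_class_iff by blast
  then have "Per f \<subseteq> Per g" by (rule Per_semiconj)
  then show "g \<in> Cs_Per Q" using fg conj_class_Cs by (auto simp: Cs_Per_def)
qed

lemma conj_invariant_Int: "conj_invariant K \<Longrightarrow> conj_invariant L \<Longrightarrow> conj_invariant (K \<inter> L)"
  unfolding conj_invariant_def by blast

lemma CR1_eq: "CR1 = Cs_Per {1} \<inter> CR"
  by (auto simp: CR1_def Cs_Per_def Per_def CR_def)

section \<open>Closed walks and cyclic towers\<close>

text \<open>This is what chain recurrence says about the graph of a label: every vertex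
  \<open>v\<close> lies on a closed walk, obtained by labelling a chain from a point to itself.
  The walks are made periodic with one common period \<open>N\<close>, the product of their
  lengths.\<close>

lemma closed_walks:
  fixes l :: "'a::metric_space \<Rightarrow> nat"
  assumes "compact (UNIV :: 'a set)" "chain_recurrent g" "continuous_on UNIV l"
  shows "\<exists>N\<ge>1. \<exists>w. \<forall>v\<in>range l. w v 0 = v \<and> (\<forall>i. w v (i + N) = w v i) \<and>
    (\<forall>i. \<exists>y. l y = w v i \<and> l (g y) = w v (Suc i))"
proof -
  have "\<exists>n w. n \<ge> 1 \<and> w 0 = v \<and> (\<forall>i. w (i + n) = w i) \<and> (\<forall>i. \<exists>y. l y = w i \<and> l (g y) = w (Suc i))"
    if vr: "v \<in> range l" for v
  proof -
    obtain x where v: "v = l x" using vr by blast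
    obtain n s where s: "n \<ge> 1" "s 0 = x" "s n = x" "\<forall>i<n. l (g (s i)) = l (s (Suc i))"
      using chain_recurrent_labelD[OF assms(2,1,3)] by blast
    have "\<exists>y. l y = l (s (i mod n)) \<and> l (g y) = l (s (Suc i mod n))" for i
    proof -
      have "l (g (s (i mod n))) = l (s (Suc (i mod n)))" using s by simp
      moreover have "l (s (Suc (i mod n))) = l (s (Suc i mod n))"
        using s by (cases "Suc (i mod n) = n") (auto simp: mod_Suc)
      ultimately show ?thesis by metis
    qed
    then show ?thesis using s v by (intro exI[of _ n] exI[of _ "\<lambda>i. l (s (i mod n))"]) auto
  qed
  then have "\<exists>n. \<forall>v\<in>range l. \<exists>w. n v \<ge> 1 \<and> w 0 = v \<and> (\<forall>i. w (i + n v) = w i) \<and> (\<forall>i. \<exists>y. l y = w i \<and> l (g y) = w (Suc i))"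
    by (intro bchoice) blast
  then obtain n where "\<forall>v\<in>range l. \<exists>w. n v \<ge> 1 \<and> w 0 = v \<and> (\<forall>i. w (i + n v) = w i) \<and> (\<forall>i. \<exists>y. l y = w i \<and> l (g y) = w (Suc i))"
    by blast
  then have "\<exists>w. \<forall>v\<in>range l. n v \<ge> 1 \<and> w v 0 = v \<and> (\<forall>i. w v (i + n v) = w v i) \<and> (\<forall>i. \<exists>y. l y = w v i \<and> l (g y) = w v (Suc i))"
    by (intro bchoice) blast
  then obtain w where w: "\<And>v. v \<in> range l \<Longrightarrow> n v \<ge> 1 \<and> w v 0 = v \<and> (\<forall>i. w v (i + n v) = w v i) \<and> (\<forall>i. \<exists>y. l y = w v i \<and> l (g y) = w v (Suc i))"
    by blast
  define N where "N = (\<Prod>v\<in>range l. n v)"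
  have fin: "finite (range l)" using finite_label_range[OF assms(1,3)] .
  have per: "w v (i + n v * j) = w v i" if "v \<in> range l" for v i j
  proof (induction j)
    case (Suc j)
    have "w v (i + n v * Suc j) = w v ((i + n v * j) + n v)" by (simp add: algebra_simps)
    also have "\<dots> = w v (i + n v * j)" using w[OF that] by blast
    finally show ?case using Suc by simp
  qed simp
  have "w v (i + N) = w v i" if "v \<in> range l" for v i
  proof -
    have "n v dvd N" unfolding N_def using fin that by (rule dvd_prodI)
    then show ?thesis using per[OF that] by (auto elim!: dvdE)
  qed
  moreover have "N > 0" unfolding N_def using w by (intro prod_pos) (auto simp: Suc_le_eq)
  ultimately show ?thesis using w by (intro exI[of _ N] conjI exI[of _ w]) auto
qed

lemma periodic_mod:
  assumes "\<And>i. w (i + N) = w (i::nat)" "N dvd M"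
  shows "w (i mod M) = w i"
proof -
  have per: "w (i + N * j) = w i" for i j
  proof (induction j)
    case (Suc j)
    have "w (i + N * Suc j) = w ((i + N * j) + N)" by (simp add: algebra_simps)
    then show ?case using Suc assms(1) by simp
  qed simp
  obtain c where c: "M = N * c" using assms(2) by blast
  have "w i = w (i mod M + N * (c * (i div M)))"
    by (metis c mod_mult_div_eq mult.assoc)
  then show ?thesis using per by simp
qed

text \<open>Outside \<open>D\<close> there are at least \<open>k\<close> invariant towers, the
  fibres of \<open>b\<close>, and \<open>f\<close> rotates each of them with period \<open>fact
  k\<close>, the position being \<open>a\<close>. The factorial makes every number up to
  \<open>k\<close> a divisor of the period. In the applications \<open>D\<close> is empty or a
  neighbourhood of a fixed point.\<close>

definition cyclic_towers :: "nat \<Rightarrow> 'a::topological_space set \<Rightarrow> ('a \<Rightarrow> 'a) \<Rightarrow> bool"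
  where "cyclic_towers k D f \<longleftrightarrow> closed D \<and> open D \<and> f ` D \<subseteq> D \<and> f ` (-D) \<subseteq> -D \<and>
    (\<exists>a b. continuous_on (-D) a \<and> continuous_on (-D) b \<and>
      (\<forall>x\<in>-D. a (f x) mod fact k = Suc (a x) mod (fact k :: nat) \<and> b (f x) = (b x :: nat)) \<and>
      (\<forall>j<k. \<exists>x\<in>-D. b x = j \<and> a x mod fact k = 0))"

text \<open>Send the \<open>j\<close>-th tower once or several times around a closed walk
  through the \<open>j\<close>-th vertex. This works as soon as there are as many towers as
  vertices and the length of the walks divides that of the towers. The set \<open>D\<close>,
  which \<open>f\<close> does not leave, is sent to the vertex of a fixed point of
  \<open>g\<close>, which has a loop.\<close>

lemma cyclic_towers_simulate:
  fixes g :: "'a::metric_space \<Rightarrow> 'a" and l :: "'a \<Rightarrow> nat"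
  assumes cpt: "compact (UNIV :: 'a set)" and "chain_recurrent g" and l: "continuous_on UNIV l"
  shows "\<exists>k\<ge>1. \<forall>(f :: 'b::metric_space \<Rightarrow> 'b) D.
    cyclic_towers k D f \<longrightarrow> (D \<noteq> {} \<longrightarrow> (\<exists>y. g y = y)) \<longrightarrow> simulates l f g"
proof -
  obtain N w where N: "N \<ge> 1" and w: "\<And>v. v \<in> range l \<Longrightarrow> w v 0 = v"
      "\<And>v i. v \<in> range l \<Longrightarrow> w v (i + N) = w v i"
      "\<And>v i. v \<in> range l \<Longrightarrow> \<exists>y. l y = w v i \<and> l (g y) = w v (Suc i)"
    using closed_walks[OF cpt assms(2) l] by blast
  obtain c where c: "set c = range l"
    using finite_list[OF finite_label_range[OF cpt l]] by blast
  define k where "k = max N (length c)"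
  have "N dvd fact k" using N by (intro dvd_fact) (auto simp: k_def)
  then have wmod: "w v (i mod fact k) = w v i" if "v \<in> range l" for v i
    using periodic_mod[of "w v"] w(2) that by blast
  have "simulates l f g" if tow: "cyclic_towers k D f" and D3: "D \<noteq> {} \<longrightarrow> (\<exists>y. g y = y)" for f :: "'b \<Rightarrow> 'b" and D
  proof -
    obtain a b where D: "closed D" "open D" "D \<noteq> {} \<longrightarrow> (\<exists>y. g y = y)" "f ` D \<subseteq> D" "f ` (-D) \<subseteq> -D"
      and ab1: "continuous_on (-D) a" "continuous_on (-D) b"
        "\<forall>x\<in>-D. a (f x) mod fact k = Suc (a x) mod (fact k :: nat) \<and> b (f x) = (b x :: nat)"
        "\<forall>j<k. \<exists>x\<in>-D. b x = j \<and> a x mod fact k = 0"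
      using tow D3 unfolding cyclic_towers_def by blast
    have ab: "continuous_on (-D) a" "continuous_on (-D) b"
        "\<And>x. x \<in> -D \<Longrightarrow> a (f x) mod fact k = Suc (a x) mod fact k"
        "\<And>x. x \<in> -D \<Longrightarrow> b (f x) = b x"
        "\<And>j. j < k \<Longrightarrow> \<exists>x\<in>-D. b x = j \<and> a x mod fact k = 0"
      using ab1 by blast+
    obtain y0 where y0: "D \<noteq> {} \<Longrightarrow> g y0 = y0" using D(3) by blast
    \<comment> \<open>Towers in excess of the number of vertices may go to any vertex; here \<open>y0\<close> is arbitrary if \<open>D\<close> is empty.\<close>
    define e where "e j = (if j < length c then c ! j else l y0)" for j
    have e: "e j \<in> range l" for j using c nth_mem by (auto simp: e_def)
    define \<pi> where "\<pi> x = (if x \<in> D then l y0 else w (e (b x)) (a x))" for x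
    have "continuous_on (-D) (\<lambda>x. w (e (b x)) (a x))"
      using ab(2,1) by (rule continuous_on_label_fun2)
    then have "continuous_on (D \<union> - D) (\<lambda>x. if x \<in> D then l y0 else w (e (b x)) (a x))"
      using D by (intro continuous_on_If) auto
    then have "continuous_on UNIV \<pi>" by (simp add: \<pi>_def)
    moreover have "range \<pi> = range l"
    proof (intro equalityI subsetI)
      fix v assume "v \<in> range \<pi>"
      then obtain x where "v = \<pi> x" by blast
      then show "v \<in> range l" using w(3)[OF e] by (auto simp: \<pi>_def) (metis rangeI)
    next
      fix v assume v: "v \<in> range l"
      then obtain j where j: "j < length c" "c ! j = v" using c by (metis in_set_conv_nth)
      then have "j < k" by (simp add: k_def)
      then obtain x where x: "x \<in> -D" "b x = j" "a x mod fact k = 0" using ab(5)[OF \<open>j < k\<close>] by (elim bexE conjE) (rule that)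
      have "w v (a x) = w v 0" using wmod[OF v, of "a x"] x by simp
      then have "\<pi> x = v" using x j v w(1) by (simp add: \<pi>_def e_def)
      then show "v \<in> range \<pi>" by blast
    qed
    moreover have "\<exists>y. l y = \<pi> x \<and> l (g y) = \<pi> (f x)" for x
    proof (cases "x \<in> D")
      case True
      then have "f x \<in> D" "g y0 = y0" using y0 D(4) by auto
      then show ?thesis using True by (intro exI[of _ y0]) (auto simp: \<pi>_def)
    next
      case False
      then have fx: "f x \<notin> D" using D(5) by auto
      have "w (e (b x)) (a (f x)) = w (e (b x)) (Suc (a x))"
        using ab(3)[of x] False wmod[OF e] by (metis ComplI)
      then show ?thesis using w(3)[OF e, of "b x" "a x"] ab(4)[of x] False fx by (auto simp: \<pi>_def)
    qed
    ultimately show ?thesis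
      unfolding simulates_def by blast
  qed
  moreover have "k \<ge> 1" using N by (simp add: k_def)
  ultimately show ?thesis by blast
qed

text \<open>The universal adding machine times the identity of a Cantor space is characterized
  by three properties, which are recorded here up to resolution \<open>k\<close>:
  \<open>f\<close> permutes the pieces of a fine partition \<open>l\<close>; it has a cyclic
  factor \<open>a\<close> of order \<open>fact k\<close>; and its invariant labels
  \<open>b\<close> take many values near every point. For fixed \<open>l\<close>,
  \<open>a\<close>, \<open>b\<close> these conditions survive small perturbations of
  \<open>f\<close>, which is why the conjugacy class will be a \<open>G\<^sub>\<delta>\<close>
  set.\<close>

definition adding_level :: "'a::metric_space set \<Rightarrow> ('a \<Rightarrow> 'a) \<Rightarrow> nat \<Rightarrow> bool"
  where "adding_level S f k \<longleftrightarrow> (\<exists>(l :: 'a \<Rightarrow> nat) (a :: 'a \<Rightarrow> nat) (b :: 'a \<Rightarrow> nat).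
    continuous_on S l \<and> continuous_on S a \<and> continuous_on S b \<and>
    (\<forall>x\<in>S. \<forall>y\<in>S. l x = l y \<longrightarrow> dist x y < 1 / Suc k \<and> l (f x) = l (f y)) \<and>
    (\<forall>x\<in>S. a (f x) mod fact k = Suc (a x) mod fact k) \<and>
    (\<forall>x\<in>S. b (f x) = b x \<and> (\<forall>j\<le>k. \<exists>y\<in>S. dist x y < 1 / Suc k \<and> b y = j)))"

definition adding_family :: "'a::metric_space set \<Rightarrow> ('a \<Rightarrow> 'a) \<Rightarrow> bool"
  where "adding_family S f \<longleftrightarrow> compact S \<and> S \<noteq> {} \<and> continuous_on S f \<and> f ` S = S \<and> (\<forall>k. adding_level S f k)"

lemma adding_levelE:
  assumes "adding_level S f k"
  obtains l a b :: "'a::metric_space \<Rightarrow> nat" where "continuous_on S l" "continuous_on S a" "continuous_on S b"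
    "\<And>x y. x \<in> S \<Longrightarrow> y \<in> S \<Longrightarrow> l x = l y \<Longrightarrow> dist x y < 1 / Suc k"
    "\<And>x y. x \<in> S \<Longrightarrow> y \<in> S \<Longrightarrow> l x = l y \<Longrightarrow> l (f x) = l (f y)"
    "\<And>x. x \<in> S \<Longrightarrow> a (f x) mod fact k = Suc (a x) mod fact k"
    "\<And>x. x \<in> S \<Longrightarrow> b (f x) = b x"
    "\<And>x j. x \<in> S \<Longrightarrow> j \<le> k \<Longrightarrow> \<exists>y\<in>S. dist x y < 1 / Suc k \<and> b y = j"
proof -
  obtain l a b :: "'a \<Rightarrow> nat" where *: "continuous_on S l" "continuous_on S a" "continuous_on S b"
    "\<forall>x\<in>S. \<forall>y\<in>S. l x = l y \<longrightarrow> dist x y < 1 / Suc k \<and> l (f x) = l (f y)"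
    "\<forall>x\<in>S. a (f x) mod fact k = Suc (a x) mod fact k"
    "\<forall>x\<in>S. b (f x) = b x \<and> (\<forall>j\<le>k. \<exists>y\<in>S. dist x y < 1 / Suc k \<and> b y = j)"
    using assms unfolding adding_level_def by blast
  show ?thesis
  proof (rule that[OF *(1-3)])
    show "dist x y < 1 / Suc k" "l (f x) = l (f y)" if "x \<in> S" "y \<in> S" "l x = l y" for x y
      using *(4) that by blast+
    show "a (f x) mod fact k = Suc (a x) mod fact k" if "x \<in> S" for x
      using *(5) that by blast
    show "b (f x) = b x" if "x \<in> S" for x
      using *(6) that by blast
    show "\<exists>y\<in>S. dist x y < 1 / Suc k \<and> b y = j" if "x \<in> S" "j \<le> k" for x j
      using *(6) that by blast
  qed
qed

lemma adding_levelI: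
  fixes l a b :: "'a::metric_space \<Rightarrow> nat"
  assumes "continuous_on S l" "continuous_on S a" "continuous_on S b"
    and "\<And>x y. x \<in> S \<Longrightarrow> y \<in> S \<Longrightarrow> l x = l y \<Longrightarrow> dist x y < 1 / Suc k \<and> l (f x) = l (f y)"
    and "\<And>x. x \<in> S \<Longrightarrow> a (f x) mod fact k = Suc (a x) mod fact k"
    and "\<And>x. x \<in> S \<Longrightarrow> b (f x) = b x \<and> (\<forall>j\<le>k. \<exists>y\<in>S. dist x y < 1 / Suc k \<and> b y = j)"
  shows "adding_level S f k"
  unfolding adding_level_def
  by (intro exI[of _ l] exI[of _ a] exI[of _ b] conjI ballI impI assms)

lemma adding_level_partition:
  assumes "adding_level S f k"
  shows "\<exists>l. continuous_on S l \<and> (\<forall>x\<in>S. \<forall>y\<in>S. l x = (l y :: nat) \<longrightarrow> dist x y < 1 / Suc k \<and> l (f x) = l (f y))"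
  using assms unfolding adding_level_def by blast

lemma adding_level_counter:
  assumes "adding_level S f k"
  shows "\<exists>a. continuous_on S a \<and> (\<forall>x\<in>S. a (f x) mod fact k = Suc (a x) mod (fact k :: nat))"
  using assms unfolding adding_level_def by blast

lemma adding_level_invariant:
  assumes "adding_level S f k"
  shows "\<exists>b. continuous_on S b \<and> (\<forall>x\<in>S. b (f x) = b x \<and> (\<forall>j\<le>k. \<exists>y\<in>S. dist x y < 1 / Suc k \<and> b y = (j :: nat)))"
  using assms unfolding adding_level_def by blast

lemma funpow_image: "f ` S \<subseteq> S \<Longrightarrow> x \<in> S \<Longrightarrow> (f ^^ i) x \<in> S"
  by (induction i) auto

lemma counter_iterate:
  fixes a :: "'a \<Rightarrow> nat"
  assumes "\<And>x. x \<in> S \<Longrightarrow> a (f x) mod N = Suc (a x) mod N" "f ` S \<subseteq> S" "x \<in> S"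
  shows "a ((f ^^ i) x) mod N = (a x + i) mod N"
proof (induction i)
  case (Suc i)
  have "a ((f ^^ Suc i) x) mod N = Suc (a ((f ^^ i) x)) mod N"
    using assms(1)[OF funpow_image[OF assms(2,3), of i]] by simp
  also have "\<dots> = Suc (a ((f ^^ i) x) mod N) mod N" by (simp add: mod_Suc_eq)
  also have "\<dots> = (a x + Suc i) mod N" using Suc by (simp add: mod_Suc_eq)
  finally show ?case .
qed simp

lemma invariant_iterate:
  assumes "\<And>x. x \<in> S \<Longrightarrow> b (f x) = b x" "f ` S \<subseteq> S" "x \<in> S"
  shows "b ((f ^^ i) x) = b x"
  using assms(1)[OF funpow_image[OF assms(2,3)]] by (induction i) auto

text \<open>Any value of \<open>b\<close> occurs with counter \<open>0\<close>, because an orbit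
  passes through all values of the counter while \<open>b\<close> stays constant.\<close>

lemma adding_level_hits:
  assumes "adding_level S f k" "S \<noteq> {}" "f ` S \<subseteq> S"
  obtains a b where "continuous_on S a" "continuous_on S b"
    "\<And>x. x \<in> S \<Longrightarrow> a (f x) mod fact k = Suc (a x) mod (fact k :: nat)"
    "\<And>x. x \<in> S \<Longrightarrow> b (f x) = (b x :: nat)"
    "\<And>j. j \<le> k \<Longrightarrow> \<exists>x\<in>S. b x = j \<and> a x mod fact k = 0"
proof -
  obtain a where a: "continuous_on S a" "\<forall>x\<in>S. a (f x) mod fact k = Suc (a x) mod (fact k :: nat)"
    using adding_level_counter[OF assms(1)] by blast
  obtain b where b: "continuous_on S b"
    "\<forall>x\<in>S. b (f x) = b x \<and> (\<forall>j\<le>k. \<exists>y\<in>S. dist x y < 1 / Suc k \<and> b y = (j :: nat))"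
    using adding_level_invariant[OF assms(1)] by blast
  have hit: "\<exists>x\<in>S. b x = j \<and> a x mod fact k = 0" if j: "j \<le> k" for j
  proof -
    obtain y where y: "y \<in> S" "b y = j" using b(2) assms(2) j by blast
    define i where "i = fact k - a y mod fact k"
    have "(a y + i) mod fact k = (a y mod fact k + i) mod fact k" by (simp add: mod_add_left_eq)
    also have "a y mod fact k + i = fact k"
      unfolding i_def using mod_less_divisor[of "fact k :: nat" "a y"] by (simp del: mod_less_divisor)
    finally have "a ((f ^^ i) y) mod fact k = 0"
      using counter_iterate[of S a f "fact k" y i] a(2) assms(3) y by simp
    moreover have "b ((f ^^ i) y) = j" using invariant_iterate[of S b f y i] b(2) assms(3) y by simp
    ultimately show ?thesis
      using funpow_image[OF assms(3) y(1), of i] by (intro bexI[of _ "(f ^^ i) y"] conjI)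
  qed
  show ?thesis using a b hit by (intro that[of a b]) auto
qed

lemma adding_family_simulates:
  fixes f :: "'b::metric_space \<Rightarrow> 'b" and g :: "'a::metric_space \<Rightarrow> 'a"
  assumes "compact (UNIV :: 'a set)" "chain_recurrent g" "continuous_on UNIV l" "adding_family (-D) f"
    and D: "closed D" "open D" "D \<noteq> {} \<Longrightarrow> \<exists>y. g y = y" "f ` D \<subseteq> D"
  shows "simulates l f g"
proof -
  obtain k where sim: "\<And>(f :: 'b \<Rightarrow> 'b) D. cyclic_towers k D f \<Longrightarrow> (D \<noteq> {} \<longrightarrow> (\<exists>y. g y = y)) \<Longrightarrow> simulates l f g"
    using cyclic_towers_simulate[OF assms(1-3)] by blast
  have f: "adding_level (-D) f k" "-D \<noteq> {}" "f ` (-D) \<subseteq> -D" using assms(4) by (auto simp: adding_family_def)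
  obtain a b where ab: "continuous_on (-D) a" "continuous_on (-D) b"
    "\<And>x. x \<in> -D \<Longrightarrow> a (f x) mod fact k = Suc (a x) mod (fact k :: nat)"
    "\<And>x. x \<in> -D \<Longrightarrow> b (f x) = (b x :: nat)"
    "\<And>j. j \<le> k \<Longrightarrow> \<exists>x\<in>-D. b x = j \<and> a x mod fact k = 0"
    by (rule adding_level_hits[OF f]) (rule that)
  have "cyclic_towers k D f"
    unfolding cyclic_towers_def
  proof (intro conjI D f)
    show "\<exists>a b. continuous_on (-D) a \<and> continuous_on (-D) b \<and>
      (\<forall>x\<in>-D. a (f x) mod fact k = Suc (a x) mod (fact k :: nat) \<and> b (f x) = (b x :: nat)) \<and>
      (\<forall>j<k. \<exists>x\<in>-D. b x = j \<and> a x mod fact k = 0)"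
      using ab by (rule_tac x = a in exI, rule_tac x = b in exI) (auto simp: less_imp_le)
  qed
  then show ?thesis using sim D(3) by blast
qed

lemma adding_level_antimono:
  assumes "adding_level S f K" "k \<le> K"
  shows "adding_level S f k"
proof -
  have "1 / real (Suc K) \<le> 1 / real (Suc k)" using assms(2) by (intro divide_left_mono) auto
  then have le: "d < 1 / real (Suc k)" if "d < 1 / real (Suc K)" for d using that by linarith
  obtain l a b :: "'a \<Rightarrow> nat" where *: "continuous_on S l" "continuous_on S a" "continuous_on S b"
    "\<forall>x\<in>S. \<forall>y\<in>S. l x = l y \<longrightarrow> dist x y < 1 / Suc K \<and> l (f x) = l (f y)"
    "\<forall>x\<in>S. a (f x) mod fact K = Suc (a x) mod fact K"
    "\<forall>x\<in>S. b (f x) = b x \<and> (\<forall>j\<le>K. \<exists>y\<in>S. dist x y < 1 / Suc K \<and> b y = j)"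
    using assms(1) unfolding adding_level_def by blast
  have "(fact k :: nat) dvd fact K" using assms(2) by (rule fact_dvd)
  then have "\<forall>x\<in>S. a (f x) mod fact k = Suc (a x) mod fact k"
    using *(5) by (metis mod_mod_cancel)
  moreover have "\<forall>x\<in>S. \<forall>y\<in>S. l x = l y \<longrightarrow> dist x y < 1 / Suc k \<and> l (f x) = l (f y)"
    using *(4) le by blast
  moreover have "\<forall>x\<in>S. b (f x) = b x \<and> (\<forall>j\<le>k. \<exists>y\<in>S. dist x y < 1 / Suc k \<and> b y = j)"
    using *(6) le assms(2) by (meson order_trans)
  ultimately show ?thesis using *(1-3) unfolding adding_level_def by blast
qed

lemma adding_level_restrict:
  assumes "adding_level T f k" "S \<subseteq> T" "f ` S \<subseteq> S"
    and "\<And>x y. x \<in> S \<Longrightarrow> y \<in> T \<Longrightarrow> dist x y < 1 / Suc k \<Longrightarrow> y \<in> S"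
  shows "adding_level S f k"
proof -
  obtain l a b :: "'a \<Rightarrow> nat" where *: "continuous_on T l" "continuous_on T a" "continuous_on T b"
    "\<forall>x\<in>T. \<forall>y\<in>T. l x = l y \<longrightarrow> dist x y < 1 / Suc k \<and> l (f x) = l (f y)"
    "\<forall>x\<in>T. a (f x) mod fact k = Suc (a x) mod fact k"
    "\<forall>x\<in>T. b (f x) = b x \<and> (\<forall>j\<le>k. \<exists>y\<in>T. dist x y < 1 / Suc k \<and> b y = j)"
    using assms(1) unfolding adding_level_def by blast
  have "\<forall>x\<in>S. b (f x) = b x \<and> (\<forall>j\<le>k. \<exists>y\<in>S. dist x y < 1 / Suc k \<and> b y = j)"
    using *(6) assms(2,4) by (meson subsetD)
  moreover have "\<forall>x\<in>S. \<forall>y\<in>S. l x = l y \<longrightarrow> dist x y < 1 / Suc k \<and> l (f x) = l (f y)"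
    using *(4) assms(2) by blast
  moreover have "\<forall>x\<in>S. a (f x) mod fact k = Suc (a x) mod fact k"
    using *(5) assms(2) by blast
  moreover have "continuous_on S l" "continuous_on S a" "continuous_on S b"
    using *(1-3) assms(2) continuous_on_subset by blast+
  ultimately show ?thesis unfolding adding_level_def by blast
qed

text \<open>Stated with explicit resolutions, because in the pointed case the sets on which the
  levels hold vary with the level.\<close>

lemma adding_level_transport:
  fixes f :: "'a::metric_space \<Rightarrow> 'a" and g :: "'b::metric_space \<Rightarrow> 'b"
  assumes "adding_level S f K" "k \<le> K" "homeomorphism S T h h'" "\<And>x. x \<in> S \<Longrightarrow> h (f x) = g (h x)"
    "f ` S \<subseteq> S"
    and uc: "\<And>x y. x \<in> S \<Longrightarrow> y \<in> S \<Longrightarrow> dist x y < 1 / Suc K \<Longrightarrow> dist (h x) (h y) < 1 / Suc k"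
  shows "adding_level T g k"
proof -
  obtain l a b :: "'a \<Rightarrow> nat" where *: "continuous_on S l" "continuous_on S a" "continuous_on S b"
    "\<And>x y. x \<in> S \<Longrightarrow> y \<in> S \<Longrightarrow> l x = l y \<Longrightarrow> dist x y < 1 / Suc K"
    "\<And>x y. x \<in> S \<Longrightarrow> y \<in> S \<Longrightarrow> l x = l y \<Longrightarrow> l (f x) = l (f y)"
    "\<And>x. x \<in> S \<Longrightarrow> a (f x) mod fact K = Suc (a x) mod fact K"
    "\<And>x. x \<in> S \<Longrightarrow> b (f x) = b x"
    "\<And>x j. x \<in> S \<Longrightarrow> j \<le> K \<Longrightarrow> \<exists>y\<in>S. dist x y < 1 / Suc K \<and> b y = j"
    by (rule adding_levelE[OF assms(1)]) (rule that)
  have hh: "h' y \<in> S" "h (h' y) = y" "h' (g y) = f (h' y)" if "y \<in> T" for y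
  proof -
    show 1: "h' y \<in> S" "h (h' y) = y"
      using assms(3) that by (auto simp: homeomorphism_def)
    then have "g y = h (f (h' y))" using assms(4) by simp
    then show "h' (g y) = f (h' y)"
      using 1 assms(5) homeomorphism_apply1[OF assms(3), of "f (h' y)"] by auto
  qed
  have hS: "h x \<in> T" "h' (h x) = x" if "x \<in> S" for x
    using assms(3) that by (auto simp: homeomorphism_def)
  have ct: "continuous_on T (\<lambda>y. m (h' y))" if "continuous_on S m" for m :: "'a \<Rightarrow> nat"
    using that homeomorphism_cont2[OF assms(3)] by (rule continuous_on_label_comp) (use hh in auto)
  have dvd: "(fact k :: nat) dvd fact K" using assms(2) by (rule fact_dvd)
  have "\<forall>x\<in>T. \<forall>y\<in>T. l (h' x) = l (h' y) \<longrightarrow> dist x y < 1 / Suc k \<and> l (h' (g x)) = l (h' (g y))"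
  proof (intro ballI impI)
    fix x y assume xy: "x \<in> T" "y \<in> T" "l (h' x) = l (h' y)"
    have "dist (h (h' x)) (h (h' y)) < 1 / Suc k"
      using uc *(4) hh(1) xy by blast
    moreover have "l (f (h' x)) = l (f (h' y))" using *(5) hh(1) xy by blast
    ultimately show "dist x y < 1 / Suc k \<and> l (h' (g x)) = l (h' (g y))"
      using hh xy by simp
  qed
  moreover have "\<forall>x\<in>T. a (h' (g x)) mod fact k = Suc (a (h' x)) mod fact k"
  proof
    fix x assume x: "x \<in> T"
    have "a (f (h' x)) mod fact K mod fact k = Suc (a (h' x)) mod fact K mod fact k"
      using *(6) hh(1) x by simp
    then show "a (h' (g x)) mod fact k = Suc (a (h' x)) mod fact k"
      using hh(3) x by (simp add: mod_mod_cancel[OF dvd])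
  qed
  moreover have "\<forall>x\<in>T. b (h' (g x)) = b (h' x) \<and> (\<forall>j\<le>k. \<exists>y\<in>T. dist x y < 1 / Suc k \<and> b (h' y) = j)"
  proof (intro ballI conjI allI impI)
    fix x assume x: "x \<in> T"
    show "b (h' (g x)) = b (h' x)" using *(7) hh x by simp
    fix x j assume x: "x \<in> T" and "j \<le> k"
    then obtain y where y: "y \<in> S" "dist (h' x) y < 1 / Suc K" "b y = j"
      using *(8)[of "h' x" j] hh x assms(2) by auto
    then have "dist (h (h' x)) (h y) < 1 / Suc k" using uc hh(1)[OF x] by blast
    then show "\<exists>y\<in>T. dist x y < 1 / Suc k \<and> b (h' y) = j"
      using y hS hh(2)[OF x] by (intro bexI[of _ "h y"]) auto
  qed
  ultimately show ?thesis
    unfolding adding_level_def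
    by (intro exI[of _ "\<lambda>x. l (h' x)"] exI[of _ "\<lambda>x. a (h' x)"] exI[of _ "\<lambda>x. b (h' x)"]
        conjI ct[OF *(1)] ct[OF *(2)] ct[OF *(3)])
qed

lemma Suc_inverse_less:
  assumes "(e::real) > 0" obtains K where "K \<ge> k" "1 / real (Suc K) < e"
proof -
  obtain n where n: "1 / real (Suc n) < e" using assms by (metis inverse_eq_divide reals_Archimedean)
  have "1 / real (Suc (max k n)) \<le> 1 / real (Suc n)" by (intro divide_left_mono) auto
  then show ?thesis using n by (intro that[of "max k n"]) auto
qed

lemma uniform_scale:
  fixes h :: "'a::metric_space \<Rightarrow> 'b::metric_space"
  assumes "compact S" "continuous_on S h"
  obtains K where "K \<ge> k" "\<And>x y. x \<in> S \<Longrightarrow> y \<in> S \<Longrightarrow> dist x y < 1 / Suc K \<Longrightarrow> dist (h x) (h y) < 1 / Suc k"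
proof -
  have "uniformly_continuous_on S h" using assms by (intro compact_uniformly_continuous)
  then obtain d where d: "d > 0" "\<And>x y. x \<in> S \<Longrightarrow> y \<in> S \<Longrightarrow> dist x y < d \<Longrightarrow> dist (h x) (h y) < 1 / Suc k"
    unfolding uniformly_continuous_on_def by (metis divide_pos_pos of_nat_0_less_iff zero_less_Suc zero_less_one)
  obtain K where "K \<ge> k" "1 / real (Suc K) < d" using Suc_inverse_less[OF d(1)] by blast
  then show ?thesis using d that by (metis order_less_trans)
qed

lemma adding_family_transport:
  fixes f :: "'a::metric_space \<Rightarrow> 'a" and g :: "'b::metric_space \<Rightarrow> 'b"
  assumes "adding_family S f" "homeomorphism S T h h'" "\<And>x. x \<in> S \<Longrightarrow> h (f x) = g (h x)"
  shows "adding_family T g"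
proof -
  have S: "compact S" "S \<noteq> {}" "continuous_on S f" "f ` S = S" "\<And>k. adding_level S f k"
    using assms(1) by (auto simp: adding_family_def)
  have h: "continuous_on S h" "continuous_on T h'" "h ` S = T" "h' ` T = S" "\<And>x. x \<in> S \<Longrightarrow> h' (h x) = x" "\<And>y. y \<in> T \<Longrightarrow> h (h' y) = y"
    using assms(2) by (auto simp: homeomorphism_def)
  have g: "g y = h (f (h' y))" if "y \<in> T" for y
    using assms(3)[of "h' y"] h that by auto
  have "adding_level T g k" for k
  proof -
    obtain K where "K \<ge> k" "\<And>x y. x \<in> S \<Longrightarrow> y \<in> S \<Longrightarrow> dist x y < 1 / Suc K \<Longrightarrow> dist (h x) (h y) < 1 / Suc k"
      using uniform_scale[OF S(1) h(1)] by metis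
    then show ?thesis
      using adding_level_transport[OF S(5) _ assms(2,3)] S(4) by blast
  qed
  moreover have "continuous_on T g"
  proof -
    have "continuous_on T (\<lambda>y. h (f (h' y)))"
      using h S by (intro continuous_on_compose2[OF h(1)] continuous_on_compose2[OF S(3)]) auto
    then show ?thesis using g by (subst continuous_on_cong[OF refl g]) auto
  qed
  moreover have "g ` T = T"
  proof -
    have "g ` T = (\<lambda>y. h (f (h' y))) ` T" using g by (rule image_cong[OF refl])
    also have "\<dots> = h ` f ` h' ` T" by (simp add: image_image)
    finally show ?thesis using h S by simp
  qed
  moreover have "compact T" using h S compact_continuous_image by metis
  moreover have "T \<noteq> {}" using h S by blast
  ultimately show ?thesis by (simp add: adding_family_def)
qed

section \<open>Uniqueness of the adding-machine family\<close>

text \<open>With \<open>u\<close> and \<open>v\<close> the two projections, in either order, this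
  says that the closure of a relation is single-valued or injective.\<close>

lemma closure_determines:
  fixes u :: "'c::metric_space \<Rightarrow> 'a::metric_space" and v :: "'c \<Rightarrow> 'b::metric_space"
  assumes lip: "\<And>p q. dist (u p) (u q) \<le> dist p q" "\<And>p q. dist (v p) (v q) \<le> dist p q"
    and unif: "\<And>e. e > 0 \<Longrightarrow> \<exists>d>0. \<forall>p\<in>R. \<forall>q\<in>R. dist (u p) (u q) < d \<longrightarrow> dist (v p) (v q) < e"
    and P: "P \<in> closure R" "Q \<in> closure R" "u P = u Q"
  shows "v P = v Q"
proof (rule ccontr)
  assume "v P \<noteq> v Q"
  define e where "e = dist (v P) (v Q) / 3"
  have "e > 0" using \<open>v P \<noteq> v Q\<close> by (simp add: e_def)
  then obtain d where d: "d > 0" "\<forall>p\<in>R. \<forall>q\<in>R. dist (u p) (u q) < d \<longrightarrow> dist (v p) (v q) < e"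
    using unif by blast
  obtain p q where pq: "p \<in> R" "q \<in> R" "dist p P < min (d/2) e" "dist q Q < min (d/2) e"
    using P \<open>e > 0\<close> d(1) unfolding closure_approachable by (metis half_gt_zero min_less_iff_conj)
  have "dist (u p) (u Q) < d/2" "dist (u q) (u Q) < d/2" "dist (v p) (v P) < e" "dist (v q) (v Q) < e"
    using pq(3,4) lip[of p P] lip[of q Q] P(3) by auto
  moreover from this have "dist (u p) (u q) < d"
    using dist_triangle_half_l[of "u p" "u Q" d "u q"] by simp
  then have "dist (v p) (v q) < e" using d(2) pq by blast
  ultimately have "dist (v P) (v Q) < 3 * e"
    using dist_triangle[of "v P" "v Q" "v p"] dist_triangle[of "v p" "v Q" "v q"] by (simp add: dist_commute)
  then show False by (simp add: e_def)
qed

text \<open>The closure of the relation is the graph of a homeomorphism: uniform continuity in both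
  directions makes it single-valued and injective, density makes its projections onto, and
  invariance passes to the closure.\<close>

lemma dense_matching_homeomorphism:
  fixes S :: "'a::metric_space set" and T :: "'b::metric_space set"
  assumes cpt: "compact S" "compact T" and R: "R \<subseteq> S \<times> T"
    and dense: "\<And>x e. x \<in> S \<Longrightarrow> e > 0 \<Longrightarrow> \<exists>p\<in>R. dist (fst p) x < e"
      "\<And>y e. y \<in> T \<Longrightarrow> e > 0 \<Longrightarrow> \<exists>p\<in>R. dist (snd p) y < e"
    and unif: "\<And>e. e > 0 \<Longrightarrow> \<exists>d>0. \<forall>p\<in>R. \<forall>q\<in>R. dist (fst p) (fst q) < d \<longrightarrow> dist (snd p) (snd q) < e"
      "\<And>e. e > 0 \<Longrightarrow> \<exists>d>0. \<forall>p\<in>R. \<forall>q\<in>R. dist (snd p) (snd q) < d \<longrightarrow> dist (fst p) (fst q) < e"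
    and cont: "continuous_on S f" "continuous_on T g" "f ` S \<subseteq> S" "g ` T \<subseteq> T"
    and inv: "\<And>x y. (x, y) \<in> R \<Longrightarrow> (f x, g y) \<in> R"
  obtains h k where "homeomorphism S T h k" "\<And>x. x \<in> S \<Longrightarrow> h (f x) = g (h x)"
proof -
  have "closed (S \<times> T)" using cpt by (intro closed_Times compact_imp_closed)
  then have sub: "closure R \<subseteq> S \<times> T" using R by (simp add: closure_minimal)
  have cR: "compact (closure R)"
    using compact_Int_closed[OF compact_Times[OF cpt] closed_closure[of R]] sub by (simp add: Int_absorb1)
  have img: "fst ` closure R = S"
  proof
    have "closed (fst ` closure R)"
      using compact_continuous_image[OF continuous_on_fst[OF continuous_on_id] cR] compact_imp_closed by blast
    moreover have "S \<subseteq> closure (fst ` R)"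
      using dense(1) by (auto simp: closure_approachable)
    ultimately show "S \<subseteq> fst ` closure R"
      by (meson closure_minimal closure_subset image_mono order_trans)
  qed (use sub in auto)
  have img': "snd ` closure R = T"
  proof
    have "closed (snd ` closure R)"
      using compact_continuous_image[OF continuous_on_snd[OF continuous_on_id] cR] compact_imp_closed by blast
    moreover have "T \<subseteq> closure (snd ` R)"
      using dense(2) by (auto simp: closure_approachable)
    ultimately show "T \<subseteq> snd ` closure R"
      by (meson closure_minimal closure_subset image_mono order_trans)
  qed (use sub in auto)
  have uni: "y = y'" if "(x, y) \<in> closure R" "(x, y') \<in> closure R" for x y y'
    using closure_determines[OF dist_fst_le dist_snd_le unif(1) that] by simp
  have inj: "x = x'" if "(x, y) \<in> closure R" "(x', y) \<in> closure R" for x x' y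
    using closure_determines[OF dist_snd_le dist_fst_le unif(2) that] by simp
  obtain h k where hk: "homeomorphism S T h k" "\<And>x. x \<in> S \<Longrightarrow> (x, h x) \<in> closure R"
  proof (rule compact_graph_homeomorphism[OF cR img img'])
    show "y = y'" if "(x, y) \<in> closure R" "(x, y') \<in> closure R" for x y y'
      using that by (rule uni)
    show "x = x'" if "(x, y) \<in> closure R" "(x', y) \<in> closure R" for x x' y
      using that by (rule inj)
  qed (rule that)
  have "h (f x) = g (h x)" if x: "x \<in> S" for x
  proof -
    have "continuous_on (S \<times> T) (\<lambda>p. (f (fst p), g (snd p)))"
    proof (rule continuous_on_Pair)
      show "continuous_on (S \<times> T) (\<lambda>p. f (fst p))"
        by (rule continuous_on_compose2[OF cont(1) continuous_on_fst[OF continuous_on_id]]) auto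
      show "continuous_on (S \<times> T) (\<lambda>p. g (snd p))"
        by (rule continuous_on_compose2[OF cont(2) continuous_on_snd[OF continuous_on_id]]) auto
    qed
    then have "continuous_on (closure R) (\<lambda>p. (f (fst p), g (snd p)))"
      using sub continuous_on_subset by blast
    moreover have "(\<lambda>p. (f (fst p), g (snd p))) ` R \<subseteq> closure R"
      using inv closure_subset by fastforce
    ultimately have "(\<lambda>p. (f (fst p), g (snd p))) ` closure R \<subseteq> closure R"
      by (rule image_closure_subset[OF _ closed_closure])
    then have "(f x, g (h x)) \<in> closure R" using hk(2)[OF x] by auto
    moreover have "f x \<in> S" using cont(3) x by auto
    ultimately show ?thesis using hk(2) uni by blast
  qed
  then show ?thesis using that hk(1) by blast
qed

lemma surj_on_finite_power_id:
  assumes "finite R" "\<sigma> ` R = R"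
  shows "\<exists>n>0. \<forall>v\<in>R. (\<sigma> ^^ n) v = v"
proof -
  define p where "p v = (if v \<in> R then \<sigma> v else v)" for v
  have "inj_on \<sigma> R" using assms by (simp add: finite_surj_inj eq_card_imp_inj_on)
  then have "bij_betw p R R" using assms by (auto simp: p_def bij_betw_def inj_on_def image_def)
  then have "p permutes R" by (rule bij_imp_permutes) (simp add: p_def)
  then have "permutation p" using assms(1) permutation_permutes by blast
  then obtain n where n: "p ^^ n = id" "n > 0" using permutation_is_nilpotent by blast
  have "(\<sigma> ^^ i) v = (p ^^ i) v \<and> (p ^^ i) v \<in> R" if v: "v \<in> R" for i v
  proof (induction i)
    case (Suc i)
    then show ?case using assms(2) by (auto simp: p_def)
  qed (use v in simp)
  then show ?thesis using n by (metis id_apply)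
qed

text \<open>The action on the fibres is surjective because \<open>f\<close> is, hence a
  permutation of a finite set, hence of finite order.\<close>

lemma permuted_label_period:
  fixes l :: "'a::metric_space \<Rightarrow> nat"
  assumes "compact S" "continuous_on S l" "f ` S = S"
    and "\<And>x y. x \<in> S \<Longrightarrow> y \<in> S \<Longrightarrow> l x = l y \<Longrightarrow> l (f x) = l (f y)"
  shows "\<exists>n>0. \<forall>x\<in>S. l ((f ^^ n) x) = l x"
proof -
  define \<sigma> where "\<sigma> v = l (f (SOME x. x \<in> S \<and> l x = v))" for v
  have \<sigma>: "\<sigma> (l x) = l (f x)" if x: "x \<in> S" for x
  proof -
    have "\<exists>y. y \<in> S \<and> l y = l x" using x by blast
    from someI_ex[OF this] show ?thesis unfolding \<sigma>_def using assms(4) x by blast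
  qed
  have "\<sigma> ` l ` S = l ` f ` S" using \<sigma> by (auto simp: image_image)
  then have "\<sigma> ` l ` S = l ` S" using assms(3) by simp
  then obtain n where n: "n > 0" "\<forall>v\<in>l ` S. (\<sigma> ^^ n) v = v"
    using surj_on_finite_power_id[OF finite_label_range[OF assms(1,2)]] by blast
  have "(\<sigma> ^^ i) (l x) = l ((f ^^ i) x)" if x: "x \<in> S" for x i
  proof (induction i)
    case (Suc i)
    have "(f ^^ i) x \<in> S" using funpow_image[of f S x i] assms(3) x by simp
    then show ?case using Suc \<sigma> by simp
  qed simp
  then show ?thesis using n by fastforce
qed

lemma period_multiple:
  assumes "\<And>x. x \<in> S \<Longrightarrow> l ((f ^^ n) x) = l x" "f ` S \<subseteq> S" "n dvd i" "x \<in> S"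
  shows "l ((f ^^ i) x) = l x"
proof -
  obtain j where j: "i = n * j" using assms(3) by blast
  have "l ((f ^^ (n * j)) x) = l x"
  proof (induction j)
    case (Suc j)
    have "(f ^^ (n * j)) x \<in> S" using funpow_image[OF assms(2,4)] .
    then show ?case using Suc assms(1) by (simp add: funpow_add)
  qed simp
  then show ?thesis using j by simp
qed

lemma adding_family_label:
  assumes "adding_family S f"
  obtains l :: "'a::metric_space \<Rightarrow> nat" and n where "continuous_on S l"
    "\<And>x y. x \<in> S \<Longrightarrow> y \<in> S \<Longrightarrow> l x = l y \<Longrightarrow> dist x y < 1 / Suc k"
    "\<And>x y i. x \<in> S \<Longrightarrow> y \<in> S \<Longrightarrow> l x = l y \<Longrightarrow> l ((f ^^ i) x) = l ((f ^^ i) y)"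
    "n > 0" "\<And>x i. x \<in> S \<Longrightarrow> n dvd i \<Longrightarrow> l ((f ^^ i) x) = l x"
proof -
  have S: "compact S" "f ` S = S" "adding_level S f k" using assms by (auto simp: adding_family_def)
  obtain l :: "'a \<Rightarrow> nat" where l: "continuous_on S l"
    and l': "\<forall>x\<in>S. \<forall>y\<in>S. l x = l y \<longrightarrow> dist x y < 1 / Suc k \<and> l (f x) = l (f y)"
    using adding_level_partition[OF S(3)] by blast
  have mesh: "dist x y < 1 / Suc k" and perm: "l (f x) = l (f y)" if "x \<in> S" "y \<in> S" "l x = l y" for x y
    using l' that by blast+
  obtain n where n: "n > 0" "\<forall>x\<in>S. l ((f ^^ n) x) = l x"
    using permuted_label_period[OF S(1) l S(2) perm] by blast
  show ?thesis
  proof (rule that[OF l mesh _ n(1)])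
    show "l ((f ^^ i) x) = l x" if "x \<in> S" "n dvd i" for x i
      by (rule period_multiple[where n = n and S = S and l = l and f = f]) (use n(2) S(2) that in auto)
    show "l ((f ^^ i) x) = l ((f ^^ i) y)" if xy: "x \<in> S" "y \<in> S" "l x = l y" for x y i
    proof (induction i)
      case (Suc i)
      have "(f ^^ i) x \<in> S" "(f ^^ i) y \<in> S" using funpow_image[of f S] S(2) xy by auto
      from perm[OF this Suc] show ?case by simp
    qed (use xy in simp)
  qed
qed

text \<open>The space has no isolated points because near every point an invariant label takes
  two different values.\<close>

lemma adding_family_cantor:
  assumes "adding_family S f"
  shows "cantor_space S"
  unfolding cantor_space_iff
proof (intro conjI ballI allI impI)
  have S: "compact S" "S \<noteq> {}" "\<And>k. adding_level S f k" using assms by (auto simp: adding_family_def)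
  show "S \<noteq> {}" "compact S" using S by auto
  show "fine_labels S"
    unfolding fine_labels_def
  proof (intro allI impI)
    fix e :: real assume "e > 0"
    then obtain k where k: "1 / real (Suc k) < e" using Suc_inverse_less by blast
    obtain l :: "'a \<Rightarrow> nat" and n where l: "continuous_on S l"
      "\<And>x y. x \<in> S \<Longrightarrow> y \<in> S \<Longrightarrow> l x = l y \<Longrightarrow> dist x y < 1 / Suc k"
      using adding_family_label[OF assms, of k] by metis
    then show "\<exists>l :: 'a \<Rightarrow> nat. continuous_on S l \<and> (\<forall>x\<in>S. \<forall>y\<in>S. l x = l y \<longrightarrow> dist x y < e)"
      using k by (intro exI[of _ l]) (force)
  qed
  fix x and e :: real assume x: "x \<in> S" and "e > 0"
  obtain K where K: "K \<ge> 1" "1 / real (Suc K) < e" using Suc_inverse_less[OF \<open>e > 0\<close>] by blast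
  obtain b where near: "\<forall>x\<in>S. b (f x) = b x \<and> (\<forall>j\<le>K. \<exists>y\<in>S. dist x y < 1 / Suc K \<and> b y = (j :: nat))"
    using adding_level_invariant[OF S(3)] by blast
  define j :: nat where "j = (if b x = 0 then 1 else 0)"
  have "j \<le> K" using K(1) by (simp add: j_def)
  then obtain y where "y \<in> S" "dist x y < 1 / Suc K" "b y = j" using near x by blast
  then show "\<exists>y\<in>S. y \<noteq> x \<and> dist x y < e"
    using K(2) by (intro bexI[of _ y]) (auto simp: j_def split: if_splits)
qed

text \<open>The counters given by the levels need not be compatible with each other. Two
  counters modulo \<open>fact m\<close> differ by an invariant function, so adding this
  difference to the counter modulo \<open>fact (Suc m)\<close> makes it reduce to the previous
  one. The result is a map to the profinite integers.\<close>

lemma adding_family_counters: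
  assumes "adding_family S f"
  obtains A :: "nat \<Rightarrow> 'a::metric_space \<Rightarrow> nat" where
    "\<And>m. continuous_on S (A m)" "\<And>m x. A m x < fact m"
    "\<And>m x. x \<in> S \<Longrightarrow> A m (f x) = Suc (A m x) mod fact m"
    "\<And>m n x. x \<in> S \<Longrightarrow> m \<le> n \<Longrightarrow> A n x mod fact m = A m x"
proof -
  have S: "f ` S = S" "\<And>k. adding_level S f k" using assms by (auto simp: adding_family_def)
  define P where "P m B \<longleftrightarrow> continuous_on S B \<and> (\<forall>x. B x < fact m) \<and> (\<forall>x\<in>S. B (f x) = Suc (B x) mod fact m)"
    for m and B :: "'a \<Rightarrow> nat"
  have step: "\<exists>C. P (Suc m) C \<and> (\<forall>x\<in>S. C x mod fact m = B x)" if B: "P m B" for m B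
  proof -
    obtain a where a: "continuous_on S a"
      and a'': "\<forall>x\<in>S. a (f x) mod fact (Suc m) = Suc (a x) mod (fact (Suc m) :: nat)"
      using adding_level_counter[OF S(2)] by blast
    have a': "a (f x) mod fact (Suc m) = Suc (a x) mod fact (Suc m)" if "x \<in> S" for x
      using a'' that by blast
    define d where "d u v = nat ((int v - int u) mod fact m)" for u v
    define C where "C x = (a x + d (a x) (B x)) mod fact (Suc m)" for x
    have dvd: "(fact m :: nat) dvd fact (Suc m)" by (intro fact_dvd) simp
    have dmod: "int (d u v) = (int v - int u) mod fact m" for u v
      by (simp add: d_def)
    have inv: "d (a (f x)) (B (f x)) = d (a x) (B x)" if x: "x \<in> S" for x
    proof -
      have "a (f x) mod fact m = Suc (a x) mod fact m"
        using a'[OF x] by (metis dvd mod_mod_cancel)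
      then have "int (a (f x)) mod fact m = (int (a x) + 1) mod fact m"
        by (metis of_nat_Suc of_nat_fact of_nat_mod add.commute)
      moreover have "int (B (f x)) mod fact m = (int (B x) + 1) mod fact m"
        using B x unfolding P_def by (metis of_nat_Suc of_nat_fact of_nat_mod add.commute mod_mod_trivial)
      ultimately have "(int (B (f x)) - int (a (f x))) mod fact m = ((int (B x) + 1) - (int (a x) + 1)) mod fact m"
        by (metis mod_diff_eq)
      then show ?thesis by (simp add: d_def)
    qed
    have "continuous_on S C"
      unfolding C_def using a B by (intro continuous_on_label_fun2[of S a B "\<lambda>u v. (u + d u v) mod fact (Suc m)"]) (auto simp: P_def)
    moreover have "C (f x) = Suc (C x) mod fact (Suc m)" if x: "x \<in> S" for x
    proof -
      have "C (f x) = (a (f x) mod fact (Suc m) + d (a x) (B x)) mod fact (Suc m)"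
        by (simp add: C_def inv[OF x] mod_add_left_eq del: fact_Suc)
      also have "\<dots> = (Suc (a x) + d (a x) (B x)) mod fact (Suc m)"
        by (simp add: a'[OF x] mod_add_left_eq del: fact_Suc)
      also have "\<dots> = Suc (C x) mod fact (Suc m)"
        by (simp add: C_def mod_Suc_eq del: fact_Suc)
      finally show ?thesis .
    qed
    moreover have "C x mod fact m = B x" if x: "x \<in> S" for x
    proof -
      have "C x mod fact m = (a x + d (a x) (B x)) mod fact m"
        unfolding C_def using dvd by (rule mod_mod_cancel)
      moreover have "int ((a x + d (a x) (B x)) mod fact m) = int (B x) mod fact m"
        by (simp add: of_nat_mod dmod mod_add_right_eq)
      moreover have "B x mod fact m = B x" using B by (simp add: P_def)
      ultimately show ?thesis by (metis of_nat_eq_iff of_nat_fact of_nat_mod)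
    qed
    ultimately show ?thesis unfolding P_def by (intro exI[of _ C]) (auto simp: C_def simp del: fact_Suc)
  qed
  have "P 0 (\<lambda>_. 0)" by (simp add: P_def)
  then obtain A where A: "\<And>m. P m (A m)" "\<And>m. \<forall>x\<in>S. A (Suc m) x mod fact m = A m x"
    using dependent_nat_choice[of P "\<lambda>m B C. \<forall>x\<in>S. C x mod fact m = B x"] step by blast
  show ?thesis
  proof (rule that)
    show "continuous_on S (A m)" "A m x < fact m" "x \<in> S \<Longrightarrow> A m (f x) = Suc (A m x) mod fact m" for m x
      using A(1)[of m] by (auto simp: P_def)
    show "A n x mod fact m = A m x" if x: "x \<in> S" and "m \<le> n" for m n x
      using \<open>m \<le> n\<close>
    proof (induction n rule: dec_induct)
      case base
      then show ?case using A(1)[of m] by (simp add: P_def)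
    next
      case (step n)
      have "(fact m :: nat) dvd fact n" using step by (intro fact_dvd) simp
      then have "A (Suc n) x mod fact m = A (Suc n) x mod fact n mod fact m" by (simp add: mod_mod_cancel)
      then show ?case using A(2) x step by simp
    qed
  qed
qed

locale adding_counters =
  fixes S :: "'a::metric_space set" and f :: "'a \<Rightarrow> 'a" and A :: "nat \<Rightarrow> 'a \<Rightarrow> nat"
  assumes family: "adding_family S f"
    and contA: "continuous_on S (A m)" and A_less: "A m x < fact m"
    and A_step: "x \<in> S \<Longrightarrow> A m (f x) = Suc (A m x) mod fact m"
    and A_mod: "x \<in> S \<Longrightarrow> m \<le> n \<Longrightarrow> A n x mod fact m = A m x"
begin

lemma S_props: "compact S" "S \<noteq> {}" "continuous_on S f" "f ` S = S" "adding_level S f k"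
  using family by (auto simp: adding_family_def)

lemma f_into: "f ` S \<subseteq> S" using S_props by simp

lemma A_iterate: assumes x: "x \<in> S" shows "A m ((f ^^ i) x) = (A m x + i) mod fact m"
proof -
  have "A m ((f ^^ i) x) mod fact m = (A m x + i) mod fact m"
    by (rule counter_iterate[OF _ f_into x]) (simp add: A_step)
  then show ?thesis using A_less[of m] by simp
qed

definition base :: "'a set" where "base = {x \<in> S. \<forall>m. A m x = 0}"

text \<open>The set \<open>base\<close> is the fibre over \<open>0\<close> of the map to the
  profinite integers. Iterating \<open>x\<close> by multiples of \<open>fact M\<close> makes the
  finer counters vanish without leaving its piece, and compactness gives a point of the piece where
  all of them vanish.\<close>

lemma base_label:
  fixes l :: "'a \<Rightarrow> nat"
  assumes l: "continuous_on S l" "\<And>z. z \<in> S \<Longrightarrow> l ((f ^^ fact M) z) = l z" and x: "x \<in> S" "A M x = 0"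
  shows "\<exists>q\<in>base. l q = l x"
proof -
  have "\<exists>z. \<forall>n. z \<in> {z \<in> {z \<in> S. l z = l x}. A (M + n) z = 0}"
  proof (rule nested_compact_nonempty)
    fix n
    have "continuous_on {z \<in> S. l z = l x} (A (M + n))"
      using contA by (rule continuous_on_subset) auto
    then show "compact {z \<in> {z \<in> S. l z = l x}. A (M + n) z = 0}"
      using compact_fibre[OF compact_fibre[OF S_props(1) l(1)]] by blast
    define i where "i = fact (M + n) - A (M + n) x"
    have M: "(fact M :: nat) dvd fact (M + n)" by (intro fact_dvd) simp
    moreover have "fact M dvd A (M + n) x" using A_mod[OF x(1), of M "M + n"] x(2) by auto
    ultimately have i: "fact M dvd i" unfolding i_def by (intro dvd_diff_nat)
    have "l ((f ^^ i) x) = l x"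
      by (rule period_multiple[where n = "fact M" and S = S and l = l and f = f]) (use l(2) f_into x(1) i in auto)
    moreover have "A (M + n) ((f ^^ i) x) = 0"
      using A_less[of "M + n" x] by (simp add: A_iterate[OF x(1)] i_def)
    ultimately show "{z \<in> {z \<in> S. l z = l x}. A (M + n) z = 0} \<noteq> {}"
      using funpow_image[OF f_into x(1)] by blast
    show "{z \<in> {z \<in> S. l z = l x}. A (M + Suc n) z = 0} \<subseteq> {z \<in> {z \<in> S. l z = l x}. A (M + n) z = 0}"
    proof
      fix z assume z: "z \<in> {z \<in> {z \<in> S. l z = l x}. A (M + Suc n) z = 0}"
      then have "A (M + n) z = 0" using A_mod[of z "M + n" "M + Suc n"] by auto
      then show "z \<in> {z \<in> {z \<in> S. l z = l x}. A (M + n) z = 0}" using z by auto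
    qed
  qed
  then obtain z where z: "z \<in> S" "l z = l x" "\<And>n. A (M + n) z = 0" by blast
  have "A m z = 0" for m
    using A_mod[OF z(1), of m "M + m"] z(3)[of m] by simp
  then show ?thesis using z by (auto simp: base_def)
qed

lemma base_subset: "base \<subseteq> S" by (auto simp: base_def)

text \<open>For perfectness, a point near \<open>q\<close> with a different value of an
  invariant label is moved into \<open>base\<close> by \<open>base_label\<close> applied to a
  label that records both the small piece and the invariant.\<close>

lemma cantor_base: "cantor_space base"
  unfolding cantor_space_iff
proof (intro conjI ballI allI impI)
  obtain x where "x \<in> S" using S_props by blast
  then show "base \<noteq> {}" using base_label[of "\<lambda>_. 0" 0 x] A_less[of 0 x] by auto
  have "closed (\<Inter>m. {x \<in> S. A m x = 0})"
    using compact_fibre[OF S_props(1) contA] by (intro closed_INT) (auto intro: compact_imp_closed)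
  moreover have "base = S \<inter> (\<Inter>m. {x \<in> S. A m x = 0})" by (auto simp: base_def)
  ultimately show "compact base" using S_props(1) by (simp add: compact_Int_closed)
  have "fine_labels S" using adding_family_cantor[OF family] by (simp add: cantor_space_iff)
  then show "fine_labels base" using base_subset fine_labels_subset by blast
  fix q and e :: real assume q: "q \<in> base" and "e > 0"
  then have qS: "q \<in> S" using base_subset by blast
  obtain k where k: "1 / real (Suc k) < e" using Suc_inverse_less[OF \<open>e > 0\<close>] by blast
  obtain l :: "'a \<Rightarrow> nat" and n where l: "continuous_on S l"
      "\<And>x y. x \<in> S \<Longrightarrow> y \<in> S \<Longrightarrow> l x = l y \<Longrightarrow> dist x y < 1 / Suc k"
      and n: "n > 0" "\<And>x i. x \<in> S \<Longrightarrow> n dvd i \<Longrightarrow> l ((f ^^ i) x) = l x"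
    using adding_family_label[OF family, of k] by metis
  obtain d where d: "d > 0" "\<And>x y. x \<in> S \<Longrightarrow> y \<in> S \<Longrightarrow> dist x y < d \<Longrightarrow> l x = l y"
    using label_uniform[OF S_props(1) l(1)] by metis
  obtain d' where d': "d' > 0" "\<And>x y. x \<in> S \<Longrightarrow> y \<in> S \<Longrightarrow> dist x y < d' \<Longrightarrow> A n x = A n y"
    using label_uniform[OF S_props(1) contA] by metis
  obtain K where K: "K \<ge> 1" "1 / real (Suc K) < min d d'" using Suc_inverse_less[of "min d d'" 1] d d' by auto
  obtain b where b: "continuous_on S b"
    and b': "\<forall>x\<in>S. b (f x) = b x \<and> (\<forall>j\<le>K. \<exists>y\<in>S. dist x y < 1 / Suc K \<and> b y = (j :: nat))"
    using adding_level_invariant[OF S_props(5)] by blast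
  define j :: nat where "j = (if b q = 0 then 1 else 0)"
  obtain y where y: "y \<in> S" "dist q y < 1 / Suc K" "b y = j"
  proof -
    have "j \<le> K" using K(1) by (simp add: j_def)
    then show ?thesis using b' qS that by blast
  qed
  have "b y \<noteq> b q" using y by (auto simp: j_def)
  have "l y = l q" "A n y = 0" using d(2)[OF qS y(1)] d'(2)[OF qS y(1)] y(2) K(2) q by (auto simp: base_def)
  have "\<exists>q'\<in>base. prod_encode (l q', b q') = prod_encode (l y, b y)"
  proof (rule base_label[OF _ _ y(1) \<open>A n y = 0\<close>])
    show "continuous_on S (\<lambda>z. prod_encode (l z, b z))" using l(1) b by (rule continuous_on_label_fun2)
    fix z assume z: "z \<in> S"
    have "n dvd fact n" using n(1) by (intro dvd_fact) auto
    then have "l ((f ^^ fact n) z) = l z" using n(2) z by blast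
    moreover have "b ((f ^^ fact n) z) = b z" using invariant_iterate[of S b f z] b' f_into z by simp
    ultimately show "prod_encode (l ((f ^^ fact n) z), b ((f ^^ fact n) z)) = prod_encode (l z, b z)" by simp
  qed
  then obtain q' where q': "q' \<in> base" "l q' = l y" "b q' = b y" by auto
  have "dist q q' < 1 / Suc k" using l(2)[of q q'] q' \<open>l y = l q\<close> qS base_subset by auto
  then show "\<exists>y\<in>base. y \<noteq> q \<and> dist q y < e"
    using q' \<open>b y \<noteq> b q\<close> k by (intro bexI[of _ q']) auto
qed

text \<open>A point with counter \<open>i\<close> is approximated by the \<open>i\<close>-th
  iterates of \<open>base\<close>.\<close>

lemma base_orbits_dense:
  assumes x: "x \<in> S" and "e > 0"
  shows "\<exists>q\<in>base. \<exists>i. dist ((f ^^ i) q) x < e"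
proof -
  obtain k where k: "1 / real (Suc k) < e" using Suc_inverse_less[OF \<open>e > 0\<close>] by blast
  obtain l :: "'a \<Rightarrow> nat" and n where l: "continuous_on S l"
      "\<And>x y. x \<in> S \<Longrightarrow> y \<in> S \<Longrightarrow> l x = l y \<Longrightarrow> dist x y < 1 / Suc k"
      and n: "n > 0" "\<And>x i. x \<in> S \<Longrightarrow> n dvd i \<Longrightarrow> l ((f ^^ i) x) = l x"
    using adding_family_label[OF family, of k] by metis
  define i where "i = A n x"
  define j where "j = fact n - A n x"
  have ij: "i + j = fact n" using A_less[of n x] by (simp add: i_def j_def)
  have nd: "n dvd fact n" using n(1) by (intro dvd_fact) auto
  have "A n ((f ^^ j) x) = 0" using ij by (simp add: A_iterate[OF x] i_def)
  moreover have xj: "(f ^^ j) x \<in> S" using funpow_image[OF f_into x] .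
  moreover have "continuous_on S (f ^^ i)"
  proof (induction i)
    case (Suc i)
    then show ?case using continuous_on_compose2[OF S_props(3) Suc] funpow_image[OF f_into] by auto
  qed simp
  then have "continuous_on S (\<lambda>z. l ((f ^^ i) z))"
    using l(1) funpow_image[OF f_into] by (intro continuous_on_label_comp[OF l(1)]) auto
  moreover have "l ((f ^^ i) ((f ^^ fact n) z)) = l ((f ^^ i) z)" if z: "z \<in> S" for z
  proof -
    have "l ((f ^^ fact n) ((f ^^ i) z)) = l ((f ^^ i) z)" using n(2)[OF funpow_image[OF f_into z] nd] .
    then show ?thesis by (metis add.commute comp_apply funpow_add)
  qed
  ultimately obtain q where q: "q \<in> base" "l ((f ^^ i) q) = l ((f ^^ i) ((f ^^ j) x))"
    using base_label[of "\<lambda>z. l ((f ^^ i) z)" n "(f ^^ j) x"] by auto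
  have "(f ^^ i) ((f ^^ j) x) = (f ^^ fact n) x" by (metis ij comp_apply funpow_add)
  then have "l ((f ^^ i) q) = l x" using q(2) n(2)[OF x nd] by simp
  moreover have "(f ^^ i) q \<in> S" using funpow_image[OF f_into] q base_subset by blast
  ultimately have "dist ((f ^^ i) q) x < 1 / Suc k" using l(2) x by blast
  then show ?thesis using q k by (meson order_less_trans)
qed

end

text \<open>If \<open>f\<^sup>i q\<close> and \<open>f\<^sup>j q'\<close> are close, the
  counters show that \<open>i\<close> and \<open>j\<close> are congruent to a modulus that is a
  period for both partitions. So \<open>j\<close> may be replaced by \<open>i\<close>, and since
  \<open>f\<close> permutes the pieces, \<open>q\<close> and \<open>q'\<close> are close. Then
  \<open>\<tau> q\<close> and \<open>\<tau> q'\<close> are close, and the argument is reversed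
  for \<open>g\<close>.\<close>

lemma adding_transfer_uniform:
  assumes "adding_counters S f A" "adding_counters T g B"
    and \<tau>: "continuous_on (adding_counters.base S A) \<tau>" "\<tau> ` adding_counters.base S A \<subseteq> adding_counters.base T B"
    and "e > 0"
  shows "\<exists>d>0. \<forall>q\<in>adding_counters.base S A. \<forall>q'\<in>adding_counters.base S A. \<forall>i j.
    dist ((f ^^ i) q) ((f ^^ j) q') < d \<longrightarrow> dist ((g ^^ i) (\<tau> q)) ((g ^^ j) (\<tau> q')) < e"
proof -
  interpret S: adding_counters S f A by fact
  interpret T: adding_counters T g B by fact
  obtain k where k: "1 / real (Suc k) < e" using Suc_inverse_less[OF \<open>e > 0\<close>] by blast
  obtain l' :: "'b \<Rightarrow> nat" and n' where l': "continuous_on T l'"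
      "\<And>x y. x \<in> T \<Longrightarrow> y \<in> T \<Longrightarrow> l' x = l' y \<Longrightarrow> dist x y < 1 / Suc k"
      "\<And>x y i. x \<in> T \<Longrightarrow> y \<in> T \<Longrightarrow> l' x = l' y \<Longrightarrow> l' ((g ^^ i) x) = l' ((g ^^ i) y)"
      and n': "n' > 0" "\<And>x i. x \<in> T \<Longrightarrow> n' dvd i \<Longrightarrow> l' ((g ^^ i) x) = l' x"
    by (rule adding_family_label[OF T.family, of k]) (rule that)
  have "continuous_on S.base (\<lambda>q. l' (\<tau> q))"
    using l'(1) \<tau> T.base_subset by (intro continuous_on_label_comp[OF l'(1)]) auto
  moreover have "compact S.base" using S.cantor_base by (rule cantor_compact)
  ultimately obtain \<eta> where \<eta>: "\<eta> > 0" "\<And>x y. x \<in> S.base \<Longrightarrow> y \<in> S.base \<Longrightarrow> dist x y < \<eta> \<Longrightarrow> l' (\<tau> x) = l' (\<tau> y)"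
    using label_uniform[of S.base "\<lambda>q. l' (\<tau> q)"] by metis
  obtain k2 where k2: "1 / real (Suc k2) < \<eta>" using Suc_inverse_less[OF \<open>\<eta> > 0\<close>] by blast
  obtain l :: "'a \<Rightarrow> nat" and n where l: "continuous_on S l"
      "\<And>x y. x \<in> S \<Longrightarrow> y \<in> S \<Longrightarrow> l x = l y \<Longrightarrow> dist x y < 1 / Suc k2"
      "\<And>x y i. x \<in> S \<Longrightarrow> y \<in> S \<Longrightarrow> l x = l y \<Longrightarrow> l ((f ^^ i) x) = l ((f ^^ i) y)"
      and n: "n > 0" "\<And>x i. x \<in> S \<Longrightarrow> n dvd i \<Longrightarrow> l ((f ^^ i) x) = l x"
    by (rule adding_family_label[OF S.family, of k2]) (rule that)
  define M where "M = max n n'"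
  have dvd: "n dvd fact M" "n' dvd fact M" using n(1) n'(1) by (auto simp: M_def intro!: dvd_fact)
  obtain d where d: "d > 0" "\<And>x y. x \<in> S \<Longrightarrow> y \<in> S \<Longrightarrow> dist x y < d \<Longrightarrow> l x = l y"
    using label_uniform[OF S.S_props(1) l(1)] by metis
  obtain d' where d': "d' > 0" "\<And>x y. x \<in> S \<Longrightarrow> y \<in> S \<Longrightarrow> dist x y < d' \<Longrightarrow> A M x = A M y"
    using label_uniform[OF S.S_props(1) S.contA] by metis
  have shift: "m ((F ^^ i) x) = m ((F ^^ j) x)"
    if m: "\<And>x i. x \<in> U \<Longrightarrow> N dvd i \<Longrightarrow> m ((F ^^ i) x) = m x" and U: "F ` U \<subseteq> U" "x \<in> U"
      and ij: "i mod N = j mod N" for m :: "'c \<Rightarrow> nat" and F U x i j N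
  proof -
    have "m ((F ^^ i) x) = m ((F ^^ (i mod N)) x)" for i
    proof -
      have "(F ^^ i) x = (F ^^ (N * (i div N))) ((F ^^ (i mod N)) x)"
        by (metis comp_apply funpow_add mult_div_mod_eq)
      then show ?thesis using m funpow_image[OF U] by simp
    qed
    then show ?thesis using ij by metis
  qed
  have "dist ((g ^^ i) (\<tau> q)) ((g ^^ j) (\<tau> q')) < e"
    if q: "q \<in> S.base" "q' \<in> S.base" and close: "dist ((f ^^ i) q) ((f ^^ j) q') < min d d'" for q q' i j
  proof -
    have qS: "q \<in> S" "q' \<in> S" using q S.base_subset by auto
    have qT: "\<tau> q \<in> T" "\<tau> q' \<in> T" using q \<tau>(2) T.base_subset by auto
    have iS: "(f ^^ i) q \<in> S" "(f ^^ j) q' \<in> S" using funpow_image[OF S.f_into] qS by auto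
    have "A M ((f ^^ i) q) = A M ((f ^^ j) q')" using d'(2)[OF iS] close by simp
    then have ij: "i mod fact M = j mod fact M" using q by (simp add: S.A_iterate qS S.base_def)
    have ijn: "i mod n = j mod n" "i mod n' = j mod n'" using ij dvd by (metis mod_mod_cancel)+
    have "l ((f ^^ i) q) = l ((f ^^ j) q')" using d(2)[OF iS] close by simp
    also have "\<dots> = l ((f ^^ i) q')" using shift[OF n(2) S.f_into qS(2) ijn(1)] by simp
    finally have *: "l ((f ^^ i) q) = l ((f ^^ i) q')" .
    \<comment> \<open>Applying \<open>f\<close> another \<open>c\<close> times completes \<open>i\<close> full periods and so undoes \<open>f\<^sup>i\<close> on the pieces.\<close>
    define c where "c = n * i - i"
    have ci: "c + i = n * i" using n(1) by (simp add: c_def)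
    have "l ((f ^^ c) ((f ^^ i) q)) = l ((f ^^ c) ((f ^^ i) q'))"
      using l(3)[OF _ _ *] funpow_image[OF S.f_into] qS by blast
    then have "l ((f ^^ (n * i)) q) = l ((f ^^ (n * i)) q')" by (metis ci comp_apply funpow_add)
    then have "l q = l q'" using n(2) qS by simp
    then have "dist q q' < \<eta>" using l(2)[OF qS] k2 by simp
    then have "l' (\<tau> q) = l' (\<tau> q')" using \<eta>(2) q by blast
    then have "l' ((g ^^ i) (\<tau> q)) = l' ((g ^^ i) (\<tau> q'))" using l'(3)[OF qT] by blast
    also have "\<dots> = l' ((g ^^ j) (\<tau> q'))" using shift[OF n'(2) T.f_into qT(2) ijn(2)] by simp
    finally have "dist ((g ^^ i) (\<tau> q)) ((g ^^ j) (\<tau> q')) < 1 / Suc k"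
      using l'(2) funpow_image[OF T.f_into] qT by blast
    then show ?thesis using k by simp
  qed
  then show ?thesis using d(1) d'(1) by (intro exI[of _ "min d d'"]) auto
qed

text \<open>Both bases are Cantor spaces, hence homeomorphic by some \<open>\<tau>\<close>, and
  \<open>f\<^sup>i q \<mapsto> g\<^sup>i (\<tau> q)\<close> extends from a dense set to a
  conjugacy.\<close>

theorem adding_family_unique:
  assumes "adding_family S f" "adding_family T g"
  obtains h k where "homeomorphism S T h k" "\<And>x. x \<in> S \<Longrightarrow> h (f x) = g (h x)"
proof -
  obtain A where "adding_counters S f A"
    using adding_family_counters[OF assms(1)] assms(1) unfolding adding_counters_def by metis
  then interpret S: adding_counters S f A .
  obtain B where "adding_counters T g B"
    using adding_family_counters[OF assms(2)] assms(2) unfolding adding_counters_def by metis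
  then interpret T: adding_counters T g B .
  obtain \<tau> \<tau>' where \<tau>: "homeomorphism S.base T.base \<tau> \<tau>'"
    using cantor_spaces_homeomorphic[OF S.cantor_base T.cantor_base] .
  have \<tau>1: "continuous_on S.base \<tau>" "\<tau> ` S.base = T.base" "continuous_on T.base \<tau>'" "\<tau>' ` T.base = S.base"
    "\<And>q. q \<in> S.base \<Longrightarrow> \<tau>' (\<tau> q) = q" "\<And>q. q \<in> T.base \<Longrightarrow> \<tau> (\<tau>' q) = q"
    using \<tau> by (auto simp: homeomorphism_def)
  define R where "R = {((f ^^ i) q, (g ^^ i) (\<tau> q)) | i q. q \<in> S.base}"
  show ?thesis
  proof (rule dense_matching_homeomorphism[OF S.S_props(1) T.S_props(1) _ _ _ _ _ S.S_props(3) T.S_props(3) S.f_into T.f_into])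
    show "R \<subseteq> S \<times> T"
    proof
      fix p assume "p \<in> R"
      then obtain i q where q: "q \<in> S.base" "p = ((f ^^ i) q, (g ^^ i) (\<tau> q))" by (auto simp: R_def)
      have "q \<in> S" using q(1) S.base_subset by blast
      moreover have "\<tau> q \<in> T" using q(1) \<tau>1(2) T.base_subset by blast
      ultimately show "p \<in> S \<times> T"
        using funpow_image[OF S.f_into] funpow_image[OF T.f_into] q(2) by blast
    qed
    show "\<exists>p\<in>R. dist (fst p) x < e" if xe: "x \<in> S" "e > 0" for x e
    proof -
      obtain q i where "q \<in> S.base" "dist ((f ^^ i) q) x < e" using S.base_orbits_dense[OF xe] by blast
      then show ?thesis by (intro bexI[of _ "((f ^^ i) q, (g ^^ i) (\<tau> q))"]) (auto simp: R_def)
    qed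
    show "\<exists>p\<in>R. dist (snd p) y < e" if ye: "y \<in> T" "e > 0" for y e
    proof -
      obtain q i where q: "q \<in> T.base" "dist ((g ^^ i) q) y < e" using T.base_orbits_dense[OF ye] by blast
      moreover have "((f ^^ i) (\<tau>' q), (g ^^ i) q) \<in> R"
        unfolding R_def using q \<tau>1 by (auto intro!: exI[of _ i] exI[of _ "\<tau>' q"])
      ultimately show ?thesis by force
    qed
    show "\<exists>d>0. \<forall>p\<in>R. \<forall>q\<in>R. dist (fst p) (fst q) < d \<longrightarrow> dist (snd p) (snd q) < e" if e: "e > 0" for e
    proof -
      obtain d where "d > 0" "\<forall>q\<in>S.base. \<forall>q'\<in>S.base. \<forall>i j.
          dist ((f ^^ i) q) ((f ^^ j) q') < d \<longrightarrow> dist ((g ^^ i) (\<tau> q)) ((g ^^ j) (\<tau> q')) < e"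
        using adding_transfer_uniform[OF S.adding_counters_axioms T.adding_counters_axioms \<tau>1(1) _ e] \<tau>1(2) by auto
      then show ?thesis by (intro exI[of _ d]) (auto simp: R_def)
    qed
    show "\<exists>d>0. \<forall>p\<in>R. \<forall>q\<in>R. dist (snd p) (snd q) < d \<longrightarrow> dist (fst p) (fst q) < e" if e: "e > 0" for e
    proof -
      obtain d where d: "d > 0" "\<forall>q\<in>T.base. \<forall>q'\<in>T.base. \<forall>i j.
          dist ((g ^^ i) q) ((g ^^ j) q') < d \<longrightarrow> dist ((f ^^ i) (\<tau>' q)) ((f ^^ j) (\<tau>' q')) < e"
        using adding_transfer_uniform[OF T.adding_counters_axioms S.adding_counters_axioms \<tau>1(3) _ e] \<tau>1(4) by auto
      have "dist ((f ^^ i) q) ((f ^^ j) q') < e" if "q \<in> S.base" "q' \<in> S.base" "dist ((g ^^ i) (\<tau> q)) ((g ^^ j) (\<tau> q')) < d" for q q' i j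
        using d(2) that \<tau>1(2,5) by (metis imageI)
      then show ?thesis using d(1) by (intro exI[of _ d]) (auto simp: R_def)
    qed
    show "(f x, g y) \<in> R" if xy: "(x, y) \<in> R" for x y
    proof -
      obtain i q where "q \<in> S.base" "x = (f ^^ i) q" "y = (g ^^ i) (\<tau> q)" using xy by (auto simp: R_def)
      then show ?thesis unfolding R_def by (intro CollectI exI[of _ "Suc i"] exI[of _ q]) simp
    qed
  qed (use that in blast)
qed

section \<open>Sequence spaces and existence of the adding-machine family\<close>

lemma compact_sequence_space:
  fixes K :: "nat \<Rightarrow> 'a::metric_space set"
  assumes "\<And>k. compact (K k)"
  shows "compact {x. \<forall>k. x k \<in> K k}"
proof -
  have "compactin (product_topology (\<lambda>_. euclidean) UNIV) (PiE UNIV K)"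
    using assms by (simp add: compactin_PiE)
  moreover have "PiE UNIV K = {x. \<forall>k. x k \<in> K k}" by auto
  ultimately show ?thesis by (simp add: euclidean_product_topology)
qed

lemma sequence_dist_small:
  assumes "e > 0"
  obtains M d where "d > 0" "\<And>x y :: nat \<Rightarrow> 'a::metric_space. (\<And>i. i < M \<Longrightarrow> dist (x i) (y i) < d) \<Longrightarrow> dist x y < e"
proof -
  obtain N where N: "(1/2)^N < e/2"
    using real_arch_pow_inv[of "e/2" "1/2"] assms by auto
  \<comment> \<open>The metric of the sequence space weights coordinates in the order given by \<open>from_nat\<close>.\<close>
  define M where "M = Suc (Max ((from_nat :: nat \<Rightarrow> nat) ` {..N}))"
  have M: "from_nat n < M" if "n \<le> N" for n
    unfolding M_def using that by (intro le_imp_less_Suc Max_ge) auto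
  show ?thesis
  proof (rule that)
    show "e/4 > 0" using assms by simp
    fix x y :: "nat \<Rightarrow> 'a" assume *: "\<And>i. i < M \<Longrightarrow> dist (x i) (y i) < e/4"
    let ?D = "{dist (x (from_nat n)) (y (from_nat n)) |n. n \<le> N}"
    have "?D = (\<lambda>n. dist (x (from_nat n)) (y (from_nat n))) ` {..N}" by auto
    then have fin: "finite ?D" "?D \<noteq> {}" by auto
    have "\<forall>v\<in>?D. v < e/4" using * M by auto
    then have "Max ?D < e/4" using Max_in[OF fin] by (rule bspec)
    then show "dist x y < e" using dist_fun_le_dist_first_terms[of x y N] N by linarith
  qed
qed

lemma continuous_on_list_label:
  fixes c :: "nat \<Rightarrow> 'a::metric_space \<Rightarrow> nat"
  assumes "\<And>i. i < M \<Longrightarrow> continuous_on S (c i)"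
  shows "continuous_on S (\<lambda>x. list_encode (map (\<lambda>i. c i x) [0..<M]))"
  using assms
proof (induction M)
  case 0
  then show ?case by simp
next
  case (Suc M)
  have "continuous_on S (\<lambda>x. list_encode (list_decode (list_encode (map (\<lambda>i. c i x) [0..<M])) @ [c M x]))"
    using Suc by (intro continuous_on_label_fun2[where g = "\<lambda>u v. list_encode (list_decode u @ [v])"]) auto
  then show ?case by simp
qed

lemma fine_labels_sequences:
  fixes K :: "nat \<Rightarrow> 'a::metric_space set"
  assumes "\<And>k. fine_labels (K k)"
  shows "fine_labels {x. \<forall>k. x k \<in> K k}"
  unfolding fine_labels_def
proof (intro allI impI)
  fix e :: real assume "e > 0"
  obtain M d where Md: "d > 0" "\<And>x y :: nat \<Rightarrow> 'a. (\<And>i. i < M \<Longrightarrow> dist (x i) (y i) < d) \<Longrightarrow> dist x y < e"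
    using sequence_dist_small[OF \<open>e > 0\<close>] by metis
  have "\<forall>k. \<exists>l :: 'a \<Rightarrow> nat. continuous_on (K k) l \<and> (\<forall>x\<in>K k. \<forall>y\<in>K k. l x = l y \<longrightarrow> dist x y < d)"
    using assms Md(1) unfolding fine_labels_def by blast
  then obtain l :: "nat \<Rightarrow> 'a \<Rightarrow> nat" where l: "\<And>k. continuous_on (K k) (l k)"
    "\<And>k x y. x \<in> K k \<Longrightarrow> y \<in> K k \<Longrightarrow> l k x = l k y \<Longrightarrow> dist x y < d"
    by metis
  define L where "L x = list_encode (map (\<lambda>i. l i (x i)) [0..<M])" for x
  have "continuous_on {x. \<forall>k. x k \<in> K k} L"
    unfolding L_def
  proof (rule continuous_on_list_label)
    fix i
    have "continuous_on {x. \<forall>k. x k \<in> K k} (\<lambda>x. x i)"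
      by (rule continuous_on_subset[OF continuous_on_product_coordinates subset_UNIV])
    then show "continuous_on {x. \<forall>k. x k \<in> K k} (\<lambda>x. l i (x i))"
      by (rule continuous_on_label_comp[OF l(1)]) auto
  qed
  moreover have "dist x y < e" if "\<forall>k. x k \<in> K k" "\<forall>k. y k \<in> K k" "L x = L y" for x y
  proof (rule Md(2))
    fix i assume "i < M"
    then have "l i (x i) = l i (y i)" using that(3) by (auto simp: L_def list_encode_eq)
    then show "dist (x i) (y i) < d" using l(2) that by blast
  qed
  ultimately show "\<exists>l. continuous_on {x. \<forall>k. x k \<in> K k} l \<and>
      (\<forall>x\<in>{x. \<forall>k. x k \<in> K k}. \<forall>y\<in>{x. \<forall>k. x k \<in> K k}. l x = (l y :: nat) \<longrightarrow> dist x y < e)"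
    by (intro exI[of _ L]) auto
qed

lemma cantor_space_sequences:
  assumes "cantor_space (UNIV :: 'a::metric_space set)"
  shows "cantor_space (UNIV :: (nat \<Rightarrow> 'a) set)"
  unfolding cantor_space_iff
proof (intro conjI ballI allI impI)
  have X: "compact (UNIV :: 'a set)" "fine_labels (UNIV :: 'a set)"
    using assms by (auto simp: cantor_space_iff)
  show "compact (UNIV :: (nat \<Rightarrow> 'a) set)" using compact_sequence_space[of "\<lambda>_. UNIV"] X by simp
  show "fine_labels (UNIV :: (nat \<Rightarrow> 'a) set)" using fine_labels_sequences[of "\<lambda>_. UNIV"] X by simp
  fix x :: "nat \<Rightarrow> 'a" and e :: real assume "e > 0"
  obtain M d where Md: "d > 0" "\<And>x y :: nat \<Rightarrow> 'a. (\<And>i. i < M \<Longrightarrow> dist (x i) (y i) < d) \<Longrightarrow> dist x y < e"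
    using sequence_dist_small[OF \<open>e > 0\<close>] by metis
  obtain z where "z \<noteq> x M" using assms unfolding cantor_space_iff by (metis UNIV_I zero_less_one)
  then show "\<exists>y\<in>UNIV. y \<noteq> x \<and> dist x y < e"
    using Md by (intro bexI[of _ "x(M := z)"]) (auto simp: fun_eq_iff)
qed simp

text \<open>Even coordinates range over cyclic groups of all orders and are rotated by
  \<open>odometer\<close>; odd coordinates are never moved and supply invariant labels with
  arbitrarily many values. Natural numbers are embedded in the reals for the sake of the metric.\<close>

definition odometer_space :: "(nat \<Rightarrow> real) set"
  where "odometer_space = {x. \<forall>k. x k \<in> real ` {..k div 2}}"

definition odometer :: "(nat \<Rightarrow> real) \<Rightarrow> nat \<Rightarrow> real"
  where "odometer x k = (if even k then real (Suc (nat \<lfloor>x k\<rfloor>) mod Suc (k div 2)) else x k)"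

lemma odometer_coordinate: "x \<in> odometer_space \<Longrightarrow> real (nat \<lfloor>x k\<rfloor>) = x k"
  "x \<in> odometer_space \<Longrightarrow> nat \<lfloor>x k\<rfloor> \<le> k div 2"
  unfolding odometer_space_def by (auto dest!: spec[of _ k])

lemma continuous_on_odometer_coordinate: "continuous_on odometer_space (\<lambda>x. nat \<lfloor>x k\<rfloor>)"
  unfolding continuous_on_nat_iff
proof
  fix x assume x: "x \<in> odometer_space"
  have "continuous_on odometer_space (\<lambda>x. x k)"
    by (rule continuous_on_subset[OF continuous_on_product_coordinates subset_UNIV])
  then obtain d where d: "d > 0" "\<forall>y\<in>odometer_space. dist y x < d \<longrightarrow> dist (y k) (x k) < 1"
    using x unfolding continuous_on_iff by (metis zero_less_one)
  have "nat \<lfloor>y k\<rfloor> = nat \<lfloor>x k\<rfloor>" if y: "y \<in> odometer_space" "dist x y < d" for y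
  proof -
    have "\<bar>real (nat \<lfloor>y k\<rfloor>) - real (nat \<lfloor>x k\<rfloor>)\<bar> < 1"
      using d(2) y by (simp add: odometer_coordinate x dist_commute dist_real_def)
    then show ?thesis by linarith
  qed
  then show "\<exists>d>0. \<forall>y\<in>odometer_space. dist x y < d \<longrightarrow> nat \<lfloor>y k\<rfloor> = nat \<lfloor>x k\<rfloor>"
    using d(1) by blast
qed

lemma odometer_in: "x \<in> odometer_space \<Longrightarrow> odometer x \<in> odometer_space"
  unfolding odometer_space_def odometer_def by (auto intro!: imageI simp: less_Suc_eq_le[symmetric] simp del: of_nat_Suc)

lemma odometer_nat: "x \<in> odometer_space \<Longrightarrow>
    nat \<lfloor>odometer x k\<rfloor> = (if even k then Suc (nat \<lfloor>x k\<rfloor>) mod Suc (k div 2) else nat \<lfloor>x k\<rfloor>)"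
  by (simp add: odometer_def)

lemma odometer_change:
  assumes "x \<in> odometer_space" "v \<le> k div 2"
  shows "x(k := real v) \<in> odometer_space"
  using assms unfolding odometer_space_def by auto

text \<open>The cyclic factor of order \<open>fact k\<close> is coordinate \<open>2 * (fact k -
  1)\<close>. The invariant is an odd coordinate \<open>K\<close> so far out that changing it
  has little effect on distances, and with more than \<open>k\<close> admissible values.\<close>

lemma adding_level_odometer: "adding_level odometer_space odometer k"
proof -
  obtain M d where Md: "d > 0" "\<And>x y :: nat \<Rightarrow> real. (\<And>i. i < M \<Longrightarrow> dist (x i) (y i) < d) \<Longrightarrow> dist x y < 1 / Suc k"
    using sequence_dist_small[of "1 / real (Suc k)"] by (metis divide_pos_pos of_nat_0_less_iff zero_less_Suc zero_less_one)
  define l where "l x = list_encode (map (\<lambda>i. nat \<lfloor>x i\<rfloor>) [0..<M])" for x :: "nat \<Rightarrow> real"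
  define K where "K = 2 * (max k M) + 1"
  define b where "b x = nat \<lfloor>x K\<rfloor>" for x :: "nat \<Rightarrow> real"
  define a where "a x = nat \<lfloor>x (2 * (fact k - 1))\<rfloor>" for x :: "nat \<Rightarrow> real"
  have "continuous_on odometer_space l"
    unfolding l_def by (intro continuous_on_list_label continuous_on_odometer_coordinate)
  moreover have "continuous_on odometer_space a" "continuous_on odometer_space b"
    unfolding a_def b_def by (rule continuous_on_odometer_coordinate)+
  moreover have "dist x y < 1 / Suc k \<and> l (odometer x) = l (odometer y)"
    if xy: "x \<in> odometer_space" "y \<in> odometer_space" "l x = l y" for x y
  proof -
    have eq: "nat \<lfloor>x i\<rfloor> = nat \<lfloor>y i\<rfloor>" if "i < M" for i
      using xy(3) that by (auto simp: l_def list_encode_eq)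
    have "dist x y < 1 / Suc k"
    proof (rule Md(2))
      fix i assume "i < M"
      then have "real (nat \<lfloor>x i\<rfloor>) = real (nat \<lfloor>y i\<rfloor>)" using eq by simp
      then have "x i = y i" by (simp only: odometer_coordinate(1)[OF xy(1)] odometer_coordinate(1)[OF xy(2)])
      then show "dist (x i) (y i) < d" using Md(1) by simp
    qed
    moreover have "l (odometer x) = l (odometer y)"
      using eq xy by (auto simp: l_def odometer_nat list_encode_eq)
    ultimately show ?thesis by simp
  qed
  moreover have "a (odometer x) mod fact k = Suc (a x) mod fact k" if "x \<in> odometer_space" for x
    using that by (simp add: a_def odometer_nat)
  moreover have "b (odometer x) = b x \<and> (\<forall>j\<le>k. \<exists>y\<in>odometer_space. dist x y < 1 / Suc k \<and> b y = j)"
    if x: "x \<in> odometer_space" for x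
  proof (intro conjI allI impI)
    show "b (odometer x) = b x" using x by (simp add: b_def odometer_nat K_def)
    fix j assume "j \<le> k"
    show "\<exists>y\<in>odometer_space. dist x y < 1 / Suc k \<and> b y = j"
    proof (intro bexI conjI)
      show "x(K := real j) \<in> odometer_space" using \<open>j \<le> k\<close> by (intro odometer_change[OF x]) (simp add: K_def)
      show "dist x (x(K := real j)) < 1 / real (Suc k)"
        by (rule Md(2)) (use Md(1) in \<open>auto simp: K_def\<close>)
    qed (simp add: b_def)
  qed
  ultimately show ?thesis by (rule adding_levelI)
qed

lemma adding_family_odometer: "adding_family odometer_space odometer"
  unfolding adding_family_def
proof (intro conjI allI adding_level_odometer)
  show "compact odometer_space"
    unfolding odometer_space_def by (intro compact_sequence_space finite_imp_compact) simp
  have "(\<lambda>_. 0) \<in> odometer_space" by (auto simp: odometer_space_def image_iff)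
  then show "odometer_space \<noteq> {}" by blast
  show "continuous_on odometer_space odometer"
  proof (rule continuous_on_coordinatewise_then_product)
    fix k
    have "continuous_on odometer_space (\<lambda>x. real (if even k then Suc (nat \<lfloor>x k\<rfloor>) mod Suc (k div 2) else nat \<lfloor>x k\<rfloor>))"
      by (intro continuous_on_of_nat continuous_on_label_fun[OF continuous_on_odometer_coordinate,
          where g = "\<lambda>v. if even k then Suc v mod Suc (k div 2) else v"])
    moreover have "real (if even k then Suc (nat \<lfloor>x k\<rfloor>) mod Suc (k div 2) else nat \<lfloor>x k\<rfloor>) = odometer x k"
      if "x \<in> odometer_space" for x
      using that by (simp add: odometer_def odometer_coordinate)
    ultimately show "continuous_on odometer_space (\<lambda>x. odometer x k)"
      by (simp cong: continuous_on_cong)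
  qed
  show "odometer ` odometer_space = odometer_space"
  proof
    show "odometer_space \<subseteq> odometer ` odometer_space"
    proof
      fix y assume y: "y \<in> odometer_space"
      \<comment> \<open>Adding \<open>k div 2\<close> modulo \<open>Suc (k div 2)\<close> is subtracting one.\<close>
      define x where "x k = (if even k then real ((nat \<lfloor>y k\<rfloor> + k div 2) mod Suc (k div 2)) else y k)" for k
      have x: "x \<in> odometer_space"
        using y unfolding odometer_space_def x_def
        by (auto intro!: imageI simp: less_Suc_eq_le[symmetric] simp del: of_nat_Suc)
      have "odometer x k = y k" for k
      proof (cases "even k")
        case True
        have "Suc ((nat \<lfloor>y k\<rfloor> + k div 2) mod Suc (k div 2)) mod Suc (k div 2) = (nat \<lfloor>y k\<rfloor> + Suc (k div 2)) mod Suc (k div 2)"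
          by (simp only: mod_Suc_eq add_Suc_right)
        also have "\<dots> = nat \<lfloor>y k\<rfloor> mod Suc (k div 2)" by (rule mod_add_self2)
        also have "\<dots> = nat \<lfloor>y k\<rfloor>" using odometer_coordinate(2)[OF y, of k] by (intro mod_less) simp
        finally show ?thesis using True by (simp add: odometer_def x_def odometer_coordinate(1)[OF y] del: of_nat_Suc)
      qed (simp add: odometer_def x_def)
      then have "y = odometer x" by auto
      then show "y \<in> odometer ` odometer_space" using x by blast
    qed
  qed (use odometer_in in auto)
qed

theorem adding_family_exists:
  fixes T :: "'a::metric_space set"
  assumes "cantor_space T"
  shows "\<exists>f. adding_family T f"
proof -
  obtain h k where hk: "homeomorphism odometer_space T h k"
    using cantor_spaces_homeomorphic[OF adding_family_cantor[OF adding_family_odometer] assms] .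
  have "h (odometer x) = (h \<circ> odometer \<circ> k) (h x)" if "x \<in> odometer_space" for x
    using homeomorphism_apply1[OF hk that] by simp
  then show ?thesis using adding_family_transport[OF adding_family_odometer hk] by blast
qed

section \<open>The generic chain recurrent map\<close>

text \<open>Following an orbit that nearly returns and then jumping back to its start is a
  chain.\<close>

lemma chain_recurrent_of_returns:
  assumes "\<And>x e. e > 0 \<Longrightarrow> \<exists>n\<ge>1. dist ((f ^^ n) x) x < e"
  shows "chain_recurrent f"
  unfolding chain_recurrent_def
proof (intro allI impI)
  fix e :: real and x assume "e > 0"
  then obtain n where n: "n \<ge> 1" "dist ((f ^^ n) x) x < e" using assms by blast
  define s where "s i = (if i < n then (f ^^ i) x else x)" for i
  have "dist (f (s i)) (s (Suc i)) < e" if "i < n" for i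
  proof (cases "Suc i = n")
    case True
    then have "f (s i) = (f ^^ n) x" using that by (auto simp: s_def)
    then show ?thesis using n True by (simp add: s_def)
  next
    case False
    then show ?thesis using that \<open>e > 0\<close> by (simp add: s_def)
  qed
  then show "\<exists>n\<ge>1. \<exists>s. s 0 = x \<and> s n = x \<and> (\<forall>i<n. dist (f (s i)) (s (Suc i)) < e)"
    using n(1) by (intro exI[of _ n] conjI exI[of _ s]) (auto simp: s_def)
qed

lemma adding_family_returns:
  assumes "adding_family S f" "x \<in> S" "e > 0"
  shows "\<exists>n\<ge>1. dist ((f ^^ n) x) x < e"
proof -
  obtain k where k: "1 / real (Suc k) < e" using Suc_inverse_less[OF assms(3)] by blast
  obtain l :: "'a \<Rightarrow> nat" and n where l: "continuous_on S l"
      "\<And>x y. x \<in> S \<Longrightarrow> y \<in> S \<Longrightarrow> l x = l y \<Longrightarrow> dist x y < 1 / Suc k"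
      and n: "n > 0" "\<And>x i. x \<in> S \<Longrightarrow> n dvd i \<Longrightarrow> l ((f ^^ i) x) = l x"
    using adding_family_label[OF assms(1), of k] by metis
  have "f ` S \<subseteq> S" using assms(1) by (auto simp: adding_family_def)
  then have "(f ^^ n) x \<in> S" using assms(2) by (rule funpow_image)
  then have "dist ((f ^^ n) x) x < 1 / Suc k" using l(2) n(2)[of x n] assms(2) by simp
  then show ?thesis using k n(1) by (intro exI[of _ n]) auto
qed

lemma clopen_separation:
  fixes D :: "'a::metric_space set"
  assumes cpt: "compact (UNIV :: 'a set)" and D: "closed D" "open D"
  obtains d where "d > 0" "\<And>x y. x \<in> D \<Longrightarrow> dist x y < d \<Longrightarrow> y \<in> D"
proof -
  have "continuous_on (D \<union> - D) (\<lambda>x. if x \<in> D then 0 else (1::nat))"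
    using D by (intro continuous_on_If) auto
  then have ind: "continuous_on UNIV (\<lambda>x. if x \<in> D then 0 else (1::nat))" by simp
  show ?thesis
  proof (rule label_uniform[OF cpt ind])
    fix d assume d: "d > 0"
      "\<And>x y. x \<in> UNIV \<Longrightarrow> y \<in> UNIV \<Longrightarrow> dist x y < d \<Longrightarrow> (if x \<in> D then 0 else 1) = (if y \<in> D then 0 else (1::nat))"
    show ?thesis
    proof (rule that[OF d(1)])
      show "y \<in> D" if "x \<in> D" "dist x y < d" for x y
        using d(2)[of x y] that by (simp split: if_splits)
    qed
  qed
qed

definition adding_off :: "'a::metric_space set \<Rightarrow> nat \<Rightarrow> ('a \<Rightarrow>\<^sub>C 'a) set"
  where "adding_off D k = {f. apply_bcontfun f ` D \<subseteq> D \<and> apply_bcontfun f ` (-D) \<subseteq> -D \<and>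
    adding_level (-D) (apply_bcontfun f) k}"

text \<open>A map close to \<open>f\<close> sends every point into the same fibres of
  \<open>l\<close>, \<open>a\<close> and \<open>b\<close> as \<open>f\<close> does, so the same
  three labels serve for it.\<close>

lemma open_adding_off:
  fixes D :: "'a::metric_space set"
  assumes cpt: "compact (UNIV :: 'a set)" and D: "closed D" "open D"
  shows "open (adding_off D k)"
  unfolding open_dist
proof (intro ballI)
  fix f :: "'a \<Rightarrow>\<^sub>C 'a" assume "f \<in> adding_off D k"
  then have f: "f ` D \<subseteq> D" "f ` (-D) \<subseteq> -D" "adding_level (-D) (apply_bcontfun f) k" by (auto simp: adding_off_def)
  have cD: "compact (-D)" using compact_Int_closed[OF cpt, of "-D"] D(2) by (simp add: closed_Compl)
  obtain l a b :: "'a \<Rightarrow> nat" where c: "continuous_on (-D) l" "continuous_on (-D) a" "continuous_on (-D) b"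
    and *: "\<And>x y. x \<in> -D \<Longrightarrow> y \<in> -D \<Longrightarrow> l x = l y \<Longrightarrow> dist x y < 1 / real (Suc k)"
    "\<And>x y. x \<in> -D \<Longrightarrow> y \<in> -D \<Longrightarrow> l x = l y \<Longrightarrow> l (apply_bcontfun f x) = l (apply_bcontfun f y)"
    "\<And>x. x \<in> -D \<Longrightarrow> a (apply_bcontfun f x) mod fact k = Suc (a x) mod fact k"
    "\<And>x. x \<in> -D \<Longrightarrow> b (apply_bcontfun f x) = b x"
    "\<And>x j. x \<in> -D \<Longrightarrow> j \<le> k \<Longrightarrow> \<exists>y\<in>-D. dist x y < 1 / real (Suc k) \<and> b y = j"
    by (rule adding_levelE[OF f(3)]) (rule that)
  obtain d0 where d0: "d0 > 0" "\<And>x y. dist x y < d0 \<Longrightarrow> x \<in> D \<longleftrightarrow> y \<in> D"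
    using clopen_separation[OF cpt D] by (metis dist_commute)
  obtain d1 where d1: "d1 > 0" "\<And>x y. x \<in> -D \<Longrightarrow> y \<in> -D \<Longrightarrow> dist x y < d1 \<Longrightarrow> l x = l y"
    using label_uniform[OF cD c(1)] by metis
  obtain d2 where d2: "d2 > 0" "\<And>x y. x \<in> -D \<Longrightarrow> y \<in> -D \<Longrightarrow> dist x y < d2 \<Longrightarrow> a x = a y"
    using label_uniform[OF cD c(2)] by metis
  obtain d3 where d3: "d3 > 0" "\<And>x y. x \<in> -D \<Longrightarrow> y \<in> -D \<Longrightarrow> dist x y < d3 \<Longrightarrow> b x = b y"
    using label_uniform[OF cD c(3)] by metis
  define d where "d = min (min d0 d1) (min d2 d3)"
  have "d > 0" using d0 d1 d2 d3 by (simp add: d_def)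
  moreover have "g ` D \<subseteq> D \<and> g ` (-D) \<subseteq> -D \<and> adding_level (-D) (apply_bcontfun g) k" if g: "dist g f < d" for g :: "'a \<Rightarrow>\<^sub>C 'a"
  proof -
    have near: "dist (apply_bcontfun g x) (apply_bcontfun f x) < d" for x using g dist_bounded[of g x f] by simp
    have inD: "g x \<in> D \<longleftrightarrow> f x \<in> D" for x using d0(2)[of "g x" "f x"] near[of x] by (simp add: d_def)
    have gD: "g ` D \<subseteq> D" "g ` (-D) \<subseteq> -D" using f(1,2) inD by auto
    have eq: "l (apply_bcontfun g x) = l (apply_bcontfun f x)" "a (apply_bcontfun g x) = a (apply_bcontfun f x)" "b (apply_bcontfun g x) = b (apply_bcontfun f x)" if x: "x \<in> -D" for x
    proof -
      have 1: "g x \<in> -D" "f x \<in> -D" using x gD f by auto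
      show "l (apply_bcontfun g x) = l (apply_bcontfun f x)" using d1(2)[OF 1] near[of x] by (simp add: d_def)
      show "a (apply_bcontfun g x) = a (apply_bcontfun f x)" using d2(2)[OF 1] near[of x] by (simp add: d_def)
      show "b (apply_bcontfun g x) = b (apply_bcontfun f x)" using d3(2)[OF 1] near[of x] by (simp add: d_def)
    qed
    have "adding_level (-D) (apply_bcontfun g) k"
    proof (rule adding_levelI[OF c])
      show "dist x y < 1 / real (Suc k) \<and> l (apply_bcontfun g x) = l (apply_bcontfun g y)" if xy: "x \<in> -D" "y \<in> -D" "l x = l y" for x y
        using *(1,2)[OF xy] eq(1)[OF xy(1)] eq(1)[OF xy(2)] by simp
      show "a (apply_bcontfun g x) mod fact k = Suc (a x) mod fact k" if "x \<in> -D" for x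
        using *(3)[OF that] eq(2)[OF that] by simp
      show "b (apply_bcontfun g x) = b x \<and> (\<forall>j\<le>k. \<exists>y\<in>-D. dist x y < 1 / real (Suc k) \<and> b y = j)" if "x \<in> -D" for x
        using *(4,5)[OF that] eq(3)[OF that] by simp
    qed
    then show ?thesis using gD by blast
  qed
  ultimately show "\<exists>e>0. \<forall>g. dist g f < e \<longrightarrow> g \<in> adding_off D k"
    unfolding adding_off_def by blast
qed

lemma gdelta_adding_levels:
  fixes K :: "('a::metric_space \<Rightarrow>\<^sub>C 'a) set"
  assumes cpt: "compact (UNIV :: 'a set)"
    and clopen: "\<And>k D. D \<in> \<D> k \<Longrightarrow> closed D \<and> open D"
  shows "gdelta_in (top_of_set K)
    {f \<in> K. \<forall>k. \<exists>D\<in>\<D> k. f \<in> adding_off D k}"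
proof -
  define U :: "nat \<Rightarrow> ('a \<Rightarrow>\<^sub>C 'a) set"
    where "U k = (\<Union>D\<in>\<D> k. adding_off D k)" for k
  have "open (U k)" for k
    unfolding U_def using clopen by (intro open_UN ballI open_adding_off[OF cpt]) auto
  then have "gdelta_in (top_of_set K) (\<Inter> (range (\<lambda>k. K \<inter> U k)))"
    by (intro gdelta_in_Inter) (auto intro!: open_imp_gdelta_in)
  moreover have "\<Inter> (range (\<lambda>k. K \<inter> U k)) =
      {f \<in> K. \<forall>k. \<exists>D\<in>\<D> k. f \<in> adding_off D k}"
    by (auto simp: U_def)
  ultimately show ?thesis by simp
qed

text \<open>The class of the adding-machine family consists of all chain recurrent maps of this
  type, by uniqueness, and is therefore a \<open>G\<^sub>\<delta>\<close>; it is dense because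
  such a map has arbitrarily many towers with heights divisible by any given number.\<close>

theorem CR_generic:
  assumes X: "cantor_space (UNIV :: 'a::metric_space set)"
  shows "\<exists>f :: 'a \<Rightarrow>\<^sub>C 'a. transitive_element CR f \<and> residual_type CR f"
proof -
  have cpt: "compact (UNIV :: 'a set)" using X by (rule cantor_compact)
  obtain f0 :: "'a \<Rightarrow> 'a" where f0: "adding_family UNIV f0" using adding_family_exists[OF X] by blast
  then obtain f :: "'a \<Rightarrow>\<^sub>C 'a" where f: "apply_bcontfun f = f0"
    using bcontfun_of_continuous[OF cpt] by (auto simp: adding_family_def)
  have fam: "adding_family UNIV f" using f0 f by simp
  have "f \<in> CR"
    using chain_recurrent_of_returns[of f] adding_family_returns[OF fam] fam
    by (auto simp: CR_def Cs_def adding_family_def)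
  have "transitive_element CR f"
  proof (rule transitive_elementI[OF X closedin_CR conj_invariant_CR[OF cpt] \<open>f \<in> CR\<close>])
    fix g :: "'a \<Rightarrow>\<^sub>C 'a" and l :: "'a \<Rightarrow> nat" assume "g \<in> CR" "continuous_on UNIV l"
    then show "simulates l f g"
      using adding_family_simulates[OF cpt, of g l "{}" f] fam by (auto simp: CR_def)
  qed
  moreover have "conj_class f = {g \<in> CR. \<forall>k. \<exists>D\<in>{{}}. g \<in> adding_off D k}"
  proof (intro equalityI subsetI)
    fix g assume g: "g \<in> conj_class f"
    then obtain h k where hk: "homeomorphism UNIV UNIV h k" "\<And>x. g (h x) = h (f x)"
      unfolding conj_class_iff by blast
    then have "adding_family UNIV g" using adding_family_transport[OF fam hk(1)] by simp
    moreover have "g \<in> CR" using g \<open>f \<in> CR\<close> conj_invariant_CR[OF cpt] by (auto simp: conj_invariant_def)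
    ultimately show "g \<in> {g \<in> CR. \<forall>k. \<exists>D\<in>{{}}. g \<in> adding_off D k}"
      by (auto simp: adding_family_def adding_off_def)
  next
    fix g :: "'a \<Rightarrow>\<^sub>C 'a" assume "g \<in> {g \<in> CR. \<forall>k. \<exists>D\<in>{{}}. g \<in> adding_off D k}"
    then have "adding_family UNIV g" using cpt by (auto simp: adding_family_def adding_off_def CR_def Cs_def)
    then obtain h k where "homeomorphism UNIV UNIV h k" "\<And>x. x \<in> UNIV \<Longrightarrow> h (f x) = g (h x)"
      using adding_family_unique[OF fam] by blast
    then show "g \<in> conj_class f" unfolding conj_class_iff by (metis UNIV_I)
  qed
  then have "residual_type CR f"
    unfolding residual_type_def using gdelta_adding_levels[OF cpt, of "\<lambda>_. {{}}" CR] by auto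
  ultimately show ?thesis by blast
qed

section \<open>Prescribed periods\<close>

lemma identity_CR:
  assumes "compact (UNIV :: 'a::metric_space set)"
  obtains e :: "'a::metric_space \<Rightarrow>\<^sub>C 'a" where "apply_bcontfun e = id" "e \<in> CR"
proof -
  obtain e :: "'a \<Rightarrow>\<^sub>C 'a" where e: "apply_bcontfun e = id"
    using bcontfun_of_continuous[OF assms continuous_on_id] by (auto simp: id_def)
  have "chain_recurrent (id :: 'a \<Rightarrow> 'a)"
    by (rule chain_recurrent_of_returns) (auto intro!: exI[of _ 1])
  then show ?thesis using that e by (auto simp: CR_def Cs_def)
qed

text \<open>Closed chains in finitely many coordinates are run in parallel for a common multiple
  of their lengths; the remaining coordinates jump back to their initial value at each step,
  which costs little.\<close>

lemma chain_recurrent_sequences: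
  fixes F :: "nat \<Rightarrow> 'a::metric_space \<Rightarrow> 'a"
  assumes "\<And>n. chain_recurrent (F n)"
  shows "chain_recurrent (\<lambda>x n. F n (x n))"
  unfolding chain_recurrent_def
proof (intro allI impI)
  fix e :: real and x :: "nat \<Rightarrow> 'a" assume "e > 0"
  then obtain M d where Md: "d > 0" "\<And>x y :: nat \<Rightarrow> 'a. (\<And>i. i < M \<Longrightarrow> dist (x i) (y i) < d) \<Longrightarrow> dist x y < e"
    using sequence_dist_small by metis
  have "\<forall>k. \<exists>n. \<exists>s. n \<ge> 1 \<and> s 0 = x k \<and> s n = x k \<and> (\<forall>i<n. dist (F k (s i)) (s (Suc i)) < d)"
    using assms Md(1) unfolding chain_recurrent_def by blast
  then obtain n s where ns: "\<And>k. n k \<ge> 1" "\<And>k. s k 0 = x k" "\<And>k. s k (n k) = x k"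
    "\<And>k i. i < n k \<Longrightarrow> dist (F k (s k i)) (s k (Suc i)) < d" by metis
  define N where "N = (\<Prod>k<M. n k)"
  have "N > 0" unfolding N_def using ns(1) by (intro prod_pos) (auto simp: Suc_le_eq)
  define t where "t i k = (if k < M then s k (i mod n k) else x k)" for i k
  have "dist (\<lambda>k. F k (t i k)) (t (Suc i)) < e" for i
  proof (rule Md(2))
    fix k assume "k < M"
    have "i mod n k < n k" using ns(1)[of k] by simp
    then have "dist (F k (s k (i mod n k))) (s k (Suc (i mod n k))) < d" by (rule ns(4))
    moreover have "s k (Suc (i mod n k)) = s k (Suc i mod n k)"
      using ns(2,3)[of k] by (cases "Suc (i mod n k) = n k") (auto simp: mod_Suc)
    ultimately show "dist (F k (t i k)) (t (Suc i) k) < d" using \<open>k < M\<close> by (simp add: t_def)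
  qed
  moreover have "t 0 = x" using ns(2) by (auto simp: t_def)
  moreover have "t N = x"
  proof
    fix k
    have "n k dvd N" if "k < M" unfolding N_def using that by (intro dvd_prodI) auto
    then show "t N k = x k" using ns(2) by (auto simp: t_def)
  qed
  ultimately show "\<exists>n\<ge>1. \<exists>s. s 0 = x \<and> s n = x \<and> (\<forall>i<n. dist (\<lambda>n. F n (s i n)) (s (Suc i)) < e)"
    using \<open>N > 0\<close> by (intro exI[of _ N] conjI exI[of _ t]) auto
qed

text \<open>There are only countably many finite graphs. For each of them choose, if possible, a
  map in the set with a label onto the graph. The product of the chosen maps lives on a
  countable power of the Cantor space, which is again a Cantor space. It is chain recurrent, has
  all the required periods, and through its coordinates simulates everything that any map of the
  set allows.\<close>

theorem conj_transitive_Cs_Per_CR: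
  fixes Q :: "nat set"
  assumes X: "cantor_space (UNIV :: 'a::metric_space set)" and "Q \<subseteq> {1..}"
  shows "conj_transitive (Cs_Per Q \<inter> CR :: ('a \<Rightarrow>\<^sub>C 'a) set)"
proof -
  have cpt: "compact (UNIV :: 'a set)" using X by (rule cantor_compact)
  let ?K = "Cs_Per Q \<inter> CR :: ('a \<Rightarrow>\<^sub>C 'a) set"
  obtain e :: "'a \<Rightarrow>\<^sub>C 'a" where e: "apply_bcontfun e = id" "e \<in> CR" using identity_CR[OF cpt] .
  have "(id ^^ n) x = (x::'a)" for n x by (induction n) auto
  then have "e \<in> ?K"
    using assms(2) e by (auto simp: Cs_Per_def Per_def CR_def)
  \<comment> \<open>A graph is given by its edges; every vertex of the graph of a label has an outgoing edge.\<close>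
  define admits :: "('a \<Rightarrow>\<^sub>C 'a) \<Rightarrow> (nat \<times> nat) set \<Rightarrow> bool" where
    "admits f E \<longleftrightarrow> (\<exists>\<pi>. continuous_on UNIV \<pi> \<and> range \<pi> = fst ` E \<and> (\<forall>x. (\<pi> x, \<pi> (f x)) \<in> E))" for f E
  have "\<exists>f\<in>?K. (\<exists>f\<in>?K. admits f (set (from_nat n))) \<longrightarrow> admits f (set (from_nat n))" for n
    using \<open>e \<in> ?K\<close> by blast
  then obtain F where F: "\<And>n. F n \<in> ?K"
    "\<And>n f. f \<in> ?K \<Longrightarrow> admits f (set (from_nat n)) \<Longrightarrow> admits (F n) (set (from_nat n))"
    by metis
  define P where "P x n = F n (x n)" for x :: "nat \<Rightarrow> 'a" and n
  have XX: "cantor_space (UNIV :: (nat \<Rightarrow> 'a) set)" using X by (rule cantor_space_sequences)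
  obtain \<phi> \<psi> where hom: "homeomorphism (UNIV :: (nat \<Rightarrow> 'a) set) (UNIV :: 'a set) \<phi> \<psi>"
    using cantor_spaces_homeomorphic[OF XX X] .
  have inv: "\<psi> (\<phi> x) = x" "\<phi> (\<psi> y) = y" for x y using hom by (auto simp: homeomorphism_def)
  have contP: "continuous_on UNIV P"
  proof (rule continuous_on_coordinatewise_then_product)
    show "continuous_on UNIV (\<lambda>x. P x n)" for n
      unfolding P_def by (intro continuous_on_compose2[OF _ continuous_on_product_coordinates, of UNIV]) auto
  qed
  have "continuous_on UNIV (\<phi> \<circ> P \<circ> \<psi>)"
    using hom contP by (intro continuous_on_compose) (auto simp: homeomorphism_def intro: continuous_on_subset)
  then obtain f :: "'a \<Rightarrow>\<^sub>C 'a" where f: "apply_bcontfun f = \<phi> \<circ> P \<circ> \<psi>"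
    using bcontfun_of_continuous[OF cpt] by blast
  have semi: "f (\<phi> x) = \<phi> (P x)" for x by (simp add: f inv)
  have "surj f"
    unfolding surj_def
  proof
    fix y
    have "\<forall>n. \<exists>z. \<psi> y n = F n z" using F(1) by (auto simp: Cs_def CR_def dest: surjD)
    then obtain x where "\<And>n. \<psi> y n = F n (x n)" by metis
    then have "P x = \<psi> y" by (auto simp: P_def)
    then have "f (\<phi> x) = y" by (simp add: semi inv)
    then show "\<exists>x. y = f x" by blast
  qed
  then have "f \<in> Cs" by (simp add: Cs_def)
  have "chain_recurrent P"
    unfolding P_def using F(1) by (intro chain_recurrent_sequences) (auto simp: CR_def)
  moreover have "uniformly_continuous_on UNIV \<phi>"
    using homeomorphism_cont1[OF hom] cantor_compact[OF XX] by (rule compact_uniformly_continuous)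
  ultimately have "chain_recurrent f"
    using chain_recurrent_factor[of P \<phi> f] homeomorphism_image1[OF hom] semi by blast
  have "m \<in> Per P" if m: "m \<in> Q" for m
  proof -
    have "m \<in> Per (F n)" for n using F(1)[of n] m by (auto simp: Cs_Per_def)
    then have "\<forall>n. \<exists>z. (apply_bcontfun (F n) ^^ m) z = z" by (simp add: Per_def)
    then obtain x where x: "\<And>n. (apply_bcontfun (F n) ^^ m) (x n) = x n" by metis
    have "(P ^^ i) x n = (apply_bcontfun (F n) ^^ i) (x n)" for i n
      by (induction i) (auto simp: P_def)
    then have "(P ^^ m) x = x" using x by auto
    then show ?thesis using m assms(2) by (auto simp: Per_def)
  qed
  then have "Q \<subseteq> Per f" using Per_semiconj[of f \<phi> P] semi by blast
  then have "f \<in> ?K" using \<open>f \<in> Cs\<close> \<open>chain_recurrent f\<close> by (simp add: Cs_Per_def CR_def)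
  have "transitive_element ?K f"
  proof (rule transitive_elementI[OF X _ _ \<open>f \<in> ?K\<close>])
    show "closedin (top_of_set Cs) ?K"
      using closedin_Cs_Per[OF cpt] closedin_CR by (intro closedin_Int) auto
    show "conj_invariant ?K"
      using conj_invariant_Cs_Per conj_invariant_CR[OF cpt] by (rule conj_invariant_Int)
    fix g :: "'a \<Rightarrow>\<^sub>C 'a" and l :: "'a \<Rightarrow> nat" assume g: "g \<in> ?K" and l: "continuous_on UNIV l"
    define E where "E = range (\<lambda>y. (l y, l (g y)))"
    have "E \<subseteq> range l \<times> range l" by (auto simp: E_def)
    then have "finite E" using finite_label_range[OF cpt l] by (meson finite_SigmaI finite_subset)
    then obtain c where c: "set c = E" using finite_list by blast
    define n where "n = to_nat c"
    have n: "set (from_nat n) = E" by (simp add: n_def c)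
    have "admits g E"
      unfolding admits_def using l by (intro exI[of _ l]) (auto simp: E_def image_image)
    then have "admits (F n) E" using F(2)[OF g, of n] n by simp
    then obtain \<pi> where \<pi>: "continuous_on UNIV \<pi>" "range \<pi> = fst ` E" "\<And>x. (\<pi> x, \<pi> (F n x)) \<in> E"
      unfolding admits_def by blast
    define \<rho> where "\<rho> y = \<pi> (\<psi> y n)" for y
    have "continuous_on UNIV (\<lambda>y. \<psi> y n)"
      using continuous_on_product_then_coordinatewise[OF homeomorphism_cont2[OF hom]] .
    then have "continuous_on UNIV \<rho>"
      unfolding \<rho>_def using \<pi>(1) by (intro continuous_on_label_comp[OF \<pi>(1)]) auto
    moreover have "range \<rho> = range l"
    proof -
      have "\<rho> (\<phi> (\<lambda>_. z)) = \<pi> z" for z by (simp add: \<rho>_def inv)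
      then have "range \<pi> \<subseteq> range \<rho>" by (metis image_subset_iff rangeI)
      moreover have "range \<rho> \<subseteq> range \<pi>" by (auto simp: \<rho>_def)
      moreover have "fst ` E = range l" by (auto simp: E_def image_image)
      ultimately show ?thesis using \<pi>(2) by auto
    qed
    moreover have "\<exists>y. l y = \<rho> x \<and> l (g y) = \<rho> (f x)" for x
    proof -
      have "\<rho> (f x) = \<pi> (F n (\<psi> x n))" by (simp add: \<rho>_def f inv P_def)
      then have "(\<rho> x, \<rho> (f x)) \<in> E" using \<pi>(3)[of "\<psi> x n"] by (simp add: \<rho>_def)
      then show ?thesis by (auto simp: E_def)
    qed
    ultimately show "simulates l f g" unfolding simulates_def by blast
  qed
  then show ?thesis unfolding conj_transitive_def by blast
qed

section \<open>Adding-machine structure on unions and clopen pieces\<close>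

text \<open>At resolutions finer than the separation of \<open>B\<close> from its complement,
  the levels of \<open>T\<close> restrict to the part of \<open>T\<close> in \<open>B\<close>.\<close>

lemma adding_levels_Int_clopen:
  assumes cpt: "compact (UNIV :: 'a::metric_space set)" and lev: "\<And>k. adding_level (T :: 'a set) f k"
    and B: "closed B" "open B" and "f ` (T \<inter> B) \<subseteq> T \<inter> B"
  shows "adding_level (T \<inter> B) f k"
proof -
  obtain e where e: "e > 0" "\<And>x y. x \<in> B \<Longrightarrow> dist x y < e \<Longrightarrow> y \<in> B"
    using clopen_separation[OF cpt B] by metis
  obtain K where K: "K \<ge> k" "1 / real (Suc K) < e" using Suc_inverse_less[OF e(1)] by metis
  have "adding_level (T \<inter> B) f K"
    by (rule adding_level_restrict[OF lev _ assms(5)]) (use e K in auto)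
  then show ?thesis using K(1) by (rule adding_level_antimono)
qed

lemma adding_level_Un:
  assumes S: "adding_level S f k" "f ` S \<subseteq> S" "closed S"
    and T: "adding_level T f k" "f ` T \<subseteq> T" "closed T" and disj: "S \<inter> T = {}"
  shows "adding_level (S \<union> T) f k"
proof -
  obtain l a b :: "'a \<Rightarrow> nat" where c: "continuous_on S l" "continuous_on S a" "continuous_on S b"
    and *: "\<And>x y. x \<in> S \<Longrightarrow> y \<in> S \<Longrightarrow> l x = l y \<Longrightarrow> dist x y < 1 / Suc k"
    "\<And>x y. x \<in> S \<Longrightarrow> y \<in> S \<Longrightarrow> l x = l y \<Longrightarrow> l (f x) = l (f y)"
    "\<And>x. x \<in> S \<Longrightarrow> a (f x) mod fact k = Suc (a x) mod fact k"
    "\<And>x. x \<in> S \<Longrightarrow> b (f x) = b x"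
    "\<And>x j. x \<in> S \<Longrightarrow> j \<le> k \<Longrightarrow> \<exists>y\<in>S. dist x y < 1 / Suc k \<and> b y = j"
    by (rule adding_levelE[OF S(1)]) (rule that)
  obtain l' a' b' :: "'a \<Rightarrow> nat" where c': "continuous_on T l'" "continuous_on T a'" "continuous_on T b'"
    and **: "\<And>x y. x \<in> T \<Longrightarrow> y \<in> T \<Longrightarrow> l' x = l' y \<Longrightarrow> dist x y < 1 / Suc k"
    "\<And>x y. x \<in> T \<Longrightarrow> y \<in> T \<Longrightarrow> l' x = l' y \<Longrightarrow> l' (f x) = l' (f y)"
    "\<And>x. x \<in> T \<Longrightarrow> a' (f x) mod fact k = Suc (a' x) mod fact k"
    "\<And>x. x \<in> T \<Longrightarrow> b' (f x) = b' x"
    "\<And>x j. x \<in> T \<Longrightarrow> j \<le> k \<Longrightarrow> \<exists>y\<in>T. dist x y < 1 / Suc k \<and> b' y = j"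
    by (rule adding_levelE[OF T(1)]) (rule that)
  define L where "L x = (if x \<in> S then 2 * l x else Suc (2 * l' x))" for x
  define A where "A x = (if x \<in> S then a x else a' x)" for x
  define C where "C x = (if x \<in> S then b x else b' x)" for x
  have split: "x \<in> S \<and> f x \<in> S \<or> x \<in> T \<and> x \<notin> S \<and> f x \<in> T \<and> f x \<notin> S" if "x \<in> S \<union> T" for x
    using that S(2) T(2) disj by blast
  have glue: "continuous_on (S \<union> T) (\<lambda>x. if x \<in> S then u x else v x)"
    if "continuous_on S u" "continuous_on T v" for u v :: "'a \<Rightarrow> nat"
    using that S(3) T(3) disj by (intro continuous_on_If) auto
  show ?thesis
  proof (rule adding_levelI)
    show "continuous_on (S \<union> T) L"
      unfolding L_def by (rule glue) (use c(1) c'(1) in \<open>auto intro: continuous_on_label_fun[where g = "\<lambda>v. 2 * v"] continuous_on_label_fun[where g = "\<lambda>v. Suc (2 * v)"]\<close>)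
    show "continuous_on (S \<union> T) A" unfolding A_def using c(2) c'(2) by (rule glue)
    show "continuous_on (S \<union> T) C" unfolding C_def using c(3) c'(3) by (rule glue)
    show "dist x y < 1 / Suc k \<and> L (f x) = L (f y)" if xy: "x \<in> S \<union> T" "y \<in> S \<union> T" "L x = L y" for x y
    proof (cases "x \<in> S")
      case True
      then have "y \<in> S" "l x = l y" using xy(3) by (auto simp: L_def split: if_splits) presburger+
      then show ?thesis using *(1,2)[OF True] S(2) True by (auto simp: L_def image_subset_iff)
    next
      case False
      then have y: "y \<notin> S" "l' x = l' y" using xy(3) by (auto simp: L_def split: if_splits) presburger+
      then have T': "x \<in> T" "y \<in> T" using False xy by auto
      show ?thesis using **(1,2)[OF T' y(2)] split[OF xy(1)] split[OF xy(2)] False y by (auto simp: L_def)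
    qed
    show "A (f x) mod fact k = Suc (A x) mod fact k" if "x \<in> S \<union> T" for x
      using split[OF that] *(3) **(3) by (auto simp: A_def)
    show "C (f x) = C x \<and> (\<forall>j\<le>k. \<exists>y\<in>S \<union> T. dist x y < 1 / Suc k \<and> C y = j)" if x: "x \<in> S \<union> T" for x
    proof (intro conjI allI impI)
      show "C (f x) = C x" using split[OF x] *(4) **(4) by (auto simp: C_def)
      fix j assume j: "j \<le> k"
      show "\<exists>y\<in>S \<union> T. dist x y < 1 / Suc k \<and> C y = j"
      proof (cases "x \<in> S")
        case True
        from *(5)[OF True j] obtain y where "y \<in> S" "dist x y < 1 / Suc k" "b y = j" by blast
        then show ?thesis by (intro bexI[of _ y]) (auto simp: C_def)
      next
        case False
        then have "x \<in> T" using x by blast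
        from **(5)[OF this j] obtain y where "y \<in> T" "dist x y < 1 / Suc k" "b' y = j" by blast
        then show ?thesis using disj by (intro bexI[of _ y]) (auto simp: C_def)
      qed
    qed
  qed
qed

section \<open>Gluing along shells that shrink to a point\<close>

definition nest :: "'a::metric_space \<Rightarrow> (nat \<Rightarrow> 'a set) \<Rightarrow> bool"
  where "nest x0 B \<longleftrightarrow> B 0 = UNIV \<and> (\<forall>n. closed (B n) \<and> open (B n) \<and> x0 \<in> B n \<and>
    B (Suc n) \<subset> B n \<and> B (Suc n) \<subseteq> ball x0 (1 / Suc n))"

lemma nest_exists:
  fixes x0 :: "'a::metric_space"
  assumes X: "cantor_space (UNIV :: 'a set)" and "P UNIV"
    and small: "\<And>e. e > 0 \<Longrightarrow> \<exists>D. closed D \<and> open D \<and> x0 \<in> D \<and> D \<subseteq> ball x0 e \<and> P D"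
  shows "\<exists>B. nest x0 B \<and> (\<forall>n. P (B n))"
proof -
  define G where "G n D \<longleftrightarrow> closed D \<and> open D \<and> x0 \<in> D \<and> P D \<and> (n = 0 \<longrightarrow> D = UNIV)" for n :: nat and D
  have "\<exists>D'. G (Suc n) D' \<and> D' \<subset> D \<and> D' \<subseteq> ball x0 (1 / Suc n)" if D: "G n D" for n D
  proof -
    obtain e where e: "e > 0" "ball x0 e \<subseteq> D" using D unfolding G_def by (metis openE)
    obtain y where y: "y \<noteq> x0" "dist x0 y < e"
      using X e(1) unfolding cantor_space_iff by (metis UNIV_I)
    \<comment> \<open>Missing \<open>y\<close> makes the next set strictly smaller.\<close>
    define d where "d = min (dist x0 y) (1 / real (Suc n))"
    have "d > 0" using y by (simp add: d_def)
    then obtain D' where D': "closed D'" "open D'" "x0 \<in> D'" "D' \<subseteq> ball x0 d" "P D'" using small by blast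
    have "ball x0 d \<subseteq> ball x0 e" "y \<notin> ball x0 d" "y \<in> D" "ball x0 d \<subseteq> ball x0 (1 / Suc n)"
      using y e by (auto simp: d_def)
    then show ?thesis using D' e by (intro exI[of _ D']) (auto simp: G_def)
  qed
  moreover have "G 0 UNIV" using \<open>P UNIV\<close> by (simp add: G_def)
  ultimately have "\<exists>B. \<forall>n. G n (B n) \<and> B (Suc n) \<subset> B n \<and> B (Suc n) \<subseteq> ball x0 (1 / Suc n)"
    by (intro dependent_nat_choice) auto
  then obtain B where BB: "\<forall>n. G n (B n) \<and> B (Suc n) \<subset> B n \<and> B (Suc n) \<subseteq> ball x0 (1 / Suc n)"
    by (elim exE) (rule that)
  have B: "G n (B n)" "B (Suc n) \<subset> B n" "B (Suc n) \<subseteq> ball x0 (1 / Suc n)" for n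
    using BB[rule_format, of n] by simp_all
  have "nest x0 B" using B(1)[of 0] B(1)[unfolded G_def] B(2,3) by (simp add: nest_def G_def)
  then show ?thesis using B(1) by (auto simp: G_def)
qed

text \<open>The successive differences of a nest partition the complement of its limit point.\<close>

definition shell :: "(nat \<Rightarrow> 'a set) \<Rightarrow> nat \<Rightarrow> 'a set"
  where "shell B n = B n - B (Suc n)"

lemma nest_antimono: "nest x0 B \<Longrightarrow> m \<le> n \<Longrightarrow> B n \<subseteq> B m"
  using lift_Suc_antimono_le[of B] unfolding nest_def by blast

lemma shell_cases:
  assumes "nest x0 B" "x \<noteq> x0"
  obtains n where "x \<in> shell B n"
proof -
  obtain m where "1 / real (Suc m) < dist x0 x" using Suc_inverse_less[of "dist x0 x"] assms(2) by auto
  then have ex: "\<exists>m. x \<notin> B (Suc m)" using assms(1) unfolding nest_def by (intro exI[of _ m]) force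
  define n where "n = (LEAST m. x \<notin> B (Suc m))"
  have "x \<notin> B (Suc n)" unfolding n_def using ex by (rule LeastI_ex)
  moreover have "x \<in> B n"
  proof (cases n)
    case 0
    then show ?thesis using assms(1) by (simp add: nest_def)
  next
    case (Suc m)
    then show ?thesis using not_less_Least[of m "\<lambda>m. x \<notin> B (Suc m)"] n_def by auto
  qed
  ultimately show ?thesis using that by (simp add: shell_def)
qed

lemma shell_index_le:
  assumes "nest x0 B" "x \<in> B m" "x \<in> shell B n"
  shows "m \<le> n"
proof (rule ccontr)
  assume "\<not> m \<le> n"
  then have "B m \<subseteq> B (Suc n)" using nest_antimono[OF assms(1), of "Suc n" m] by simp
  then show False using assms(2,3) by (auto simp: shell_def)
qed

lemma shell_unique:
  assumes "nest x0 B" "x \<in> shell B m" "x \<in> shell B n"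
  shows "m = n"
proof (rule ccontr)
  assume "m \<noteq> n"
  then have "B n \<subseteq> B (Suc m) \<or> B m \<subseteq> B (Suc n)"
    using nest_antimono[OF assms(1)] by (metis Suc_leI linorder_neqE_nat)
  then show False using assms(2,3) by (auto simp: shell_def)
qed

lemma shell_props:
  assumes "nest x0 B"
  shows "open (shell B n)" "closed (shell B n)" "shell B n \<noteq> {}" "x0 \<notin> shell B n"
  using assms unfolding nest_def shell_def by (auto intro: open_Diff closed_Diff)

text \<open>Maps between corresponding shells fit together, since points near \<open>x0\<close>
  lie in far shells and these are sent to far shells, which are near \<open>y0\<close>.\<close>

lemma glue_shells:
  fixes x0 :: "'a::metric_space" and y0 :: "'b::metric_space"
  assumes B: "nest x0 B" and C: "nest y0 C"
    and h: "\<And>n. continuous_on (shell B n) (h n)" "\<And>n. h n ` shell B n \<subseteq> shell C n"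
  obtains g where "continuous_on UNIV g" "g x0 = y0" "\<And>n x. x \<in> shell B n \<Longrightarrow> g x = h n x"
proof -
  define g where "g x = (if x = x0 then y0 else h (THE n. x \<in> shell B n) x)" for x
  have g: "g x = h n x" if "x \<in> shell B n" for x n
  proof -
    have "(THE n. x \<in> shell B n) = n" using that shell_unique[OF B] by blast
    moreover have "x \<noteq> x0" using that shell_props(4)[OF B] by auto
    ultimately show ?thesis by (simp add: g_def)
  qed
  have "isCont g x" for x
  proof (cases "x = x0")
    case False
    then obtain n where n: "x \<in> shell B n" using shell_cases[OF B] by blast
    have "continuous_on (shell B n) g" using h(1) g by (simp cong: continuous_on_cong)
    then show ?thesis using n shell_props(1)[OF B] continuous_on_eq_continuous_at by blast
  next
    case True
    have "\<exists>d>0. \<forall>y. dist y x0 < d \<longrightarrow> dist (g y) (g x0) < e" if e: "e > 0" for e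
    proof -
      obtain m where m: "1 / real (Suc m) < e" using Suc_inverse_less[OF e] by blast
      obtain d where d: "d > 0" "ball x0 d \<subseteq> B (Suc m)" using B unfolding nest_def by (metis openE)
      have "dist (g y) (g x0) < e" if "dist y x0 < d" for y
      proof (cases "y = x0")
        case False
        then obtain n where n: "y \<in> shell B n" using shell_cases[OF B] by blast
        have "y \<in> B (Suc m)" using d that by (auto simp: dist_commute)
        then have "Suc m \<le> n" using shell_index_le[OF B _ n] by blast
        moreover have "g y \<in> C n" using g[OF n] h(2)[of n] n by (auto simp: shell_def)
        ultimately have "g y \<in> C (Suc m)" using nest_antimono[OF C] by blast
        moreover have "C (Suc m) \<subseteq> ball y0 (1 / Suc m)" using C unfolding nest_def by blast
        ultimately have "dist y0 (g y) < 1 / Suc m" by auto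
        then show ?thesis using m by (simp add: g_def dist_commute)
      qed (use e in simp)
      then show ?thesis using d(1) by blast
    qed
    then show ?thesis using True by (simp add: continuous_at_eps_delta)
  qed
  then have "continuous_on UNIV g" by (simp add: continuous_on_eq_continuous_at)
  then show ?thesis using that[of g] g by (simp add: g_def)
qed

lemma shell_bijection:
  assumes B: "nest x0 B" and C: "nest y0 C" and g0: "g x0 = y0"
    and h: "\<And>n. bij_betw g (shell B n) (shell C n)"
  shows "bij g"
proof (rule bijI)
  show "inj g"
  proof (rule injI)
    fix x y assume eq: "g x = g y"
    have img: "g z \<in> shell C n" if "z \<in> shell B n" for z n
      using h[of n] that by (auto simp: bij_betw_def)
    show "x = y"
    proof (cases "x = x0 \<or> y = x0")
      case True
      then show ?thesis
        using eq g0 img shell_cases[OF B] shell_props(4)[OF C] by metis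
    next
      case False
      then obtain m n where mn: "x \<in> shell B m" "y \<in> shell B n" using shell_cases[OF B] by metis
      then have "m = n" using img[OF mn(1)] img[OF mn(2)] eq shell_unique[OF C] by metis
      then show ?thesis using h[of n] mn eq by (auto simp: bij_betw_def inj_on_def)
    qed
  qed
  show "surj g"
  proof -
    have "\<exists>x. y = g x" for y
    proof (cases "y = y0")
      case False
      then obtain n where "y \<in> shell C n" using shell_cases[OF C] by blast
      then show ?thesis using h[of n] by (auto simp: bij_betw_def)
    qed (use g0 in auto)
    then show ?thesis by blast
  qed
qed

section \<open>The generic chain recurrent map with a fixed point\<close>

definition small_clopen :: "nat \<Rightarrow> 'a::metric_space set set"
  where "small_clopen k = {D. closed D \<and> open D \<and> D \<noteq> {} \<and> (\<forall>x\<in>D. \<forall>y\<in>D. dist x y < 1 / real (Suc k))}"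

text \<open>The exceptional set \<open>D\<close> may depend on \<open>k\<close>, which makes this a
  countable intersection of open conditions. That one set serves all levels is then a consequence.\<close>

definition pointed_generic :: "('a::metric_space \<Rightarrow>\<^sub>C 'a) \<Rightarrow> bool"
  where "pointed_generic f \<longleftrightarrow> (\<forall>k. \<exists>D\<in>small_clopen k. f \<in> adding_off D k)"

text \<open>Phrased with levels rather than \<open>adding_family\<close>, so that it also holds for
  the whole space, which is where a nest starts and has empty complement.\<close>

definition adding_complement :: "('a::metric_space \<Rightarrow> 'a) \<Rightarrow> 'a set \<Rightarrow> bool"
  where "adding_complement f D \<longleftrightarrow> f ` D \<subseteq> D \<and> f ` (-D) \<subseteq> -D \<and> (\<forall>k. adding_level (-D) f k)"

text \<open>Off \<open>D\<close> there is a counter modulo at least two, which a fixed point would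
  have to increase and to preserve.\<close>

lemma fixed_point_in_small_clopen:
  assumes "f \<in> adding_off D k" "k \<ge> 2" "apply_bcontfun f x0 = x0"
  shows "x0 \<in> D"
proof (rule ccontr)
  assume "x0 \<notin> D"
  have "adding_level (-D) f k" using assms(1) by (simp add: adding_off_def)
  then obtain a where a: "\<forall>x\<in>-D. a (apply_bcontfun f x) mod fact k = Suc (a x) mod (fact k :: nat)"
    using adding_level_counter by blast
  have "a x0 mod fact k = Suc (a x0) mod fact k" using bspec[OF a, of x0] \<open>x0 \<notin> D\<close> assms(3) by simp
  moreover have "(fact k :: nat) \<ge> 2" using fact_ge_self[of k] assms(2) by linarith
  ultimately show False by (auto simp: mod_Suc split: if_splits)
qed

text \<open>By definition a pointed generic map satisfies a level of the adding-machine
  structure only off a set that may depend on the level. Since all these sets contain the fixed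
  point and their diameters tend to zero, they are eventually contained in any given one of
  them, and all levels restrict to its complement.\<close>

lemma pointed_generic_small:
  fixes f :: "'a::metric_space \<Rightarrow>\<^sub>C 'a"
  assumes cpt: "compact (UNIV :: 'a set)" and gen: "pointed_generic f" and fx: "apply_bcontfun f x0 = x0" and "e > 0"
  shows "\<exists>D. closed D \<and> open D \<and> x0 \<in> D \<and> D \<subseteq> ball x0 e \<and> adding_complement f D"
proof -
  have small: "\<exists>D K. K \<ge> k \<and> closed D \<and> open D \<and> x0 \<in> D \<and> 1 / real (Suc K) < e \<and> D \<subseteq> ball x0 e \<and> f \<in> adding_off D K" if e: "e > 0" for e k
  proof -
    \<comment> \<open>Resolution at least two forces the fixed point into the exceptional set.\<close>
    obtain K where K: "K \<ge> max k 2" "1 / real (Suc K) < e" using Suc_inverse_less[OF e] by metis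
    obtain D where D: "D \<in> small_clopen K" "f \<in> adding_off D K" using gen unfolding pointed_generic_def by blast
    have "x0 \<in> D" using fixed_point_in_small_clopen[OF D(2) _ fx] K by simp
    then show ?thesis using D K unfolding small_clopen_def by (intro exI[of _ D] exI[of _ K]) force
  qed
  obtain D K where D: "closed D" "open D" "x0 \<in> D" "D \<subseteq> ball x0 e" "f \<in> adding_off D K"
    using small[OF \<open>e > 0\<close>] by blast
  obtain d where d: "d > 0" "\<And>x y. x \<in> D \<Longrightarrow> dist x y < d \<Longrightarrow> y \<in> D"
    using clopen_separation[OF cpt D(1,2)] by metis
  have "adding_level (-D) f k" for k
  proof -
    obtain D' K' where D': "K' \<ge> k" "x0 \<in> D'" "1 / real (Suc K') < d" "D' \<subseteq> ball x0 d" "f \<in> adding_off D' K'"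
      using small[OF d(1)] by blast
    have "D' \<subseteq> D" using D'(4) d(2) D(3) by auto
    have "adding_level (-D) f K'"
    proof (rule adding_level_restrict[of "-D'"])
      show "adding_level (-D') f K'" using D'(5) by (simp add: adding_off_def)
      show "apply_bcontfun f ` (-D) \<subseteq> -D" using D(5) by (simp add: adding_off_def)
      show "y \<in> -D" if "x \<in> -D" "dist x y < 1 / real (Suc K')" for x y
        using d(2)[of y x] that D'(3) by (auto simp: dist_commute)
    qed (use \<open>D' \<subseteq> D\<close> in auto)
    then show ?thesis using D'(1) by (rule adding_level_antimono)
  qed
  then show ?thesis using D by (intro exI[of _ D]) (auto simp: adding_complement_def adding_off_def)
qed

lemma adding_family_shell:
  fixes f :: "'a::metric_space \<Rightarrow>\<^sub>C 'a"
  assumes cpt: "compact (UNIV :: 'a set)" and "f \<in> Cs"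
    and B: "nest x0 B" "\<And>n. adding_complement f (B n)"
  shows "adding_family (shell B n) f"
proof -
  have inv: "f x \<in> B n \<longleftrightarrow> x \<in> B n" for x n using B(2)[of n] by (auto simp: adding_complement_def)
  have sh: "f x \<in> shell B n \<longleftrightarrow> x \<in> shell B n" for x by (simp add: shell_def inv)
  have "adding_level (- B (Suc n) \<inter> B n) f k" for k
    by (rule adding_levels_Int_clopen[OF cpt]) (use B in \<open>auto simp: adding_complement_def nest_def inv\<close>)
  moreover have "- B (Suc n) \<inter> B n = shell B n" by (auto simp: shell_def)
  moreover have "f ` shell B n = shell B n"
  proof
    show "shell B n \<subseteq> f ` shell B n"
    proof
      fix y assume y: "y \<in> shell B n"
      obtain x where "y = f x" using \<open>f \<in> Cs\<close> by (auto simp: Cs_def dest: surjD)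
      then show "y \<in> f ` shell B n" using y sh by auto
    qed
  qed (use sh in auto)
  moreover have "compact (shell B n)"
    using compact_Int_closed[OF cpt shell_props(2)[OF B(1)], of n] by simp
  ultimately show ?thesis
    using shell_props(3)[OF B(1)] by (simp add: adding_family_def)
qed

lemma adding_complement_UNIV: "adding_complement f UNIV"
  unfolding adding_complement_def
proof (intro conjI allI)
  show "adding_level (- UNIV) f k" for k
    by (rule adding_levelI[of _ "\<lambda>_. 0" "\<lambda>_. 0" "\<lambda>_. 0"]) auto
qed auto

text \<open>The complements of the fixed points are cut into shells that carry adding-machine
  families; these are pairwise conjugate, and the conjugacies are glued.\<close>

lemma pointed_generic_unique:
  fixes f g :: "'a::metric_space \<Rightarrow>\<^sub>C 'a"
  assumes X: "cantor_space (UNIV :: 'a set)" and f: "f \<in> CR1" "pointed_generic f" and g: "g \<in> CR1" "pointed_generic g"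
  shows "g \<in> conj_class f"
proof -
  have cpt: "compact (UNIV :: 'a set)" using X by (rule cantor_compact)
  have Cs: "f \<in> Cs" "g \<in> Cs" using f g by (auto simp: CR1_def CR_def)
  obtain x0 y0 where fx: "f x0 = x0" "g y0 = y0" using f g by (auto simp: CR1_def)
  obtain B where B: "nest x0 B" "\<And>n. adding_complement f (B n)"
    using nest_exists[OF X, of "adding_complement f", OF adding_complement_UNIV pointed_generic_small[OF cpt f(2) fx(1)]] by blast
  obtain C where C: "nest y0 C" "\<And>n. adding_complement g (C n)"
    using nest_exists[OF X, of "adding_complement g", OF adding_complement_UNIV pointed_generic_small[OF cpt g(2) fx(2)]] by blast
  note fB = adding_family_shell[OF cpt Cs(1) B]
  note gC = adding_family_shell[OF cpt Cs(2) C]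
  have "\<forall>n. \<exists>h k. homeomorphism (shell B n) (shell C n) h k \<and> (\<forall>x\<in>shell B n. h (f x) = g (h x))"
    using adding_family_unique[OF fB gC] by metis
  then obtain h k where hk: "\<And>n. homeomorphism (shell B n) (shell C n) (h n) (k n)"
    and conj: "\<And>n x. x \<in> shell B n \<Longrightarrow> h n (f x) = g (h n x)" by metis
  have "continuous_on (shell B n) (h n)" "h n ` shell B n \<subseteq> shell C n" for n
    using hk[of n] by (auto simp: homeomorphism_def)
  then obtain F where F: "continuous_on UNIV F" "F x0 = y0" "\<And>n x. x \<in> shell B n \<Longrightarrow> F x = h n x"
    using glue_shells[OF B(1) C(1)] by metis
  have "bij_betw F (shell B n) (shell C n)" for n
  proof -
    have "bij_betw (h n) (shell B n) (shell C n)"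
      using hk[of n] by (intro bij_betw_byWitness[where f' = "k n"]) (auto simp: homeomorphism_def)
    then show ?thesis using F(3) by (simp cong: bij_betw_cong)
  qed
  then have "bij F" using shell_bijection[where g = F and B = B and C = C, OF B(1) C(1) F(2)] by blast
  then obtain F' where "homeomorphism UNIV UNIV F F'"
    using homeomorphism_compact[OF cpt F(1)] by (auto simp: bij_def)
  moreover have "g (F x) = F (f x)" for x
  proof (cases "x = x0")
    case False
    then obtain n where n: "x \<in> shell B n" using shell_cases[OF B(1)] by blast
    then have "f x \<in> shell B n" using fB[of n] by (auto simp: adding_family_def)
    then show ?thesis using F(3) n conj by simp
  qed (simp add: fx F(2))
  ultimately show ?thesis unfolding conj_class_iff by blast
qed

lemma pointed_generic_conj:
  fixes f g :: "'a::metric_space \<Rightarrow>\<^sub>C 'a"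
  assumes cpt: "compact (UNIV :: 'a set)" and "pointed_generic f" "g \<in> conj_class f"
  shows "pointed_generic g"
  unfolding pointed_generic_def
proof
  fix k
  obtain h h' where hk: "homeomorphism UNIV UNIV h h'" "\<And>x. g (h x) = h (f x)"
    using assms(3) unfolding conj_class_iff by blast
  have inv: "h' (h x) = x" "h (h' x) = x" for x using hk(1) by (auto simp: homeomorphism_def)
  obtain K where K: "K \<ge> k" "\<And>x y. dist x y < 1 / real (Suc K) \<Longrightarrow> dist (h x) (h y) < 1 / real (Suc k)"
    using uniform_scale[OF cpt homeomorphism_cont1[OF hk(1)], of k] by (metis UNIV_I)
  obtain D where D: "D \<in> small_clopen K" "f \<in> adding_off D K" using assms(2) unfolding pointed_generic_def by blast
  have "open (h ` D)" "closed (h ` D)"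
    using homeomorphism_imp_open_map[OF hk(1), of D] homeomorphism_imp_closed_map[OF hk(1), of D] D(1)
    by (auto simp: small_clopen_def)
  then have "h ` D \<in> small_clopen k" using D(1) K(2) by (auto simp: small_clopen_def)
  moreover have compl: "h ` (-D) = - h ` D"
  proof -
    have "inj h" "surj h" using inv by (metis injI, metis surjI)
    then show ?thesis by (intro bij_image_Compl_eq bijI)
  qed
  have "g ` h ` D \<subseteq> h ` D" "g ` (h ` (-D)) \<subseteq> h ` (-D)"
    using D(2) by (auto simp: adding_off_def image_subset_iff hk(2))
  moreover have "adding_level (h ` (-D)) g k"
  proof (rule adding_level_transport[where S = "-D" and f = f and K = K and h' = h'])
    show "homeomorphism (-D) (h ` (-D)) h h'"
      by (rule homeomorphism_of_subsets[OF hk(1)]) auto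
  qed (use D(2) K hk(2) in \<open>auto simp: adding_off_def\<close>)
  ultimately show "\<exists>D\<in>small_clopen k. g \<in> adding_off D k"
    unfolding adding_off_def by (intro bexI[of _ "h ` D"]) (auto simp: compl)
qed

text \<open>Put an adding-machine family on each shell of a nest, and fix the remaining point.\<close>

lemma pointed_generic_exists:
  assumes X: "cantor_space (UNIV :: 'a::metric_space set)"
  shows "\<exists>f :: 'a \<Rightarrow>\<^sub>C 'a. f \<in> CR1 \<and> pointed_generic f"
proof -
  have cpt: "compact (UNIV :: 'a set)" using X by (rule cantor_compact)
  fix x0 :: 'a
  have "\<exists>D. closed D \<and> open D \<and> x0 \<in> D \<and> D \<subseteq> ball x0 e \<and> True" if e: "e > 0" for e
  proof -
    obtain l :: "'a \<Rightarrow> nat" where l: "continuous_on UNIV l" "\<And>x y. l x = l y \<Longrightarrow> dist x y < e"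
      using X e unfolding cantor_space_iff fine_labels_def by (metis UNIV_I)
    have "open (l -` {l x0})" "closed (l -` {l x0})"
      using l(1) by (auto intro: open_vimage closed_vimage simp: open_discrete)
    then show ?thesis using l(2) by (intro exI[of _ "l -` {l x0}"]) (auto simp: dist_commute)
  qed
  then obtain B where B: "nest x0 B" using nest_exists[OF X, of "\<lambda>_. True" x0] by blast
  have "cantor_space (shell B n)" for n
    using cantor_space_clopen_subset[OF X, of "shell B n"] shell_props[OF B] by simp
  then have "\<forall>n. \<exists>F. adding_family (shell B n) F" using adding_family_exists by blast
  then obtain F where F: "\<And>n. adding_family (shell B n) (F n)" by metis
  have "continuous_on (shell B n) (F n)" "F n ` shell B n \<subseteq> shell B n" for n
    using F[of n] by (auto simp: adding_family_def)
  then obtain G where G: "continuous_on UNIV G" "G x0 = x0" "\<And>n x. x \<in> shell B n \<Longrightarrow> G x = F n x"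
    using glue_shells[OF B B] by metis
  obtain f :: "'a \<Rightarrow>\<^sub>C 'a" where f: "apply_bcontfun f = G" using bcontfun_of_continuous[OF cpt G(1)] .
  have fam: "adding_family (shell B n) G" for n
    by (rule adding_family_transport[OF F homeomorphism_ident]) (simp add: G(3))
  have img: "G ` shell B n = shell B n" for n using fam[of n] by (simp add: adding_family_def)
  have "\<exists>x. y = G x" for y
  proof (cases "y = x0")
    case False
    then obtain n where "y \<in> shell B n" using shell_cases[OF B] by blast
    then show ?thesis using img[of n] by blast
  qed (use G(2) in metis)
  then have "f \<in> Cs" by (auto simp: Cs_def f)
  moreover have "chain_recurrent f"
  proof (rule chain_recurrent_of_returns)
    fix x and e :: real assume "e > 0"
    show "\<exists>n\<ge>1. dist ((apply_bcontfun f ^^ n) x) x < e"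
    proof (cases "x = x0")
      case True
      then show ?thesis using G(2) \<open>e > 0\<close> by (intro exI[of _ 1]) (simp add: f)
    next
      case False
      then obtain n where "x \<in> shell B n" using shell_cases[OF B] by blast
      then show ?thesis using adding_family_returns[OF fam _ \<open>e > 0\<close>] by (simp add: f)
    qed
  qed
  ultimately have "f \<in> CR1" using G(2) f by (auto simp: CR1_def CR_def)
  moreover have "pointed_generic f"
    unfolding pointed_generic_def
  proof
    fix k
    have lev: "adding_level (- B m) G k \<and> G ` (- B m) \<subseteq> - B m" for m
    proof (induction m)
      case 0
      have "B 0 = UNIV" using B by (simp add: nest_def)
      then show ?case using adding_complement_UNIV[of G] by (auto simp: adding_complement_def)
    next
      case (Suc m)
      have eq: "- B (Suc m) = - B m \<union> shell B m" using B by (auto simp: nest_def shell_def)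
      moreover have "adding_level (shell B m) G k" using fam[of m] by (simp add: adding_family_def)
      moreover have "closed (- B m)" using B by (simp add: nest_def closed_Compl)
      moreover have "- B m \<inter> shell B m = {}" by (auto simp: shell_def)
      ultimately have "adding_level (- B m \<union> shell B m) G k"
        using Suc img[of m] shell_props(2)[OF B, of m] by (intro adding_level_Un) auto
      moreover have "G ` (- B m \<union> shell B m) \<subseteq> - B m \<union> shell B m" using Suc img[of m] by blast
      ultimately show ?case using eq by simp
    qed
    \<comment> \<open>The radius of this set is half of the admissible diameter.\<close>
    define D where "D = B (Suc (Suc (2 * k)))"
    have D: "closed D" "open D" "x0 \<in> D" "D \<subseteq> ball x0 (1 / Suc (Suc (2 * k)))"
      using B unfolding nest_def D_def by blast+
    have "dist x y < 1 / real (Suc k)" if xy: "x \<in> D" "y \<in> D" for x y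
    proof -
      have "dist x0 x < 1 / Suc (Suc (2 * k))" "dist x0 y < 1 / Suc (Suc (2 * k))" using xy D(4) by auto
      then have "dist x y < 1 / Suc (Suc (2 * k)) + 1 / Suc (Suc (2 * k))"
        using dist_triangle3[of x y x0] by linarith
      also have "\<dots> = 1 / real (Suc k)" by (simp add: field_simps)
      finally show ?thesis .
    qed
    then have "D \<in> small_clopen k" using D by (auto simp: small_clopen_def)
    moreover have "G ` D \<subseteq> D"
    proof
      fix y assume "y \<in> G ` D"
      then obtain x where x: "x \<in> D" "y = G x" by blast
      show "y \<in> D"
      proof (cases "x = x0")
        case False
        then obtain n where n: "x \<in> shell B n" using shell_cases[OF B] by blast
        then have "Suc (Suc (2 * k)) \<le> n" using shell_index_le[OF B] x(1) unfolding D_def by blast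
        moreover have "y \<in> B n" using img[of n] n x(2) by (auto simp: shell_def)
        ultimately show ?thesis using nest_antimono[OF B] unfolding D_def by blast
      qed (use x G(2) in simp)
    qed
    ultimately show "\<exists>D\<in>small_clopen k. f \<in> adding_off D k"
      using lev[of "Suc (Suc (2 * k))"] by (intro bexI[of _ D]) (auto simp: adding_off_def f D_def)
  qed
  ultimately show ?thesis by blast
qed

theorem CR1_generic:
  assumes X: "cantor_space (UNIV :: 'a::metric_space set)"
  shows "\<exists>f :: 'a \<Rightarrow>\<^sub>C 'a. transitive_element CR1 f \<and> residual_type CR1 f"
proof -
  have cpt: "compact (UNIV :: 'a set)" using X by (rule cantor_compact)
  obtain f :: "'a \<Rightarrow>\<^sub>C 'a" where f: "f \<in> CR1" "pointed_generic f" using pointed_generic_exists[OF X] by blast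
  obtain x0 where x0: "f x0 = x0" using f by (auto simp: CR1_def)
  obtain y where "y \<noteq> x0" using X unfolding cantor_space_iff by (metis UNIV_I zero_less_one)
  then obtain D where D: "closed D" "open D" "x0 \<in> D" "D \<subseteq> ball x0 (dist x0 y)" "adding_complement f D"
    using pointed_generic_small[OF cpt f(2) x0, of "dist x0 y"] by auto
  have fam: "adding_family (-D) f"
    unfolding adding_family_def
  proof (intro conjI allI)
    show "compact (-D)" using compact_Int_closed[OF cpt, of "-D"] D(2) by (simp add: closed_Compl)
    show "-D \<noteq> {}" using D(4) by auto
    show "apply_bcontfun f ` (-D) = -D"
    proof
      show "-D \<subseteq> apply_bcontfun f ` (-D)"
      proof
        fix y assume y: "y \<in> -D"
        obtain x where "y = f x" using f by (auto simp: CR1_def CR_def Cs_def dest: surjD)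
        then show "y \<in> apply_bcontfun f ` (-D)" using y D(5) by (auto simp: adding_complement_def)
      qed
    qed (use D(5) in \<open>auto simp: adding_complement_def\<close>)
  qed (use D(5) in \<open>auto simp: adding_complement_def\<close>)
  have inv: "conj_invariant (CR1 :: ('a \<Rightarrow>\<^sub>C 'a) set)"
    unfolding CR1_eq using conj_invariant_Cs_Per conj_invariant_CR[OF cpt] by (rule conj_invariant_Int)
  have "transitive_element CR1 f"
  proof (rule transitive_elementI[OF X _ inv f(1)])
    show "closedin (top_of_set Cs) (CR1 :: ('a \<Rightarrow>\<^sub>C 'a) set)"
      unfolding CR1_eq using closedin_Cs_Per[OF cpt] closedin_CR by (intro closedin_Int) auto
    fix g :: "'a \<Rightarrow>\<^sub>C 'a" and l :: "'a \<Rightarrow> nat" assume "g \<in> CR1" "continuous_on UNIV l"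
    then show "simulates l f g"
      using adding_family_simulates[OF cpt, of g l D f] fam D by (auto simp: CR1_def CR_def adding_complement_def)
  qed
  moreover have "conj_class f = {g \<in> CR1. \<forall>k. \<exists>D\<in>small_clopen k. g \<in> adding_off D k}"
  proof (intro equalityI subsetI)
    fix g assume g: "g \<in> conj_class f"
    then have "g \<in> CR1" using inv f(1) by (auto simp: conj_invariant_def)
    then show "g \<in> {g \<in> CR1. \<forall>k. \<exists>D\<in>small_clopen k. g \<in> adding_off D k}"
      using pointed_generic_conj[OF cpt f(2) g] by (simp add: pointed_generic_def)
  next
    fix g :: "'a \<Rightarrow>\<^sub>C 'a" assume "g \<in> {g \<in> CR1. \<forall>k. \<exists>D\<in>small_clopen k. g \<in> adding_off D k}"
    then show "g \<in> conj_class f" using pointed_generic_unique[OF X f] by (simp add: pointed_generic_def)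
  qed
  then have "residual_type CR1 f"
    unfolding residual_type_def using gdelta_adding_levels[OF cpt, of small_clopen CR1] by (auto simp: small_clopen_def)
  ultimately show ?thesis by blast
qed

section \<open>Suspensions and periodic maps\<close>

lemma cantor_space_Times_nats:
  assumes X: "cantor_space (UNIV :: 'a::metric_space set)" and I: "finite I" "I \<noteq> {}"
  shows "cantor_space ((UNIV :: 'a set) \<times> real ` I)"
  unfolding cantor_space_iff
proof (intro conjI ballI allI impI)
  have cpt: "compact (UNIV :: 'a set)" using X by (rule cantor_compact)
  show "(UNIV :: 'a set) \<times> real ` I \<noteq> {}" using I by auto
  show "compact ((UNIV :: 'a set) \<times> real ` I)" using I by (intro compact_Times cpt finite_imp_compact) auto
  show "fine_labels ((UNIV :: 'a set) \<times> real ` I)"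
    unfolding fine_labels_def
  proof (intro allI impI)
    fix e :: real assume "e > 0"
    then obtain l :: "'a \<Rightarrow> nat" where l: "continuous_on UNIV l" "\<And>x y. l x = l y \<Longrightarrow> dist x y < e"
      using X unfolding cantor_space_iff fine_labels_def by (metis UNIV_I)
    have "continuous_on (UNIV \<times> real ` I) (\<lambda>p::'a \<times> real. l (fst p))"
      by (rule continuous_on_label_comp[OF l(1) continuous_on_fst[OF continuous_on_id]]) auto
    moreover have "continuous_on (UNIV \<times> real ` I) (\<lambda>p::'a \<times> real. nat \<lfloor>snd p\<rfloor>)"
      unfolding continuous_on_nat_iff
    proof (intro ballI exI[of _ 1] conjI impI)
      fix p q :: "'a \<times> real" assume "p \<in> UNIV \<times> real ` I" "q \<in> UNIV \<times> real ` I" "dist p q < 1"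
      moreover have "dist (snd p) (snd q) \<le> dist p q" by (rule dist_snd_le)
      ultimately show "nat \<lfloor>snd q\<rfloor> = nat \<lfloor>snd p\<rfloor>" by (auto simp: dist_real_def)
    qed simp
    ultimately have cont: "continuous_on (UNIV \<times> real ` I) (\<lambda>p. prod_encode (l (fst p), nat \<lfloor>snd p\<rfloor>))"
      by (rule continuous_on_label_fun2)
    have mesh: "dist p q < e"
      if "p \<in> UNIV \<times> real ` I" "q \<in> UNIV \<times> real ` I" "prod_encode (l (fst p), nat \<lfloor>snd p\<rfloor>) = prod_encode (l (fst q), nat \<lfloor>snd q\<rfloor>)" for p q
      using that l(2) by (auto simp: dist_Pair_Pair)
    show "\<exists>l. continuous_on ((UNIV :: 'a set) \<times> real ` I) l \<and>
        (\<forall>p\<in>UNIV \<times> real ` I. \<forall>q\<in>UNIV \<times> real ` I. l p = (l q :: nat) \<longrightarrow> dist p q < e)"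
      by (rule exI[of _ "\<lambda>p :: 'a \<times> real. prod_encode (l (fst p), nat \<lfloor>snd p\<rfloor>)"]) (intro conjI ballI impI cont mesh)
  qed
  fix p :: "'a \<times> real" and e :: real assume p: "p \<in> UNIV \<times> real ` I" and "e > 0"
  then obtain y where y: "y \<noteq> fst p" "dist (fst p) y < e"
    using X unfolding cantor_space_iff by (metis UNIV_I)
  then show "\<exists>q\<in>UNIV \<times> real ` I. q \<noteq> p \<and> dist p q < e"
    using p by (intro bexI[of _ "(y, snd p)"]) (auto simp: dist_Pair_Pair)
qed

definition tower_space :: "nat \<Rightarrow> nat \<Rightarrow> (('a \<times> nat) \<times> nat) set"
  where "tower_space N n = (UNIV \<times> {1..N}) \<times> {1..n}"

lemma compact_tower_space:
  assumes "compact (UNIV :: 'a::topological_space set)"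
  shows "compact (tower_space N n :: (('a \<times> nat) \<times> nat) set)"
  unfolding tower_space_def using assms by (intro compact_Times finite_imp_compact[of "{1.._}"]) auto

text \<open>The pairs of indices are numbered injectively by \<open>c\<close>, which turns the
  disjoint union into a product with a finite set of reals.\<close>

lemma tower_space_homeomorphic:
  assumes X: "cantor_space (UNIV :: 'a::metric_space set)" and "N \<ge> 1" "n \<ge> 1"
  obtains \<phi> \<psi> where "homeomorphism (tower_space N n :: (('a \<times> nat) \<times> nat) set) (UNIV :: 'a set) \<phi> \<psi>"
proof -
  let ?Y = "tower_space N n :: (('a \<times> nat) \<times> nat) set"
  define c where "c i j = i + j * Suc N" for i j :: nat
  define \<zeta> :: "('a \<times> nat) \<times> nat \<Rightarrow> 'a \<times> real"
    where "\<zeta> p = (fst (fst p), real (snd (fst p)) + real (snd p) * real (Suc N))" for p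
  define I where "I = (\<lambda>(i, j). c i j) ` ({1..N} \<times> {1..n})"
  have c_inj: "i = i' \<and> j = j'" if "c i j = c i' j'" "i \<le> N" "i' \<le> N" for i j i' j'
  proof -
    have "c i j mod Suc N = i" "c i j div Suc N = j" "c i' j' mod Suc N = i'" "c i' j' div Suc N = j'"
      using that(2,3) by (auto simp: c_def simp del: mult_Suc_right)
    then show ?thesis using that(1) by metis
  qed
  have \<zeta>: "\<zeta> ((x, i), j) = (x, real (c i j))" for x i j by (simp add: \<zeta>_def c_def algebra_simps)
  have "continuous_on ?Y \<zeta>" unfolding \<zeta>_def by (intro continuous_intros)
  moreover have "inj_on \<zeta> ?Y"
  proof (rule inj_onI)
    fix p q assume pq: "p \<in> ?Y" "q \<in> ?Y" "\<zeta> p = \<zeta> q"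
    obtain x i j x' i' j' where "p = ((x, i), j)" "q = ((x', i'), j')" by (metis prod.exhaust)
    then show "p = q" using pq c_inj[of i j i' j'] by (auto simp: \<zeta> tower_space_def)
  qed
  moreover have "\<zeta> ` ?Y = UNIV \<times> real ` I"
  proof (intro equalityI subsetI)
    fix r assume "r \<in> \<zeta> ` ?Y"
    then obtain x i j where "r = (x, real (c i j))" "i \<in> {1..N}" "j \<in> {1..n}"
      by (auto simp: \<zeta> tower_space_def)
    moreover from this have "c i j \<in> I" unfolding I_def by (intro image_eqI[of _ _ "(i, j)"]) auto
    ultimately show "r \<in> UNIV \<times> real ` I" by simp
  next
    fix r :: "'a \<times> real" assume "r \<in> UNIV \<times> real ` I"
    then obtain x i j where "r = (x, real (c i j))" "i \<in> {1..N}" "j \<in> {1..n}" by (auto simp: I_def)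
    then show "r \<in> \<zeta> ` ?Y" by (intro image_eqI[of _ _ "((x, i), j)"]) (auto simp: \<zeta> tower_space_def)
  qed
  ultimately obtain \<xi> where 2: "homeomorphism ?Y (UNIV \<times> real ` I) \<zeta> \<xi>"
    using homeomorphism_compact[OF compact_tower_space[OF cantor_compact[OF X]]] by metis
  have "cantor_space ((UNIV :: 'a set) \<times> real ` I)"
    using assms(2,3) by (intro cantor_space_Times_nats[OF X]) (auto simp: I_def)
  then obtain h k where 3: "homeomorphism ((UNIV :: 'a set) \<times> real ` I) (UNIV :: 'a set) h k"
    using cantor_spaces_homeomorphic X by metis
  show ?thesis by (rule that[OF homeomorphism_compose[OF 2 3]])
qed

abbreviation tower :: "nat \<Rightarrow> ('a \<Rightarrow> 'a) \<Rightarrow> ('a \<times> nat) \<times> nat \<Rightarrow> ('a \<times> nat) \<times> nat"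
  where "tower N g \<equiv> copies (suspension N g)"

lemma tower_simp: "tower N g ((x, i), j) = (if i < N then ((x, i + 1), j) else ((g x, 1), j))"
  by (simp add: copies_def suspension_def)

lemma tower_image:
  fixes g :: "'a \<Rightarrow> 'a"
  assumes "surj g" "N \<ge> 1"
  shows "tower N g ` tower_space N n = tower_space N n"
proof
  let ?Y = "tower_space N n :: (('a \<times> nat) \<times> nat) set"
  show "tower N g ` ?Y \<subseteq> ?Y"
    using assms(2) by (auto simp: tower_space_def tower_simp split: if_splits)
  show "?Y \<subseteq> tower N g ` ?Y"
  proof
    fix p assume "p \<in> ?Y"
    then obtain y i j where p: "p = ((y, i), j)" "1 \<le> i" "i \<le> N" "1 \<le> j" "j \<le> n"
      by (auto simp: tower_space_def)
    obtain x where x: "y = g x" using assms(1) by (auto dest: surjD)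
    define q where "q = (if i = 1 then ((x, N), j) else ((y, i - 1), j))"
    have "tower N g q = p" "q \<in> ?Y"
      using p x assms(2) by (auto simp: q_def tower_simp tower_space_def)
    then show "p \<in> tower N g ` ?Y" by blast
  qed
qed

lemma continuous_on_tower:
  fixes g :: "'a::topological_space \<Rightarrow> 'a"
  assumes "continuous_on UNIV g"
  shows "continuous_on (tower_space N n) (tower N g)"
proof -
  let ?A = "{p. snd (fst p) < N} :: (('a \<times> nat) \<times> nat) set"
  let ?B = "{p. \<not> snd (fst p) < N} :: (('a \<times> nat) \<times> nat) set"
  have c: "continuous_on UNIV (\<lambda>p::(('a \<times> nat) \<times> nat). snd (fst p))" by (intro continuous_intros)
  have "closed V" for V :: "nat set" by (simp only: closed_def open_discrete)
  then have "closed ((\<lambda>p::(('a \<times> nat) \<times> nat). snd (fst p)) -` V)" for V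
    using c by (rule closed_vimage)
  from this[of "{..<N}"] this[of "- {..<N}"] have "closed ?A" "closed ?B"
    by (auto simp: vimage_def not_less)
  moreover have "continuous_on ?A (\<lambda>p. ((fst (fst p), Suc (snd (fst p))), snd p))"
    by (intro continuous_on_Pair continuous_on_compose2[OF Topological_Spaces.continuous_on_discrete[of UNIV Suc]] continuous_intros) auto
  moreover have "continuous_on ?B (\<lambda>p. ((g (fst (fst p)), 1::nat), snd p))"
    by (intro continuous_on_Pair continuous_on_compose2[OF assms(1) continuous_on_fst[OF continuous_on_fst[OF continuous_on_id]]]
        continuous_intros) auto
  ultimately have "continuous_on (?A \<union> ?B) (\<lambda>p. if snd (fst p) < N then ((fst (fst p), Suc (snd (fst p))), snd p) else ((g (fst (fst p)), 1), snd p))"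
    by (intro continuous_on_If) auto
  moreover have "tower N g = (\<lambda>p. if snd (fst p) < N then ((fst (fst p), Suc (snd (fst p))), snd p) else ((g (fst (fst p)), 1), snd p))"
    by (auto simp: fun_eq_iff tower_simp)
  ultimately show ?thesis using continuous_on_subset by auto
qed

lemma suspension_copies_exists:
  fixes g :: "'a::metric_space \<Rightarrow>\<^sub>C 'a"
  assumes X: "cantor_space (UNIV :: 'a set)" and g: "g \<in> Cs" and n: "n \<ge> 1"
  shows "\<exists>f. suspension_copies g n f"
proof -
  have N: "(fact n :: nat) \<ge> 1" by (rule fact_ge_1)
  let ?Y = "tower_space (fact n) n :: (('a \<times> nat) \<times> nat) set" and ?F = "tower (fact n) (apply_bcontfun g)"
  obtain \<phi> \<psi> where hom: "homeomorphism ?Y (UNIV :: 'a set) \<phi> \<psi>" using tower_space_homeomorphic[OF X N n] .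
  have h: "continuous_on ?Y \<phi>" "continuous_on UNIV \<psi>" "\<phi> ` ?Y = UNIV" "\<psi> ` UNIV = ?Y" "\<And>y. y \<in> ?Y \<Longrightarrow> \<psi> (\<phi> y) = y"
    using hom by (auto simp: homeomorphism_def)
  have F: "continuous_on ?Y ?F" "?F ` ?Y = ?Y"
    using continuous_on_tower[of "apply_bcontfun g"] tower_image[OF _ N, of "apply_bcontfun g" n] g
    by (simp_all add: Cs_def)
  have "continuous_on UNIV (\<phi> \<circ> ?F \<circ> \<psi>)"
    by (intro continuous_on_compose h) (simp_all add: h F)
  then obtain f :: "'a \<Rightarrow>\<^sub>C 'a" where f: "apply_bcontfun f = \<phi> \<circ> ?F \<circ> \<psi>"
    using bcontfun_of_continuous[OF cantor_compact[OF X]] by blast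
  have "range f = \<phi> ` ?F ` \<psi> ` UNIV" by (simp add: f image_comp)
  then have "f \<in> Cs" by (simp add: Cs_def h F)
  moreover have "isomorphic_maps ?Y ?F UNIV f"
    unfolding isomorphic_maps_def using hom h(5) by (intro exI[of _ \<phi>] exI[of _ \<psi>]) (simp add: f)
  ultimately show ?thesis unfolding suspension_copies_def tower_space_def by blast
qed

lemma suspension_copiesE:
  assumes "suspension_copies g n f"
  obtains \<phi> \<psi> where "f \<in> Cs" "homeomorphism (tower_space (fact n) n) UNIV \<phi> \<psi>"
    "\<And>y. y \<in> tower_space (fact n) n \<Longrightarrow> \<phi> (tower (fact n) (apply_bcontfun g) y) = apply_bcontfun f (\<phi> y)"
  using assms that unfolding suspension_copies_def isomorphic_maps_def tower_space_def by blast

lemma suspension_copies_cyclic_towers: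
  fixes f g :: "'a::metric_space \<Rightarrow>\<^sub>C 'a"
  assumes f: "suspension_copies g n f" and g: "g \<in> Cs"
  shows "cyclic_towers n {} f"
proof -
  let ?Y = "tower_space (fact n) n :: (('a \<times> nat) \<times> nat) set" and ?F = "tower (fact n) (apply_bcontfun g)"
  obtain \<phi> \<psi> where hom: "homeomorphism ?Y UNIV \<phi> \<psi>" and semi: "\<And>y. y \<in> ?Y \<Longrightarrow> \<phi> (?F y) = f (\<phi> y)"
    by (rule suspension_copiesE[OF f]) (rule that)
  have h: "continuous_on UNIV \<psi>" "\<And>z. \<psi> z \<in> ?Y" "\<And>y. y \<in> ?Y \<Longrightarrow> \<psi> (\<phi> y) = y" "\<And>z. \<phi> (\<psi> z) = z"
    using hom by (auto simp: homeomorphism_def)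
  have N: "(fact n :: nat) \<ge> 1" by (rule fact_ge_1)
  have F: "?F y \<in> ?Y" if "y \<in> ?Y" for y
    using tower_image[OF _ N, of "apply_bcontfun g" n] g that by (auto simp: Cs_def)
  have \<psi>f: "\<psi> (f z) = ?F (\<psi> z)" for z
    using semi[OF h(2), of z] h(3)[OF F[OF h(2)], of z] by (simp add: h(4))
  define a where "a z = snd (fst (\<psi> z))" for z
  define b where "b z = snd (\<psi> z) - 1" for z
  have "continuous_on UNIV a"
    unfolding a_def by (intro continuous_intros h)
  moreover have "continuous_on UNIV b"
  proof -
    have "continuous_on UNIV (\<lambda>z. snd (\<psi> z))" by (intro continuous_intros h)
    then show ?thesis unfolding b_def by (rule continuous_on_label_fun[where g = "\<lambda>v. v - 1"])
  qed
  moreover have "a (f z) mod fact n = Suc (a z) mod fact n \<and> b (f z) = b z" for z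
  proof -
    obtain x i j where p: "\<psi> z = ((x, i), j)" by (metis prod.exhaust)
    have "i \<le> fact n" using h(2)[of z] p by (simp add: tower_space_def)
    then show ?thesis by (auto simp: a_def b_def \<psi>f p tower_simp mod_Suc)
  qed
  moreover have "\<exists>z. b z = j \<and> a z mod fact n = 0" if "j < n" for j
  proof -
    obtain x :: 'a where True by simp
    have y: "((x, fact n), Suc j) \<in> ?Y" using that N by (simp add: tower_space_def)
    then show ?thesis
      by (intro exI[of _ "\<phi> ((x, fact n), Suc j)"]) (simp add: a_def b_def h(3)[OF y])
  qed
  ultimately have "continuous_on (-{}) a \<and> continuous_on (-{}) b \<and>
      (\<forall>x\<in>-{}. a (f x) mod fact n = Suc (a x) mod fact n \<and> b (f x) = b x) \<and>
      (\<forall>j<n. \<exists>x\<in>-{}. b x = j \<and> a x mod fact n = 0)"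
    by auto
  then show ?thesis unfolding cyclic_towers_def by blast
qed

text \<open>Run through all floors of the suspension while a chain of \<open>g\<close> makes one
  step. The label \<open>m\<close> of a point \<open>x\<close> lists the labels of all points
  above \<open>x\<close>, so a jump of the chain within a fibre of \<open>m\<close> is allowed
  on every floor. The chain starts on floor \<open>i\<close>, hence the shift by \<open>i -
  1\<close>.\<close>

lemma suspension_copies_CR:
  fixes f g :: "'a::metric_space \<Rightarrow>\<^sub>C 'a"
  assumes X: "cantor_space (UNIV :: 'a set)" and f: "suspension_copies g n f" and g: "g \<in> CR"
  shows "f \<in> CR"
proof -
  define N :: nat where "N = fact n"
  have N: "N \<ge> 1" by (simp add: N_def)
  let ?Y = "tower_space N n :: (('a \<times> nat) \<times> nat) set" and ?F = "tower N (apply_bcontfun g)"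
  obtain \<phi> \<psi> where "f \<in> Cs" and hom: "homeomorphism ?Y UNIV \<phi> \<psi>" and semi: "\<And>y. y \<in> ?Y \<Longrightarrow> \<phi> (?F y) = f (\<phi> y)"
    by (rule suspension_copiesE[OF f, folded N_def]) (rule that)
  have cpt: "compact (UNIV :: 'a set)" using X by (rule cantor_compact)
  have "chain_recurrent f"
  proof (rule chain_recurrent_labelI[OF X])
    fix l :: "'a \<Rightarrow> nat" and z assume l: "continuous_on UNIV l"
    obtain x i j where p: "\<psi> z = ((x, i), j)" by (metis prod.exhaust)
    have pY: "((x, i), j) \<in> ?Y" and z: "z = \<phi> ((x, i), j)"
    proof -
      have "\<psi> z \<in> ?Y" using homeomorphism_image2[OF hom] by blast
      then show "((x, i), j) \<in> ?Y" by (simp add: p)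
      show "z = \<phi> ((x, i), j)" using homeomorphism_apply2[OF hom, of z] p by simp
    qed
    from pY have ij: "1 \<le> i" "i \<le> N" "1 \<le> j" "j \<le> n" by (auto simp: tower_space_def)
    define m where "m x = list_encode (map (\<lambda>r. l (\<phi> ((x, Suc r), j))) [0..<N])" for x
    have "continuous_on UNIV m"
      unfolding m_def
    proof (rule continuous_on_list_label)
      fix r assume "r < N"
      have "continuous_on UNIV (\<lambda>x. ((x, Suc r), j))" by (intro continuous_intros)
      then have "continuous_on UNIV (\<lambda>x. \<phi> ((x, Suc r), j))"
        by (rule continuous_on_compose2[OF homeomorphism_cont1[OF hom]]) (use \<open>r < N\<close> ij in \<open>auto simp: tower_space_def\<close>)
      then show "continuous_on UNIV (\<lambda>x. l (\<phi> ((x, Suc r), j)))"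
        by (rule continuous_on_label_comp[OF l]) auto
    qed
    then obtain k s where s: "k \<ge> 1" "s 0 = x" "s k = x" "\<forall>i<k. m (g (s i)) = m (s (Suc i))"
      using chain_recurrent_labelD[of g m x] g cpt by (auto simp: CR_def)
    define t where "t q = \<phi> ((s ((q + (i - 1)) div N), Suc ((q + (i - 1)) mod N)), j)" for q
    have "l (f (t q)) = l (t (Suc q))" if q: "q < k * N" for q
    proof -
      define u where "u = (q + (i - 1)) div N"
      define v where "v = (q + (i - 1)) mod N"
      have uv: "q + (i - 1) = u * N + v" "v < N" using N by (auto simp: u_def v_def)
      have "((s u, Suc v), j) \<in> ?Y" using uv ij by (auto simp: tower_space_def)
      then have ft: "f (t q) = \<phi> (?F ((s u, Suc v), j))" using semi by (simp add: t_def u_def v_def)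
      show ?thesis
      proof (cases "Suc v < N")
        case True
        have "Suc q + (i - 1) = Suc v + u * N" using uv(1) by simp
        moreover have "(Suc v + u * N) div N = u" "(Suc v + u * N) mod N = Suc v"
          using True N by (simp_all only: div_mult_self1 mod_mult_self1) simp_all
        ultimately have "(Suc q + (i - 1)) div N = u" "(Suc q + (i - 1)) mod N = Suc v"
          by (simp_all only:)
        then have "t (Suc q) = \<phi> ((s u, Suc (Suc v)), j)" by (simp add: t_def)
        then show ?thesis using True by (simp add: ft tower_simp)
      next
        case False
        then have v: "Suc v = N" using uv by simp
        have sq: "Suc q + (i - 1) = Suc u * N" using uv v by simp
        then have "(Suc q + (i - 1)) div N = Suc u" "(Suc q + (i - 1)) mod N = 0"
          using N by simp_all
        then have t': "t (Suc q) = \<phi> ((s (Suc u), Suc 0), j)" by (simp add: t_def)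
        have "u < k"
        proof (rule ccontr)
          assume "\<not> u < k"
          then have "k * N \<le> u * N" by (intro mult_le_mono1) simp
          with q have "q < u * N" by (rule order_less_le_trans)
          then show False using sq ij by simp
        qed
        then have "m (g (s u)) = m (s (Suc u))" using s(4) by blast
        then have "l (\<phi> ((g (s u), Suc 0), j)) = l (\<phi> ((s (Suc u), Suc 0), j))"
          using N by (auto simp: m_def list_encode_eq)
        then show ?thesis using v by (simp add: ft tower_simp t')
      qed
    qed
    moreover have "t 0 = z" using ij s(2) by (simp add: t_def z)
    moreover have "t (k * N) = z"
    proof -
      have "k * N + (i - 1) = (i - 1) + k * N" by simp
      moreover have "((i - 1) + k * N) div N = k" "((i - 1) + k * N) mod N = i - 1"
        using ij N by (simp_all only: div_mult_self1 mod_mult_self1) simp_all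
      ultimately have "(k * N + (i - 1)) div N = k" "(k * N + (i - 1)) mod N = i - 1"
        by (simp_all only:)
      then show ?thesis using ij s(3) unfolding t_def z by simp
    qed
    moreover have "k * N \<ge> 1" using s(1) N by simp
    ultimately show "\<exists>n\<ge>1. \<exists>s. s 0 = z \<and> s n = z \<and> (\<forall>i<n. l (f (s i)) = l (s (Suc i)))"
      by (intro exI[of _ "k * N"] conjI exI[of _ t]) auto
  qed
  then show ?thesis using \<open>f \<in> Cs\<close> by (simp add: CR_def)
qed

theorem suspension_copies_dense:
  fixes g :: "'a::metric_space \<Rightarrow>\<^sub>C 'a"
  assumes X: "cantor_space (UNIV :: 'a set)" and g: "g \<in> CR" and gs: "\<And>n. n \<ge> 1 \<Longrightarrow> suspension_copies g n (gs n)"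
  shows "dense_subset (\<Union>n\<in>{1..}. conj_class (gs n)) CR"
  unfolding dense_subset_def
proof (intro conjI subsetI)
  have cpt: "compact (UNIV :: 'a set)" using X by (rule cantor_compact)
  fix f assume "f \<in> (\<Union>n\<in>{1..}. conj_class (gs n))"
  then show "f \<in> CR"
    using suspension_copies_CR[OF X gs g] conj_invariant_CR[OF cpt] by (auto simp: conj_invariant_def)
next
  have cpt: "compact (UNIV :: 'a set)" using X by (rule cantor_compact)
  fix t :: "'a \<Rightarrow>\<^sub>C 'a" assume t: "t \<in> CR"
  have "t \<in> closure (\<Union>f\<in>gs ` {1..}. conj_class f)"
  proof (rule simulates_imp_closure_conj_class[OF X])
    fix l :: "'a \<Rightarrow> nat" assume "continuous_on UNIV l"
    then obtain k where k: "k \<ge> 1" "\<And>(f :: 'a \<Rightarrow> 'a). cyclic_towers k {} f \<Longrightarrow> simulates l f t"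
      using cyclic_towers_simulate[OF cpt, of t l] t by (auto simp: CR_def)
    have "cyclic_towers k {} (gs k)"
      using suspension_copies_cyclic_towers[OF gs[OF k(1)]] g by (simp add: CR_def)
    then show "\<exists>f\<in>gs ` {1..}. simulates l f t" using k by auto
  qed
  then show "t \<in> closure (\<Union>n\<in>{1..}. conj_class (gs n))" by simp
qed

text \<open>A chain from \<open>x\<close> to itself follows the orbit of a nearby periodic point
  \<open>y\<close>. Twice the period of \<open>y\<close> is used as length, so that the jump
  from \<open>f x\<close> to \<open>f y\<close> and the jump to \<open>x\<close> occur at
  different steps.\<close>

lemma dense_periodic_points_CR:
  fixes f :: "'a::metric_space \<Rightarrow>\<^sub>C 'a"
  assumes f: "f \<in> H" "closure (periodic_points f) = UNIV"
  shows "f \<in> CR"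
proof -
  have "surj f" using f(1) self_homeo_surjD by (auto simp: H_def)
  moreover have "chain_recurrent f"
    unfolding chain_recurrent_def
  proof (intro allI impI)
    fix e :: real and x assume "e > 0"
    have "continuous_on UNIV f" by simp
    then obtain d where d: "d > 0" "\<And>y. dist y x < d \<Longrightarrow> dist (f y) (f x) < e"
      using \<open>e > 0\<close> unfolding continuous_on_iff by (metis UNIV_I)
    have "x \<in> closure (periodic_points f)" using f(2) by simp
    then obtain y where y: "y \<in> periodic_points f" "dist y x < min d e"
      unfolding closure_approachable using d(1) \<open>e > 0\<close> by (meson min_less_iff_conj)
    then obtain m where m: "m \<ge> 1" "(apply_bcontfun f ^^ m) y = y" by (auto simp: periodic_points_def)
    define n where "n = m + m"
    have n: "n \<ge> 2" "(apply_bcontfun f ^^ n) y = y" using m by (auto simp: n_def funpow_add)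
    define s where "s i = (if i = 0 \<or> i = n then x else (apply_bcontfun f ^^ i) y)" for i
    have "dist (f (s i)) (s (Suc i)) < e" if i: "i < n" for i
    proof -
      consider "i = 0" | "Suc i = n" "i \<noteq> 0" | "i \<noteq> 0" "Suc i < n" using i by linarith
      then show ?thesis
      proof cases
        case 1
        then show ?thesis using n d(2)[of y] y(2) by (simp add: s_def dist_commute)
      next
        case 2
        then have "f (s i) = (apply_bcontfun f ^^ n) y" by (auto simp: s_def)
        then show ?thesis using n y(2) 2 by (simp add: s_def)
      next
        case 3
        then show ?thesis using \<open>e > 0\<close> by (simp add: s_def)
      qed
    qed
    then show "\<exists>n\<ge>1. \<exists>s. s 0 = x \<and> s n = x \<and> (\<forall>i<n. dist (f (s i)) (s (Suc i)) < e)"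
      using n(1) by (intro exI[of _ n] conjI exI[of _ s]) (auto simp: s_def)
  qed
  ultimately show ?thesis by (simp add: CR_def Cs_def)
qed

lemma periodic_map_homeo:
  fixes f :: "'a::metric_space \<Rightarrow>\<^sub>C 'a"
  assumes "N \<ge> 1" "\<And>x. (apply_bcontfun f ^^ N) x = x"
  shows "f \<in> H" "periodic_points f = UNIV"
proof -
  show "periodic_points f = UNIV" using assms by (auto simp: periodic_points_def)
  have cont: "continuous_on UNIV (apply_bcontfun f ^^ i)" for i
    by (induction i) (auto intro: continuous_on_compose2[of UNIV])
  have eq: "N = Suc (N - 1)" using assms(1) by simp
  have 1: "f ((apply_bcontfun f ^^ (N - 1)) x) = x" for x
    using assms(2)[of x] by (subst (asm) eq) simp
  have 2: "(apply_bcontfun f ^^ (N - 1)) (f x) = x" for x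
    using assms(2)[of x] by (subst (asm) eq) (simp add: funpow_swap1)
  have "homeomorphism UNIV UNIV f (apply_bcontfun f ^^ (N - 1))"
    by (rule homeomorphismI) (use 1 2 cont in auto)
  then show "f \<in> H" by (auto simp: H_def self_homeo_def)
qed

lemma tower_id_iterate:
  assumes "1 \<le> i" "i \<le> N"
  shows "(tower N id ^^ k) ((x, i), j) = ((x, Suc ((i - 1 + k) mod N)), j)"
proof (induction k)
  case 0
  then show ?case using assms by simp
next
  case (Suc k)
  have "N > 0" using assms by simp
  show ?case
  proof (cases "Suc ((i - 1 + k) mod N) < N")
    case True
    then show ?thesis using Suc by (simp add: tower_simp mod_Suc)
  next
    case False
    moreover have "(i - 1 + k) mod N < N" using \<open>N > 0\<close> by simp
    ultimately have "Suc ((i - 1 + k) mod N) = N" by linarith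
    then show ?thesis using Suc by (simp add: tower_simp mod_Suc)
  qed
qed

text \<open>The suspensions of the identity are periodic homeomorphisms, and their conjugates are
  dense by \<open>suspension_copies_dense\<close>.\<close>

theorem dense_periodic_points_dense:
  assumes X: "cantor_space (UNIV :: 'a::metric_space set)"
  shows "dense_subset {f \<in> (H :: ('a \<Rightarrow>\<^sub>C 'a) set). closure (periodic_points (apply_bcontfun f)) = UNIV} CR"
    (is "dense_subset ?K1 _")
proof -
  have cpt: "compact (UNIV :: 'a set)" using X by (rule cantor_compact)
  obtain e :: "'a \<Rightarrow>\<^sub>C 'a" where e: "apply_bcontfun e = id" and "e \<in> CR" using identity_CR[OF cpt] .
  then have "e \<in> Cs" by (simp add: CR_def)
  have "\<forall>n. \<exists>f. n \<ge> 1 \<longrightarrow> suspension_copies e n f" using suspension_copies_exists[OF X \<open>e \<in> Cs\<close>] by blast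
  then obtain gs where gs: "\<And>n. n \<ge> 1 \<Longrightarrow> suspension_copies e n (gs n)" by metis
  have "conj_class (gs n) \<subseteq> ?K1" if n: "n \<ge> 1" for n
  proof
    fix f assume "f \<in> conj_class (gs n)"
    then obtain h k where hk: "homeomorphism UNIV UNIV h k" "\<And>x. f (h x) = h (gs n x)"
      unfolding conj_class_iff by blast
    define N :: nat where "N = fact n"
    let ?Y = "tower_space N n :: (('a \<times> nat) \<times> nat) set"
    obtain \<phi> \<psi> where hom: "homeomorphism ?Y UNIV \<phi> \<psi>"
      and semi: "\<And>y. y \<in> ?Y \<Longrightarrow> \<phi> (tower N (apply_bcontfun e) y) = gs n (\<phi> y)"
      by (rule suspension_copiesE[OF gs[OF n], folded N_def]) (rule that)
    define F where "F = tower N (apply_bcontfun e)"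
    have F: "F ` ?Y = ?Y" unfolding F_def by (rule tower_image) (simp_all add: N_def e)
    have it: "(apply_bcontfun (gs n) ^^ r) (\<phi> y) = \<phi> ((F ^^ r) y) \<and> (F ^^ r) y \<in> ?Y" if y: "y \<in> ?Y" for r y
    proof (induction r)
      case (Suc r)
      then show ?case using F semi[of "(F ^^ r) y"] by (auto simp: F_def[symmetric])
    qed (use y in simp)
    have "(apply_bcontfun (gs n) ^^ N) z = z" for z
    proof -
      obtain y where y: "y \<in> ?Y" "z = \<phi> y" using hom by (metis UNIV_I homeomorphism_def imageE)
      obtain x i j where p: "y = ((x, i), j)" by (metis prod.exhaust)
      have "1 \<le> i" "i \<le> N" using y p by (auto simp: tower_space_def)
      then have "Suc ((i - 1 + N) mod N) = i" by (subst mod_add_self2) simp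
      then have "(F ^^ N) y = y"
        unfolding p F_def e using \<open>1 \<le> i\<close> \<open>i \<le> N\<close> by (simp add: tower_id_iterate)
      then show ?thesis using it[OF y(1), of N] y(2) by simp
    qed
    then have "(apply_bcontfun f ^^ N) (h x) = h x" for x
      using iterates_semiconj[of f h "gs n" N x] hk(2) by simp
    moreover have "surj h" using homeomorphism_image1[OF hk(1)] .
    ultimately have "(apply_bcontfun f ^^ N) z = z" for z by (metis surjD)
    moreover have "N \<ge> 1" by (simp add: N_def)
    ultimately show "f \<in> ?K1" using periodic_map_homeo[of N f] by simp
  qed
  then have "(\<Union>n\<in>{1..}. conj_class (gs n)) \<subseteq> ?K1" by auto
  then have "closure (\<Union>n\<in>{1..}. conj_class (gs n)) \<subseteq> closure ?K1" by (rule closure_mono)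
  moreover have "CR \<subseteq> closure (\<Union>n\<in>{1..}. conj_class (gs n))"
    using suspension_copies_dense[OF X \<open>e \<in> CR\<close> gs] unfolding dense_subset_def by blast
  ultimately have "CR \<subseteq> closure ?K1" by (rule order_trans[rotated])
  moreover have "?K1 \<subseteq> CR" using dense_periodic_points_CR by blast
  ultimately show ?thesis by (simp add: dense_subset_def)
qed

theorem theorem4p9:
  assumes "cantor_space (UNIV :: 'a::metric_space set)"
  shows
    "(conj_transitive (CR :: ('a \<Rightarrow>\<^sub>C 'a) set) \<and>
        (\<exists>f :: 'a \<Rightarrow>\<^sub>C 'a. transitive_element CR f \<and> residual_type CR f)) \<and>
     (\<forall>g \<in> (CR :: ('a \<Rightarrow>\<^sub>C 'a) set).
        (\<forall>n\<ge>1. \<exists>f. suspension_copies g n f) \<and>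
        (\<forall>gs :: nat \<Rightarrow> ('a \<Rightarrow>\<^sub>C 'a). (\<forall>n\<ge>1. suspension_copies g n (gs n)) \<longrightarrow>
           dense_subset (\<Union>n\<in>{1..}. conj_class (gs n)) CR)) \<and>
     dense_subset {f \<in> (H :: ('a \<Rightarrow>\<^sub>C 'a) set). closure (periodic_points (apply_bcontfun f)) = UNIV} CR \<and>
     (\<forall>Q \<subseteq> {1..}. conj_transitive (Cs_Per Q \<inter> CR :: ('a \<Rightarrow>\<^sub>C 'a) set)) \<and>
     (\<exists>f :: 'a \<Rightarrow>\<^sub>C 'a. transitive_element CR1 f \<and> residual_type CR1 f)"
proof (intro conjI ballI allI impI)
  show "\<exists>f :: 'a \<Rightarrow>\<^sub>C 'a. transitive_element CR f \<and> residual_type CR f"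
    using assms by (rule CR_generic)
  then show "conj_transitive (CR :: ('a \<Rightarrow>\<^sub>C 'a) set)"
    unfolding conj_transitive_def by blast
  show "dense_subset {f \<in> (H :: ('a \<Rightarrow>\<^sub>C 'a) set). closure (periodic_points (apply_bcontfun f)) = UNIV} CR"
    using assms by (rule dense_periodic_points_dense)
  show "\<exists>f :: 'a \<Rightarrow>\<^sub>C 'a. transitive_element CR1 f \<and> residual_type CR1 f"
    using assms by (rule CR1_generic)
  show "conj_transitive (Cs_Per Q \<inter> CR :: ('a \<Rightarrow>\<^sub>C 'a) set)" if "Q \<subseteq> {1..}" for Q
    using assms that by (rule conj_transitive_Cs_Per_CR)
  fix g :: "'a \<Rightarrow>\<^sub>C 'a" assume g: "g \<in> CR"
  show "\<exists>f. suspension_copies g n f" if "1 \<le> n" for n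
    using suspension_copies_exists[OF assms _ that] g by (simp add: CR_def)
  show "dense_subset (\<Union>n\<in>{1..}. conj_class (gs n)) CR" if "\<forall>n\<ge>1. suspension_copies g n (gs n)" for gs
    using suspension_copies_dense[OF assms g] that by blast
qed

end
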